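(* Suppose that the Foster--Lyapunov drift condition (Condition 1 of the context) holds with constant $b$, finite set $\mathbb{C}$ and vector $v$. Then, for every $\beta>0$ and every choice of probability vectors $\alpha_n$ on $\mathbb{M}_n$ ($n\in\mathbb{Z}_+$), $$\|{}_{(n)}\widehat{\pi}-\pi\|\le E(n),\qquad n\in\mathbb{Z}_+,$$ where $$E(n)=\frac{2}{\alpha_n u_n^*}\left\{\alpha_n\left(v_n+\sum_{k=0}^n U_{n,k}^*\sum_{\ell=n+1}^\infty Q_{k,\ell}v_\ell\right)+\frac{2b}{\beta\,\overline{\phi}_{\mathbb{C}}^{(\beta)}}\right\},\qquad n\in\mathbb{Z}_+.$$
   Context: Notation: $\mathbb{N}=\{1,2,\dots\}$, $\mathbb{Z}_+=\{0,1,2,\dots\}$, $\mathbb{Z}_n=\{0,1,\dots,n\}$. For each $k\in\mathbb{Z}_+$ let $M_k\in\mathbb{N}$, $\mathbb{M}_k=\{1,\dots,M_k\}$, $\mathbb{L}_k=\{k\}\times\mathbb{M}_k$, $\mathbb{S}=\bigcup_{k\ge0}\mathbb{L}_k$, $\mathbb{S}_n=\bigcup_{k=0}^n\mathbb{L}_k$. $e$ is the column vector of ones of appropriate size; row vectors multiply from the left. Finite vectors are extended by zeros to infinite vectors when necessary. For a vector $m$, $\|m\|=\sum_i|m(i)|$. Standing assumptions: $Q=(q(k,i;\ell,j))$ is the stable, conservative ($Qe=0$) generator of a regular-jump (non-explosive) continuous-time Markov chain $\{(X(t),J(t))\}$ on $\mathbb{S}$; it is ergodic (irreducible and positive recurrent)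 and upper block-Hessenberg: writing $Q_{k,\ell}$ for the $\mathbb{L}_k\times\mathbb{L}_\ell$ block, $Q_{k,\ell}=O$ whenever $\ell<k-1$. $\pi$ is its unique stationary distribution (row) vector: $\pi Q=0$, $\pi e=1$, $\pi>0$. Truncation: ${}_{(n)}Q$ is the restriction of $Q$ to $\mathbb{S}_n\times\mathbb{S}_n$; the inverse $(-{}_{(n)}Q)^{-1}$ exists, and its $\mathbb{L}_k\times\mathbb{L}_\ell$ block is denoted ${}_{(n)}X_{k,\ell}$. For a probability (row) vector $\alpha_n$ on $\mathbb{M}_n$, let ${}_{(n)}\widehat\alpha=(0,\dots,0,\alpha_n)$ be the probability vector on $\mathbb{S}_n$ supported on $\mathbb{L}_n$, and let $${}_{(n)}\widehat\pi=\frac{{}_{(n)}\widehat\alpha(-{}_{(n)}Q)^{-1}}{{}_{(n)}\widehat\alpha(-{}_{(n)}Q)^{-1}e}$$ (the last-block-column-linearly-augmented truncation approximation to $\pi$; it is a stationary distribution vector of ${}_{(n)}Q-{}_{(n)}Qe\,{}_{(n)}\widehat\alpha$). Matrices: $U_n^*={}_{(n)}X_{n,n}$; $U_{n,k}=Q_{n,n-1}\,{}_{(n-1)}X_{n-1,k}$ for $0\le k\le n-1$ and $U_{n,n}=I$; $U_{n,k}^*=U_n^*U_{n,k}$ for $k\in\mathbb{Z}_n$; $u_n^*=\sum_{\ell=0}^nU_{n,\ell}^*e$ (one has $u_n^*>0$). Condition 1: $Q$ is irreducible, and there exist a constant $b\in(0,\infty)$, a finite set $\mathbb{C}\subset\mathbb{S}$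 and a positive column vector $v=(v(k,i))_{(k,i)\in\mathbb{S}}$ with $\inf_{(k,i)\in\mathbb{S}}v(k,i)>0$ and $Qv\le -e+b\,1_{\mathbb{C}}$, where $1_{\mathbb{C}}$ is the column vector with entries $1$ on $\mathbb{C}$ and $0$ on $\mathbb{S}\setminus\mathbb{C}$. Write $v_n=(v(n,i))_{i\in\mathbb{M}_n}$. For $\beta>0$: $\Phi^{(\beta)}=(\phi^{(\beta)}(k,i;\ell,j))=\int_0^\infty\beta e^{-\beta t}P^{(t)}\,dt$, where $P^{(t)}$ is the transition matrix function of the chain with generator $Q$, and $\overline\phi_{\mathbb{C}}^{(\beta)}=\sup_{(\ell,j)\in\mathbb{S}}\min_{(k,i)\in\mathbb{C}}\phi^{(\beta)}(k,i;\ell,j)>0$. *)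

theory Defs
  imports "HOL-Probability.Probability"
begin

section \<open>State space\<close>

definition level :: "(nat \<Rightarrow> nat) \<Rightarrow> nat \<Rightarrow> (nat \<times> nat) set" where
  "level M k = {k} \<times> {1..M k}"

definition states :: "(nat \<Rightarrow> nat) \<Rightarrow> (nat \<times> nat) set" where
  "states M = (\<Union>k. level M k)"

definition states_upto :: "(nat \<Rightarrow> nat) \<Rightarrow> nat \<Rightarrow> (nat \<times> nat) set" where
  "states_upto M n = (\<Union>k\<le>n. level M k)"

section \<open>Continuous-time Markov chains and their generators\<close>

text \<open>
  A chain on a set \<open>S\<close> is given by one process \<open>X\<close> together with a family of laws \<open>Pr x\<close>,
  one for each initial state \<open>x\<close>.
\<close>

definition trans_prob :: "('s \<Rightarrow> 'w measure) \<Rightarrow> (real \<Rightarrow> 'w \<Rightarrow> 's) \<Rightarrow> real \<Rightarrow> 's \<Rightarrow> 's \<Rightarrow> real" where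
  "trans_prob Pr X t x y = \<P>(\<omega> in Pr x. X t \<omega> = y)"

definition markov_chain :: "'s set \<Rightarrow> ('s \<Rightarrow> 'w measure) \<Rightarrow> (real \<Rightarrow> 'w \<Rightarrow> 's) \<Rightarrow> bool" where
  "markov_chain S Pr X \<longleftrightarrow>
     (\<forall>x\<in>S. prob_space (Pr x)
        \<and> (\<forall>t\<ge>0. X t \<in> Pr x \<rightarrow>\<^sub>M count_space S)
        \<and> \<P>(\<omega> in Pr x. X 0 \<omega> = x) = 1
        \<and> (\<forall>n (t :: nat \<Rightarrow> real) (z :: nat \<Rightarrow> 's).
             0 \<le> t 0 \<longrightarrow> (\<forall>i\<le>n. t i < t (Suc i)) \<longrightarrow> (\<forall>i\<le>Suc n. z i \<in> S) \<longrightarrow>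
             \<P>(\<omega> in Pr x. \<forall>i\<le>n. X (t i) \<omega> = z i) \<noteq> 0 \<longrightarrow>
             \<P>(\<omega> in Pr x. X (t (Suc n)) \<omega> = z (Suc n) \<bar> \<forall>i\<le>n. X (t i) \<omega> = z i)
               = trans_prob Pr X (t (Suc n) - t n) (z n) (z (Suc n))))"

text \<open>
  A right-continuous path (for the discrete topology on the states) that has only finitely many
  discontinuities in every bounded time interval, i.e. that does not explode.
\<close>

definition regular_jump_path :: "(real \<Rightarrow> 's) \<Rightarrow> bool" where
  "regular_jump_path f \<longleftrightarrow>
     (\<forall>t\<ge>0. \<forall>\<^sub>F s in at_right t. f s = f t)
   \<and> (\<forall>T. finite {t \<in> {0<..T}. \<not> (\<forall>\<^sub>F s in at_left t. f s = f t)})"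

definition regular_jump_chain ::
  "'s set \<Rightarrow> ('s \<Rightarrow> 'w measure) \<Rightarrow> (real \<Rightarrow> 'w \<Rightarrow> 's) \<Rightarrow> bool" where
  "regular_jump_chain S Pr X \<longleftrightarrow>
     markov_chain S Pr X \<and> (\<forall>x\<in>S. AE \<omega> in Pr x. regular_jump_path (\<lambda>t. X t \<omega>))"

definition is_generator ::
  "'s set \<Rightarrow> ('s \<Rightarrow> 'w measure) \<Rightarrow> (real \<Rightarrow> 'w \<Rightarrow> 's) \<Rightarrow> ('s \<Rightarrow> 's \<Rightarrow> real) \<Rightarrow> bool" where
  "is_generator S Pr X q \<longleftrightarrow>
     (\<forall>x\<in>S. \<forall>y\<in>S.
        ((\<lambda>h. (trans_prob Pr X h x y - of_bool (x = y)) / h) \<longlongrightarrow> q x y) (at_right 0))"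

text \<open>
  Stability, i.e. finiteness of the diagonal entries, is built into the real-valuedness of \<open>q\<close>.
\<close>

definition stable_conservative :: "'s set \<Rightarrow> ('s \<Rightarrow> 's \<Rightarrow> real) \<Rightarrow> bool" where
  "stable_conservative S q \<longleftrightarrow>
     (\<forall>x\<in>S. \<forall>y\<in>S. x \<noteq> y \<longrightarrow> 0 \<le> q x y) \<and> (\<forall>x\<in>S. (q x has_sum 0) S)"

definition irreducible_generator :: "'s set \<Rightarrow> ('s \<Rightarrow> 's \<Rightarrow> real) \<Rightarrow> bool" where
  "irreducible_generator S q \<longleftrightarrow>
     (\<forall>x\<in>S. \<forall>y\<in>S. (x, y) \<in> {(a, b). a \<in> S \<and> b \<in> S \<and> a \<noteq> b \<and> 0 < q a b}\<^sup>*)"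

text \<open>
  The first time at which the path is in \<open>x\<close> after having been outside \<open>x\<close>
  (infinite if there is none).
\<close>

definition return_time :: "(real \<Rightarrow> 'w \<Rightarrow> 's) \<Rightarrow> 's \<Rightarrow> 'w \<Rightarrow> ennreal" where
  "return_time X x \<omega> = (INF t\<in>{t. 0 < t \<and> X t \<omega> = x \<and> (\<exists>s\<in>{0..t}. X s \<omega> \<noteq> x)}. ennreal t)"

definition positive_recurrent ::
  "'s set \<Rightarrow> ('s \<Rightarrow> 'w measure) \<Rightarrow> (real \<Rightarrow> 'w \<Rightarrow> 's) \<Rightarrow> bool" where
  "positive_recurrent S Pr X \<longleftrightarrow> (\<forall>x\<in>S. (\<integral>\<^sup>+ \<omega>. return_time X x \<omega> \<partial>Pr x) < \<infinity>)"

definition ergodic_chain ::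
  "'s set \<Rightarrow> ('s \<Rightarrow> 'w measure) \<Rightarrow> (real \<Rightarrow> 'w \<Rightarrow> 's) \<Rightarrow> ('s \<Rightarrow> 's \<Rightarrow> real) \<Rightarrow> bool" where
  "ergodic_chain S Pr X q \<longleftrightarrow> irreducible_generator S q \<and> positive_recurrent S Pr X"

definition stationary_distribution :: "'s set \<Rightarrow> ('s \<Rightarrow> 's \<Rightarrow> real) \<Rightarrow> ('s \<Rightarrow> real) \<Rightarrow> bool" where
  "stationary_distribution S q p \<longleftrightarrow>
     (\<forall>x\<in>S. 0 < p x) \<and> (p has_sum 1) S \<and> (\<forall>y\<in>S. ((\<lambda>x. p x * q x y) has_sum 0) S)"

definition upper_block_hessenberg ::
  "(nat \<Rightarrow> nat) \<Rightarrow> (nat \<times> nat \<Rightarrow> nat \<times> nat \<Rightarrow> real) \<Rightarrow> bool" where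
  "upper_block_hessenberg M q \<longleftrightarrow>
     (\<forall>k l. l + 1 < k \<longrightarrow> (\<forall>x\<in>level M k. \<forall>y\<in>level M l. q x y = 0))"

section \<open>Drift condition and resolvent kernel\<close>

text \<open>
  The off-diagonal part of each row of \<open>Q v\<close> is a sum of nonnegative terms, so the inequality
  \<open>Q v \<le> - e + b 1\<^sub>C\<close> includes the convergence of these sums.  This is spelled out because
  \<open>infsum\<close> is \<open>0\<close> for divergent sums.
\<close>

definition drift_condition ::
  "'s set \<Rightarrow> ('s \<Rightarrow> 's \<Rightarrow> real) \<Rightarrow> real \<Rightarrow> 's set \<Rightarrow> ('s \<Rightarrow> real) \<Rightarrow> bool" where
  "drift_condition S q b C v \<longleftrightarrow>
     irreducible_generator S q
   \<and> 0 < b \<and> finite C \<and> C \<subseteq> S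
   \<and> (\<forall>x\<in>S. 0 < v x) \<and> 0 < (INF x\<in>S. v x)
   \<and> (\<forall>x\<in>S. (\<lambda>y. q x y * v y) summable_on S
            \<and> (\<Sum>\<^sub>\<infinity>y\<in>S. q x y * v y) \<le> - 1 + b * indicator C x)"

definition resolvent_kernel ::
  "('s \<Rightarrow> 'w measure) \<Rightarrow> (real \<Rightarrow> 'w \<Rightarrow> 's) \<Rightarrow> real \<Rightarrow> 's \<Rightarrow> 's \<Rightarrow> real" where
  "resolvent_kernel Pr X \<beta> x y = (LBINT t:{0..}. \<beta> * exp (- \<beta> * t) * trans_prob Pr X t x y)"

definition phi_bar ::
  "'s set \<Rightarrow> ('s \<Rightarrow> 'w measure) \<Rightarrow> (real \<Rightarrow> 'w \<Rightarrow> 's) \<Rightarrow> 's set \<Rightarrow> real \<Rightarrow> real" where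
  "phi_bar S Pr X C \<beta> = (SUP y\<in>S. Min ((\<lambda>x. resolvent_kernel Pr X \<beta> x y) ` C))"

section \<open>Truncation and the matrices of the error bound\<close>

text \<open>
  The inverse of a finite matrix indexed by \<open>A\<close>, extended by zeros outside \<open>A\<close>.  The zero
  extension makes the inverse unique as a function.
\<close>

definition matrix_inverse_on :: "'s set \<Rightarrow> ('s \<Rightarrow> 's \<Rightarrow> real) \<Rightarrow> 's \<Rightarrow> 's \<Rightarrow> real" where
  "matrix_inverse_on A f = (THE g.
     (\<forall>x y. x \<notin> A \<or> y \<notin> A \<longrightarrow> g x y = 0)
   \<and> (\<forall>x\<in>A. \<forall>y\<in>A. (\<Sum>z\<in>A. f x z * g z y) = of_bool (x = y))
   \<and> (\<forall>x\<in>A. \<forall>y\<in>A. (\<Sum>z\<in>A. g x z * f z y) = of_bool (x = y)))"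

context
  fixes M :: "nat \<Rightarrow> nat" and q :: "nat \<times> nat \<Rightarrow> nat \<times> nat \<Rightarrow> real"
begin

definition trunc_inv :: "nat \<Rightarrow> nat \<times> nat \<Rightarrow> nat \<times> nat \<Rightarrow> real" where
  "trunc_inv n = matrix_inverse_on (states_upto M n) (\<lambda>x y. - q x y)"

definition prob_vector_on_phases :: "nat \<Rightarrow> (nat \<Rightarrow> real) \<Rightarrow> bool" where
  "prob_vector_on_phases n a \<longleftrightarrow> (\<forall>i\<in>{1..M n}. 0 \<le> a i) \<and> (\<Sum>i=1..M n. a i) = 1"

definition alpha_hat :: "nat \<Rightarrow> (nat \<Rightarrow> real) \<Rightarrow> nat \<times> nat \<Rightarrow> real" where
  "alpha_hat n a x = (if x \<in> level M n then a (snd x) else 0)"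

text \<open>As \<open>trunc_inv n\<close> vanishes outside \<open>states_upto M n\<close>, so does \<open>pi_hat n a\<close>.\<close>

definition pi_hat :: "nat \<Rightarrow> (nat \<Rightarrow> real) \<Rightarrow> nat \<times> nat \<Rightarrow> real" where
  "pi_hat n a y =
     (\<Sum>x\<in>states_upto M n. alpha_hat n a x * trunc_inv n x y) /
     (\<Sum>z\<in>states_upto M n. \<Sum>x\<in>states_upto M n. alpha_hat n a x * trunc_inv n x z)"

text \<open>
  Blocks are functions of the two phases; \<open>U_mat n k\<close> and \<open>U_star n k\<close> are meant for \<open>k \<le> n\<close>.
\<close>

definition U_mat :: "nat \<Rightarrow> nat \<Rightarrow> nat \<Rightarrow> nat \<Rightarrow> real" where
  "U_mat n k i j =
     (if k < n then \<Sum>h=1..M (n - 1). q (n, i) (n - 1, h) * trunc_inv (n - 1) (n - 1, h) (k, j)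
      else of_bool (i = j))"

definition U_star :: "nat \<Rightarrow> nat \<Rightarrow> nat \<Rightarrow> nat \<Rightarrow> real" where
  "U_star n k i j = (\<Sum>h=1..M n. trunc_inv n (n, i) (n, h) * U_mat n k h j)"

definition u_star :: "nat \<Rightarrow> nat \<Rightarrow> real" where
  "u_star n i = (\<Sum>l=0..n. \<Sum>j=1..M l. U_star n l i j)"

definition error_bound ::
  "(nat \<times> nat \<Rightarrow> real) \<Rightarrow> real \<Rightarrow> real \<Rightarrow> real \<Rightarrow> (nat \<Rightarrow> real) \<Rightarrow> nat \<Rightarrow> real" where
  "error_bound v b \<beta> \<phi> a n =
     2 / (\<Sum>i=1..M n. a i * u_star n i) *
     ((\<Sum>i=1..M n. a i *
         (v (n, i) + (\<Sum>k=0..n. \<Sum>j=1..M k. U_star n k i j *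
            (\<Sum>\<^sub>\<infinity>l\<in>{n+1..}. \<Sum>h=1..M l. q (k, j) (l, h) * v (l, h)))))
      + 2 * b / (\<beta> * \<phi>))"

end

end

theory Submission
  imports Defs
begin

text \<open>
  Let \<open>p\<close> be the truncated approximation and \<open>g\<close> the indicator of the set where \<open>p \<ge> \<pi>\<close>.  As both
  vectors have mass one, the distance of \<open>p\<close> and \<open>\<pi>\<close> is twice \<open>p g - \<pi> g\<close>.  If \<open>h\<close> solves Poisson's
  equation \<open>Q h = - (g - \<pi> g)\<close>, this difference is \<open>- p Q h\<close>, and \<open>p Q\<close> is explicit: \<open>p\<close> is
  proportional to \<open>\<alpha> (- Q\<^sub>n)\<^sup>-\<^sup>1\<close>, so with \<open>N = \<alpha>\<^sub>n u\<^sub>n\<close> the row \<open>N p Q\<close> equals \<open>- \<alpha>\<close> on the truncated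
  space and outside it equals the flow out of the truncated space, which again has total mass one.
  Hence every bound \<open>\<bar>h\<bar> \<le> v + c\<close> gives half of the error bound, with \<open>2 c\<close> as its additive constant
  (lemma \<open>truncation_error\<close>).

  A good \<open>h\<close> is the expected integral of \<open>g - \<pi> g\<close> up to the first visit to a reference state \<open>y\<close>;
  its modulus is at most the expected hitting time of \<open>y\<close>.  By the drift condition the latter is at
  most \<open>v\<close> plus \<open>b\<close> times the expected time spent in \<open>C\<close> before \<open>y\<close>.  That time is at most
  \<open>1 / (\<beta> \<phi>)\<close>, where \<open>\<phi>\<close> is the minimum over \<open>C\<close> of the resolvent kernel at \<open>y\<close>
  (lemma \<open>occupation_bound\<close>): wait an independent exponential time of rate \<open>\<beta>\<close>; in its course the
  mean time in \<open>C\<close> is at most \<open>1 / \<beta>\<close>, at its end the chain is in \<open>y\<close> with probability at least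
  \<open>\<phi>\<close>, and otherwise one starts afresh.  The best choice of \<open>y\<close> turns \<open>\<phi>\<close> into \<open>phi_bar\<close>.

  These expectations are not computed from paths.  They are limits of solutions of linear systems on
  finite sets \<open>E m - {y}\<close>, where \<open>E m\<close> exhausts the state space; comparisons between such solutions
  follow from the minimum principle for \<open>\<gamma> - Q\<close> restricted to a finite set.  The resolvent kernel
  takes part in them through the inequality \<open>(\<beta> - Q) \<phi> \<ge> \<beta> I\<close> (lemma \<open>resolvent_supersolution\<close>).  With \<open>h\<^sub>m\<close> for the
  solution on \<open>E m - {y}\<close>, it is enough that \<open>Q h\<^sub>m\<close> converges pointwise to \<open>- (g - \<pi> g)\<close>
  (lemma \<open>poisson_approximation\<close>).  Away from \<open>y\<close> this is an identity.  At \<open>y\<close> it says that \<open>\<pi>\<close> is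
  proportional to the expected occupation of the states during a cycle from \<open>y\<close> to \<open>y\<close>, which holds
  because the cycle is completed with probability one.

  Completion of the cycle combines finite mean hitting times with non-explosion, used in the form
  \<open>\<gamma> (\<gamma> - Q\<^sub>m)\<^sup>-\<^sup>1 1 \<longlonglongrightarrow> 1\<close> with \<open>Q\<^sub>m\<close> the restriction of \<open>Q\<close> to \<open>E m\<close> (lemma \<open>nonexplosion\<close>).  This is
  where the regularity of the paths is used: on a bounded time interval a path visits finitely many
  states, hence stays in \<open>E m\<close> with probability close to one, and observing the chain along finer and
  finer meshes turns this probability into a lower bound for the finite resolvent.

  All of this concerns an arbitrary finite truncation.  For a block-Hessenberg generator, block
  elimination gives \<open>U\<^sup>*\<^sub>n\<^sub>,\<^sub>k\<close> as the blocks in the last block row of \<open>(- Q\<^sub>n)\<^sup>-\<^sup>1\<close>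
  (lemma \<open>U_star_eq_trunc_inv\<close>), which brings the bound into its final form.
\<close>

section \<open>Generators killed outside a finite set\<close>

locale irreducible_rates =
  fixes S :: "'s set" and q :: "'s \<Rightarrow> 's \<Rightarrow> real"
  assumes infinite_states: "infinite S"
    and rates: "stable_conservative S q"
    and irreducible: "irreducible_generator S q"
begin

lemma rate_nonneg: "x \<in> S \<Longrightarrow> y \<in> S \<Longrightarrow> x \<noteq> y \<Longrightarrow> 0 \<le> q x y"
  using rates by (auto simp: stable_conservative_def)

lemma row_has_sum: "x \<in> S \<Longrightarrow> (q x has_sum 0) S"
  using rates by (auto simp: stable_conservative_def)

lemma exit_rate:
  assumes "finite A" "A \<subseteq> S" "x \<in> S"
  shows "(q x has_sum - (\<Sum>z\<in>A. q x z)) (S - A)"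
  using has_sum_Diff[OF row_has_sum[OF assms(3)] has_sum_finite[OF assms(1)] assms(2)] by simp

lemma row_sum_nonpos:
  assumes "finite A" "A \<subseteq> S" "x \<in> A"
  shows "(\<Sum>z\<in>A. q x z) \<le> 0"
proof -
  have "x \<in> S" using assms by auto
  hence "0 \<le> - (\<Sum>z\<in>A. q x z)"
    by (intro has_sum_nonneg[OF exit_rate[OF assms(1,2)]] rate_nonneg) (use assms(3) in auto)
  thus ?thesis by simp
qed

text \<open>
  The function \<open>(\<gamma> - Q\<^sub>A) h\<close>, where \<open>Q\<^sub>A\<close> is the restriction of the generator to \<open>A\<close>.  In terms of the
  chain, \<open>\<gamma>\<close> is the rate of an additional killing clock and leaving \<open>A\<close> kills as well.
\<close>

definition shifted :: "real \<Rightarrow> 's set \<Rightarrow> ('s \<Rightarrow> real) \<Rightarrow> 's \<Rightarrow> real" where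
  "shifted \<gamma> A h x = \<gamma> * h x - (\<Sum>z\<in>A. q x z * h z)"

text \<open>
  The inverse of \<open>\<gamma> - Q\<^sub>A\<close>: its entry at \<open>x\<close>, \<open>y\<close> is the expected time that the killed chain started in
  \<open>x\<close> spends in \<open>y\<close>.  Thus \<open>green_fun 0 A (\<lambda>_. 1)\<close> is the mean exit time from \<open>A\<close>, and
  \<open>green_fun \<gamma> A (\<lambda>_. \<gamma>)\<close> is the probability that the clock of rate \<open>\<gamma>\<close> rings before the exit.
\<close>

definition green :: "real \<Rightarrow> 's set \<Rightarrow> 's \<Rightarrow> 's \<Rightarrow> real" where
  "green \<gamma> A = matrix_inverse_on A (\<lambda>x y. (if x = y then \<gamma> else 0) - q x y)"

definition green_fun :: "real \<Rightarrow> 's set \<Rightarrow> ('s \<Rightarrow> real) \<Rightarrow> 's \<Rightarrow> real" where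
  "green_fun \<gamma> A f x = (\<Sum>z\<in>A. green \<gamma> A x z * f z)"

lemma shifted_diff: "shifted \<gamma> A (\<lambda>x. h x - k x) x = shifted \<gamma> A h x - shifted \<gamma> A k x"
  by (simp add: shifted_def algebra_simps sum_subtractf)

lemma shifted_add: "shifted \<gamma> A (\<lambda>x. h x + k x) x = shifted \<gamma> A h x + shifted \<gamma> A k x"
  by (simp add: shifted_def algebra_simps sum.distrib)

lemma shifted_scale: "shifted \<gamma> A (\<lambda>x. c * h x) x = c * shifted \<gamma> A h x"
  by (simp add: shifted_def algebra_simps sum_distrib_left)

lemma shifted_matrix:
  assumes "finite A" "x \<in> A"
  shows "(\<Sum>z\<in>A. ((if x = z then \<gamma> else 0) - q x z) * h z) = shifted \<gamma> A h x"
proof -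
  have "(\<Sum>z\<in>A. (if x = z then \<gamma> else 0) * h z) = (\<Sum>z\<in>A. if x = z then \<gamma> * h z else 0)"
    by (intro sum.cong) auto
  also have "\<dots> = \<gamma> * h x" using assms by simp
  finally show ?thesis by (simp add: shifted_def left_diff_distrib sum_subtractf)
qed

text \<open>
  At a state where \<open>h\<close> attains a negative minimum, the hypothesis forces all states reachable in one jump
  to lie in \<open>A\<close> and to be minimisers too.  By irreducibility the minimisers would then include a state
  outside of \<open>A\<close>; such a state exists because \<open>A\<close> is finite and \<open>S\<close> is not.
\<close>

theorem minimum_principle:
  assumes A: "finite A" "A \<subseteq> S" and \<gamma>: "0 \<le> \<gamma>"
    and h: "\<And>x. x \<in> A \<Longrightarrow> 0 \<le> shifted \<gamma> A h x"
    and x: "x \<in> A"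
  shows "0 \<le> h x"
proof (rule ccontr)
  assume neg: "\<not> 0 \<le> h x"
  define c where "c = Min (h ` A)"
  have c_le: "c \<le> h z" if "z \<in> A" for z using that A by (simp add: c_def)
  have c_neg: "c < 0" using c_le[OF x] neg by linarith
  have "c \<in> h ` A" unfolding c_def using A x by (intro Min_in) auto
  then obtain x0 where x0: "x0 \<in> A" "h x0 = c" by auto
  obtain w where w: "w \<in> S" "w \<notin> A"
    using infinite_states A by (meson finite_subset subsetI)
  have closed: "z \<in> A \<and> h z = c"
    if y: "y \<in> A" "h y = c" and z: "z \<in> S" "y \<noteq> z" "0 < q y z" for y z
  proof -
    have yS: "y \<in> S" using y A by auto
    have terms: "0 \<le> q y u * (h u - c)" if "u \<in> A" for u
      using that y c_le A yS by (cases "u = y") (auto intro!: mult_nonneg_nonneg rate_nonneg)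
    have "shifted \<gamma> A h y = \<gamma> * c - (\<Sum>u\<in>A. q y u * (h u - c)) - c * (\<Sum>u\<in>A. q y u)"
      using y by (simp add: shifted_def algebra_simps sum_subtractf sum_distrib_left)
    moreover have "\<gamma> * c \<le> 0" using \<gamma> c_neg by (simp add: mult_nonneg_nonpos)
    moreover have "0 \<le> (\<Sum>u\<in>A. q y u * (h u - c))" using terms by (intro sum_nonneg)
    moreover have "0 \<le> c * (\<Sum>u\<in>A. q y u)"
      using c_neg row_sum_nonpos[OF A y(1)] by (simp add: mult_nonpos_nonpos)
    ultimately have s0: "(\<Sum>u\<in>A. q y u * (h u - c)) = 0" and e0: "c * (\<Sum>u\<in>A. q y u) = 0"
      using h[OF y(1)] by linarith+
    have zA: "z \<in> A"
    proof (rule ccontr)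
      assume zA: "z \<notin> A"
      have "(q y has_sum 0) (S - A)" using exit_rate[OF A yS] e0 c_neg by simp
      moreover have "q y z \<le> 0" if "(q y has_sum 0) (S - A)"
        by (rule has_sum_mono2[OF has_sum_finite[of "{z}" "q y", simplified] that])
          (use zA z y yS A in \<open>auto intro!: rate_nonneg\<close>)
      ultimately show False using z by simp
    qed
    moreover have "q y z * (h z - c) = 0"
      using sum_nonneg_eq_0_iff[THEN iffD1, OF A(1) _ s0] terms zA by blast
    ultimately show ?thesis using z by simp
  qed
  have "(x0, w) \<in> {(a, b). a \<in> S \<and> b \<in> S \<and> a \<noteq> b \<and> 0 < q a b}\<^sup>*"
    using irreducible x0 w A by (auto simp: irreducible_generator_def)
  hence "w \<in> A \<and> h w = c"
  proof (induction rule: rtrancl_induct)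
    case (step y z)
    thus ?case using closed[of y z] by blast
  qed (use x0 in simp)
  thus False using w by simp
qed

lemma kernel_trivial:
  assumes A: "finite A" "A \<subseteq> S" and "0 \<le> \<gamma>"
    and h: "\<And>x. x \<in> A \<Longrightarrow> shifted \<gamma> A h x = 0" and x: "x \<in> A"
  shows "h x = 0"
proof -
  have "0 \<le> h x" using minimum_principle[OF A assms(3), of h] h x by simp
  moreover have "0 \<le> -1 * h x"
    by (rule minimum_principle[OF A assms(3) _ x, where h = "\<lambda>x. -1 * h x"])
      (simp only: shifted_scale h)
  ultimately show ?thesis by simp
qed

text \<open>
  Gaussian elimination.  The minimum principle holds for every subset of \<open>A\<close>, so no pivot vanishes: if
  \<open>u\<close> solves the homogeneous system on \<open>A\<close> with \<open>u a = 1\<close> at a new state \<open>a\<close>, then the residue of \<open>u\<close>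
  at \<open>a\<close> is nonzero, and a multiple of \<open>u\<close> corrects a solution on \<open>A\<close> to one on \<open>insert a A\<close>.
\<close>

lemma solvable:
  assumes "finite A" "A \<subseteq> S" and \<gamma>: "0 \<le> \<gamma>"
  shows "\<exists>h. \<forall>x\<in>A. shifted \<gamma> A h x = f x"
  using assms(1,2)
proof (induction A arbitrary: f rule: finite_induct)
  case (insert a A)
  have A: "finite A" "A \<subseteq> S" and aA: "a \<notin> A" using insert by auto
  have split: "shifted \<gamma> (insert a A) h x = shifted \<gamma> A h x - q x a * h a" for h x
    using A aA by (simp add: shifted_def)
  have upd: "shifted \<gamma> A (h(a := c)) x = shifted \<gamma> A h x" if "x \<in> A" for h c x
  proof -
    have "(\<Sum>z\<in>A. q x z * (h(a := c)) z) = (\<Sum>z\<in>A. q x z * h z)"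
      using aA by (intro sum.cong) auto
    thus ?thesis using that aA by (auto simp: shifted_def)
  qed
  obtain u0 where u0: "\<forall>x\<in>A. shifted \<gamma> A u0 x = q x a"
    using insert.IH[OF A(2), of "\<lambda>x. q x a"] by blast
  obtain w0 where w0: "\<forall>x\<in>A. shifted \<gamma> A w0 x = f x"
    using insert.IH[OF A(2), of f] by blast
  define u where "u = u0(a := 1)"
  define w where "w = w0(a := 0)"
  define p where "p = shifted \<gamma> (insert a A) u a"
  define c where "c = (f a - shifted \<gamma> (insert a A) w a) / p"
  have u: "shifted \<gamma> (insert a A) u x = 0" if "x \<in> A" for x
    using that u0 upd[OF that, of u0 1] by (simp add: split u_def)
  have w: "shifted \<gamma> (insert a A) w x = f x" if "x \<in> A" for x
    using that w0 upd[OF that, of w0 0] by (simp add: split w_def)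
  have p: "p \<noteq> 0"
  proof
    assume "p = 0"
    hence "shifted \<gamma> (insert a A) u x = 0" if "x \<in> insert a A" for x
      using u that by (auto simp: p_def)
    hence "u a = 0"
      by (rule kernel_trivial[OF finite.insertI[OF A(1)] insert.prems \<gamma>]) simp_all
    thus False by (simp add: u_def)
  qed
  have cp: "c * p = f a - shifted \<gamma> (insert a A) w a" using p by (simp add: c_def)
  have "shifted \<gamma> (insert a A) (\<lambda>x. w x + c * u x) x = f x" if "x \<in> insert a A" for x
    using that u w cp by (auto simp: shifted_add shifted_scale p_def[symmetric])
  thus ?case by blast
qed simp

text \<open>
  The columns obtained from \<open>solvable\<close> form a right inverse.  It is a left inverse as well since
  \<open>(\<gamma> - Q\<^sub>A) (G (\<gamma> - Q\<^sub>A) - I) = 0\<close> and \<open>\<gamma> - Q\<^sub>A\<close> has trivial kernel.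
\<close>

lemma green_properties:
  assumes A: "finite A" "A \<subseteq> S" and \<gamma>: "0 \<le> \<gamma>"
  shows green_zero: "x \<notin> A \<or> y \<notin> A \<Longrightarrow> green \<gamma> A x y = 0"
    and green_right: "x \<in> A \<Longrightarrow> y \<in> A \<Longrightarrow> shifted \<gamma> A (\<lambda>z. green \<gamma> A z y) x = of_bool (x = y)"
    and green_left: "x \<in> A \<Longrightarrow> y \<in> A \<Longrightarrow>
      \<gamma> * green \<gamma> A x y - (\<Sum>z\<in>A. green \<gamma> A x z * q z y) = of_bool (x = y)"
proof -
  let ?f = "\<lambda>x y. (if x = y then \<gamma> else 0) - q x y"
  let ?P = "\<lambda>g. (\<forall>x y. x \<notin> A \<or> y \<notin> A \<longrightarrow> g x y = 0)
     \<and> (\<forall>x\<in>A. \<forall>y\<in>A. (\<Sum>z\<in>A. ?f x z * g z y) = of_bool (x = y))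
     \<and> (\<forall>x\<in>A. \<forall>y\<in>A. (\<Sum>z\<in>A. g x z * ?f z y) = of_bool (x = y))"
  have left: "(\<Sum>z\<in>A. g x z * ?f z y) = \<gamma> * g x y - (\<Sum>z\<in>A. g x z * q z y)" if "y \<in> A" for g x y
  proof -
    have "(\<Sum>z\<in>A. g x z * (if z = y then \<gamma> else 0)) = \<gamma> * g x y"
      using A that by (simp add: if_distrib[of "(*) _"] cong: if_cong)
    thus ?thesis by (simp add: right_diff_distrib sum_subtractf)
  qed
  have "\<exists>g. \<forall>y. \<forall>x\<in>A. shifted \<gamma> A (g y) x = of_bool (x = y)"
    using solvable[OF A \<gamma>] by (intro choice allI)
  then obtain g where g: "\<And>x y. x \<in> A \<Longrightarrow> shifted \<gamma> A (g y) x = of_bool (x = y)" by blast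
  define G where "G = (\<lambda>x y. if x \<in> A \<and> y \<in> A then g y x else 0)"
  have Gr: "shifted \<gamma> A (\<lambda>z. G z y) x = of_bool (x = y)" if "x \<in> A" "y \<in> A" for x y
    using g[OF that(1), of y] that by (simp add: shifted_def G_def)
  have Gl: "\<gamma> * G x y - (\<Sum>z\<in>A. G x z * q z y) - of_bool (x = y) = 0" if "x \<in> A" "y \<in> A" for x y
  proof (rule kernel_trivial[OF A \<gamma> _ that(1), where h = "\<lambda>x. \<gamma> * G x y - (\<Sum>z\<in>A. G x z * q z y) - of_bool (x = y)"])
    fix x assume x: "x \<in> A"
    have "shifted \<gamma> A (\<lambda>x. \<Sum>z\<in>A. G x z * q z y) x
        = (\<Sum>z\<in>A. q z y * shifted \<gamma> A (\<lambda>x. G x z) x)"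
      unfolding shifted_def sum_distrib_left right_diff_distrib sum_subtractf
      by (subst sum.swap) (simp add: mult_ac)
    also have "\<dots> = q x y" using A x by (simp add: Gr)
    finally have 1: "shifted \<gamma> A (\<lambda>x. \<Sum>z\<in>A. G x z * q z y) x = q x y" .
    have 2: "shifted \<gamma> A (\<lambda>x. of_bool (x = y)) x = \<gamma> * of_bool (x = y) - q x y"
      using A that by (simp add: shifted_def)
    show "shifted \<gamma> A (\<lambda>x. \<gamma> * G x y - (\<Sum>z\<in>A. G x z * q z y) - of_bool (x = y)) x = 0"
      using Gr[OF x that(2)] by (simp add: shifted_diff shifted_scale 1 2)
  qed
  have P: "?P G"
    using Gl by (simp add: shifted_matrix[OF A(1)] Gr left) (simp add: G_def)
  have "green \<gamma> A = G" unfolding green_def matrix_inverse_on_def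
  proof (rule the_equality, rule P)
    fix g assume g: "?P g"
    have "g x y - G x y = 0" if "x \<in> A" "y \<in> A" for x y
    proof (rule kernel_trivial[OF A \<gamma> _ that(1), where h = "\<lambda>x. g x y - G x y"])
      fix x assume "x \<in> A"
      thus "shifted \<gamma> A (\<lambda>x. g x y - G x y) x = 0"
        using g that shifted_matrix[OF A(1), of x \<gamma> "\<lambda>z. g z y"]
        by (simp add: shifted_diff Gr)
    qed
    thus "g = G" using g P by (intro ext) (metis eq_iff_diff_eq_0)
  qed
  thus "x \<notin> A \<or> y \<notin> A \<Longrightarrow> green \<gamma> A x y = 0"
    and "x \<in> A \<Longrightarrow> y \<in> A \<Longrightarrow> shifted \<gamma> A (\<lambda>z. green \<gamma> A z y) x = of_bool (x = y)"
    and "x \<in> A \<Longrightarrow> y \<in> A \<Longrightarrow>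
      \<gamma> * green \<gamma> A x y - (\<Sum>z\<in>A. green \<gamma> A x z * q z y) = of_bool (x = y)"
    using P Gr Gl by auto
qed

lemma green_nonneg:
  assumes A: "finite A" "A \<subseteq> S" and \<gamma>: "0 \<le> \<gamma>"
  shows "0 \<le> green \<gamma> A x y"
proof (cases "x \<in> A \<and> y \<in> A")
  case True
  thus ?thesis
    by (intro minimum_principle[OF A \<gamma>, where h = "\<lambda>z. green \<gamma> A z y"])
      (auto simp: green_right[OF assms])
qed (use green_zero[OF assms] in auto)

lemma shifted_green_fun:
  assumes A: "finite A" "A \<subseteq> S" and \<gamma>: "0 \<le> \<gamma>" and x: "x \<in> A"
  shows "shifted \<gamma> A (green_fun \<gamma> A f) x = f x"
proof -
  have "shifted \<gamma> A (green_fun \<gamma> A f) x = (\<Sum>z\<in>A. f z * shifted \<gamma> A (\<lambda>x. green \<gamma> A x z) x)"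
    unfolding shifted_def green_fun_def sum_distrib_left right_diff_distrib sum_subtractf
    by (subst sum.swap) (simp add: mult_ac)
  also have "\<dots> = f x" using A x by (simp add: green_right[OF A \<gamma>])
  finally show ?thesis .
qed

lemma green_fun_zero: "finite A \<Longrightarrow> A \<subseteq> S \<Longrightarrow> 0 \<le> \<gamma> \<Longrightarrow> x \<notin> A \<Longrightarrow> green_fun \<gamma> A f x = 0"
  by (simp add: green_fun_def green_zero)

lemma green_fun_nonneg:
  assumes A: "finite A" "A \<subseteq> S" and \<gamma>: "0 \<le> \<gamma>" and f: "\<And>z. z \<in> A \<Longrightarrow> 0 \<le> f z"
  shows "0 \<le> green_fun \<gamma> A f x"
  unfolding green_fun_def using f by (intro sum_nonneg mult_nonneg_nonneg green_nonneg[OF A \<gamma>]) auto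

text \<open>
  The main tool of what follows: supersolutions dominate the solution.
\<close>

lemma green_comparison:
  assumes A: "finite A" "A \<subseteq> S" and \<gamma>: "0 \<le> \<gamma>"
    and h: "\<And>z. z \<in> A \<Longrightarrow> f z \<le> shifted \<gamma> A h z" and x: "x \<in> A"
  shows "green_fun \<gamma> A f x \<le> h x"
proof -
  have "0 \<le> h x - green_fun \<gamma> A f x"
    by (rule minimum_principle[OF A \<gamma> _ x]) (simp add: shifted_diff shifted_green_fun[OF A \<gamma>] h)
  thus ?thesis by simp
qed

end

section \<open>Paths and transition functions\<close>

text \<open>
  The finitely many discontinuities in \<open>(0, T]\<close> cut the time interval into finitely many open intervals.
  On each of them the path is locally constant, hence constant.
\<close>

lemma regular_jump_path_finite_range:
  fixes f :: "real \<Rightarrow> 's"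
  assumes reg: "regular_jump_path f"
  shows "finite (f ` {0..T})"
proof -
  define D where "D = {t \<in> {0<..T}. \<not> (\<forall>\<^sub>F s in at_left t. f s = f t)}"
  have D: "finite D" using reg by (auto simp: regular_jump_path_def D_def)
  have right: "\<forall>\<^sub>F s in at_right t. f s = f t" if "0 \<le> t" for t
    using reg that by (auto simp: regular_jump_path_def)
  have left: "\<forall>\<^sub>F s in at_left t. f s = f t" if "0 < t" "t \<le> T" "t \<notin> D" for t
    using that by (auto simp: D_def)
  have gap: "f constant_on {a<..<b}" if ab: "0 \<le> a" "b \<le> T" "{a<..<b} \<inter> D = {}" for a b
  proof (rule locally_constant_imp_constant)
    fix t assume t: "t \<in> {a<..<b}"
    have "\<forall>\<^sub>F s in at t. f s = f t"
    proof -
      have "t \<notin> D" using t ab by blast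
      thus ?thesis using left[of t] right[of t] t ab by (auto simp: eventually_at_split)
    qed
    hence "\<forall>\<^sub>F s in nhds t. f s = f t" by (simp add: eventually_nhds_conv_at)
    then obtain U where "open U" "t \<in> U" "\<forall>s\<in>U. f s = f t"
      by (auto simp: eventually_nhds)
    thus "\<exists>U. openin (top_of_set {a<..<b}) U \<and> t \<in> U \<and> (\<forall>s\<in>U. f s = f t)"
      using t by (intro exI[of _ "{a<..<b} \<inter> U"] conjI openin_open_Int) blast+
  qed simp
  show ?thesis
  proof (cases "0 \<le> T")
    case True
    \<comment> \<open>between two neighbours in the finite set of cut points the path is constant\<close>
    define P where "P = insert 0 (insert T D)"
    have P: "finite P" using D by (simp add: P_def)
    have "f ` {0..T} \<subseteq> f ` P \<union> (\<lambda>(a, b). f ((a + b) / 2)) ` (P \<times> P)"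
    proof
      fix u assume "u \<in> f ` {0..T}"
      then obtain s where s: "0 \<le> s" "s \<le> T" and us: "u = f s" by auto
      show "u \<in> f ` P \<union> (\<lambda>(a, b). f ((a + b) / 2)) ` (P \<times> P)"
      proof (cases "s \<in> P")
        case sP: False
        hence s': "0 < s" "s < T" using s by (auto simp: P_def less_le)
        define a where "a = Max {u \<in> P. u < s}"
        define b where "b = Min {u \<in> P. s < u}"
        have a: "a \<in> {u \<in> P. u < s}" unfolding a_def using P s' by (intro Max_in) (auto simp: P_def)
        have b: "b \<in> {u \<in> P. s < u}" unfolding b_def using P s' by (intro Min_in) (auto simp: P_def)
        have "u \<le> a \<or> b \<le> u" if "u \<in> P" for u
        proof (cases "u < s")
          case True
          thus ?thesis unfolding a_def using that P by (auto intro!: disjI1 Max_ge)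
        next
          case False
          hence "s < u" using that sP by (auto simp: less_le)
          thus ?thesis unfolding b_def using that P by (auto intro!: disjI2 Min_le)
        qed
        hence disj: "{a<..<b} \<inter> D = {}" by (fastforce simp: P_def)
        have D01: "u \<in> {0..T}" if "u \<in> P" for u using that True by (auto simp: P_def D_def)
        have "f constant_on {a<..<b}" using D01[of a] D01[of b] a b by (intro gap disj) auto
        hence "f s = f ((a + b) / 2)" using a b unfolding constant_on_def by force
        thus ?thesis using a b us by force
      qed (use us in auto)
    qed
    thus "finite (f ` {0..T})" by (rule finite_subset) (use P in auto)
  qed auto
qed

locale regular_chain = irreducible_rates S q
  for S :: "'s set" and q :: "'s \<Rightarrow> 's \<Rightarrow> real" +
  fixes Pr :: "'s \<Rightarrow> 'w measure" and X :: "real \<Rightarrow> 'w \<Rightarrow> 's"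
  assumes chain: "regular_jump_chain S Pr X"
    and generator: "is_generator S Pr X q"
begin

abbreviation p :: "real \<Rightarrow> 's \<Rightarrow> 's \<Rightarrow> real" where "p \<equiv> trans_prob Pr X"

lemma markov: "markov_chain S Pr X"
  using chain by (simp add: regular_jump_chain_def)

lemma prob_space_Pr: "x \<in> S \<Longrightarrow> prob_space (Pr x)"
  using markov by (auto simp: markov_chain_def)

lemma state_in: "x \<in> S \<Longrightarrow> 0 \<le> t \<Longrightarrow> \<omega> \<in> space (Pr x) \<Longrightarrow> X t \<omega> \<in> S"
proof -
  assume "x \<in> S" "0 \<le> t" "\<omega> \<in> space (Pr x)"
  moreover from this have "X t \<in> Pr x \<rightarrow>\<^sub>M count_space S" using markov by (auto simp: markov_chain_def)
  ultimately show "X t \<omega> \<in> S" using measurable_space[of "X t" "Pr x" "count_space S" \<omega>] by simp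
qed

lemma events:
  assumes "x \<in> S" "0 \<le> t"
  shows "{\<omega> \<in> space (Pr x). X t \<omega> \<in> Y} \<in> sets (Pr x)"
proof -
  have "X t \<in> Pr x \<rightarrow>\<^sub>M count_space S" using markov assms by (auto simp: markov_chain_def)
  hence "X t -` (Y \<inter> S) \<inter> space (Pr x) \<in> sets (Pr x)" by (rule measurable_sets) auto
  also have "X t -` (Y \<inter> S) \<inter> space (Pr x) = {\<omega> \<in> space (Pr x). X t \<omega> \<in> Y}"
    using state_in[OF assms] by auto
  finally show ?thesis .
qed

lemma event_eq: "x \<in> S \<Longrightarrow> 0 \<le> t \<Longrightarrow> {\<omega> \<in> space (Pr x). X t \<omega> = y} \<in> sets (Pr x)"
  using events[of x t "{y}"] by simp

lemma p_nonneg: "0 \<le> p t x y" and p_le_1: "x \<in> S \<Longrightarrow> p t x y \<le> 1"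
  using prob_space.prob_le_1[OF prob_space_Pr] by (auto simp: trans_prob_def)

lemma p_0: assumes "x \<in> S" shows "p 0 x y = of_bool (x = y)"
proof -
  interpret prob_space "Pr x" using assms by (rule prob_space_Pr)
  have 1: "prob {\<omega> \<in> space (Pr x). X 0 \<omega> = x} = 1"
    using markov assms by (auto simp: markov_chain_def)
  hence "AE \<omega> in Pr x. X 0 \<omega> = x" using event_eq[OF assms, of 0 x] by (simp add: prob_Collect_eq_1)
  hence "prob {\<omega> \<in> space (Pr x). X 0 \<omega> = y} = 0" if "x \<noteq> y"
    using event_eq[OF assms, of 0 y] that by (subst prob_Collect_eq_0) auto
  with 1 show ?thesis by (auto simp: trans_prob_def)
qed

text \<open>
  The Markov property without conditional probabilities; it holds also when the conditioning event is
  null, since then both sides vanish.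
\<close>

lemma path_step:
  assumes x: "x \<in> S" and h: "0 < h" and z: "\<And>i. i \<le> k \<Longrightarrow> z i \<in> S" and y: "y \<in> S" and s: "0 \<le> s"
  shows "\<P>(\<omega> in Pr x. (\<forall>i\<le>k. X (s + real i * h) \<omega> = z i) \<and> X (s + real (Suc k) * h) \<omega> = y)
     = \<P>(\<omega> in Pr x. \<forall>i\<le>k. X (s + real i * h) \<omega> = z i) * p h (z k) y" (is "?J = ?I * _")
proof -
  interpret prob_space "Pr x" using x by (rule prob_space_Pr)
  define z' where "z' = z(Suc k := y)"
  have z': "(\<forall>i\<le>k. X (s + real i * h) \<omega> = z' i) \<longleftrightarrow> (\<forall>i\<le>k. X (s + real i * h) \<omega> = z i)" for \<omega>
    by (auto simp: z'_def)
  have ev: "{\<omega> \<in> space (Pr x). \<forall>i\<le>k. X (s + real i * h) \<omega> = z i} \<in> sets (Pr x)"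
  proof -
    have "{\<omega> \<in> space (Pr x). \<forall>i\<in>{..k}. X (s + real i * h) \<omega> = z i} \<in> sets (Pr x)"
      using h s by (intro sets.sets_Collect_finite_All' event_eq x add_nonneg_nonneg mult_nonneg_nonneg) simp_all
    thus ?thesis by (simp only: Ball_def atMost_iff)
  qed
  show ?thesis
  proof (cases "?I = 0")
    case True
    moreover have "?J \<le> ?I" by (rule finite_measure_mono[OF _ ev]) blast
    ultimately show ?thesis by (simp add: measure_le_0_iff)
  next
    case False
    have "\<P>(\<omega> in Pr x. X (s + real (Suc k) * h) \<omega> = z' (Suc k) \<bar> \<forall>i\<le>k. X (s + real i * h) \<omega> = z' i)
      = p (s + real (Suc k) * h - (s + real k * h)) (z' k) (z' (Suc k))"
    proof (rule markov[unfolded markov_chain_def, rule_format, THEN conjunct2, THEN conjunct2, THEN conjunct2, rule_format])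
      show "\<P>(\<omega> in Pr x. \<forall>i\<le>k. X (s + real i * h) \<omega> = z' i) \<noteq> 0" using False unfolding z' .
    qed (use x z y h s in \<open>auto simp: z'_def le_Suc_eq algebra_simps\<close>)
    moreover have "s + real (Suc k) * h - (s + real k * h) = h" by (simp add: algebra_simps)
    ultimately show ?thesis using False unfolding cond_prob_def z'
      by (simp add: z'_def conj_commute field_simps)
  qed
qed

lemma two_point:
  assumes "x \<in> S" "z \<in> S" "y \<in> S" "0 \<le> s" "0 \<le> t"
  shows "\<P>(\<omega> in Pr x. X s \<omega> = z \<and> X (s + t) \<omega> = y) = p s x z * p t z y"
proof (cases "t = 0")
  case True
  show ?thesis
  proof (cases "z = y")
    case False
    hence "{\<omega> \<in> space (Pr x). X s \<omega> = z \<and> X s \<omega> = y} = {}" by auto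
    thus ?thesis using True False assms by (simp only: measure_empty add_0_right) (simp add: p_0)
  next
    case True
    have "\<P>(\<omega> in Pr x. X s \<omega> = y \<and> X s \<omega> = y) = p s x y" by (simp add: trans_prob_def)
    thus ?thesis using True \<open>t = 0\<close> assms by (simp add: p_0)
  qed
next
  case False
  thus ?thesis using path_step[of x t 0 "\<lambda>_. z" y s] assms by (simp add: trans_prob_def)
qed

lemma sum_p_le_1:
  assumes "x \<in> S" "0 \<le> t" "finite F"
  shows "(\<Sum>z\<in>F. p t x z) \<le> 1"
proof -
  interpret prob_space "Pr x" using assms by (intro prob_space_Pr)
  have "(\<Sum>z\<in>F. p t x z) = prob (\<Union>z\<in>F. {\<omega> \<in> space (Pr x). X t \<omega> = z})"
    unfolding trans_prob_def using assms
    by (intro finite_measure_finite_Union[symmetric]) (auto simp: disjoint_family_on_def intro: event_eq)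
  thus ?thesis by simp
qed

lemma chapman_kolmogorov_le:
  assumes "x \<in> S" "y \<in> S" "0 \<le> s" "0 \<le> t" "finite F" "F \<subseteq> S"
  shows "(\<Sum>z\<in>F. p s x z * p t z y) \<le> p (s + t) x y"
proof -
  interpret prob_space "Pr x" using assms by (intro prob_space_Pr)
  have ev: "{\<omega> \<in> space (Pr x). X s \<omega> = z \<and> X (s + t) \<omega> = y} \<in> sets (Pr x)" for z
    using assms by (intro sets.sets_Collect_conj event_eq) auto
  have "(\<Sum>z\<in>F. p s x z * p t z y) = (\<Sum>z\<in>F. prob {\<omega> \<in> space (Pr x). X s \<omega> = z \<and> X (s + t) \<omega> = y})"
    using assms by (intro sum.cong refl) (auto simp: two_point)
  also have "\<dots> = prob (\<Union>z\<in>F. {\<omega> \<in> space (Pr x). X s \<omega> = z \<and> X (s + t) \<omega> = y})"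
    using assms ev by (intro finite_measure_finite_Union[symmetric]) (auto simp: disjoint_family_on_def)
  also have "\<dots> \<le> p (s + t) x y" unfolding trans_prob_def
    using assms by (intro finite_measure_mono event_eq) auto
  finally show ?thesis .
qed

text \<open>
  The two probabilities differ at most by the probability that the chain is away from \<open>x\<close> at time \<open>h\<close>.  The bound
  is uniform in \<open>t\<close>, which makes the transition function continuous in time.
\<close>

lemma p_shift_bound:
  assumes "x \<in> S" "y \<in> S" "0 \<le> h" "0 \<le> t"
  shows "\<bar>p (h + t) x y - p t x y\<bar> \<le> 1 - p h x x"
proof -
  interpret prob_space "Pr x" using assms by (intro prob_space_Pr)
  have ev: "{\<omega> \<in> space (Pr x). X h \<omega> = x \<and> X (h + t) \<omega> = y} \<in> sets (Pr x)"
    using assms by (intro sets.sets_Collect_conj event_eq) auto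
  have ev': "{\<omega> \<in> space (Pr x). X h \<omega> \<noteq> x} \<in> sets (Pr x)"
    using events[of x h "- {x}"] assms by simp
  have "p (h + t) x y \<le> prob ({\<omega> \<in> space (Pr x). X h \<omega> = x \<and> X (h + t) \<omega> = y}
      \<union> {\<omega> \<in> space (Pr x). X h \<omega> \<noteq> x})"
    unfolding trans_prob_def using ev ev' by (intro finite_measure_mono) auto
  also have "\<dots> \<le> prob {\<omega> \<in> space (Pr x). X h \<omega> = x \<and> X (h + t) \<omega> = y}
      + prob {\<omega> \<in> space (Pr x). X h \<omega> \<noteq> x}"
    using ev ev' by (rule measure_Un_le)
  also have "\<dots> = p h x x * p t x y + (1 - p h x x)"
    using assms two_point[of x x y h t] event_eq[of x h x]
    by (simp add: trans_prob_def prob_neg)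
  finally have 1: "p (h + t) x y \<le> p h x x * p t x y + (1 - p h x x)" .
  have 2: "p h x x * p t x y \<le> p (h + t) x y"
    using chapman_kolmogorov_le[of x y h t "{x}"] assms by simp
  have 3: "0 \<le> (1 - p h x x) * p t x y" "(1 - p h x x) * p t x y \<le> (1 - p h x x) * 1"
    using p_le_1[OF assms(1)] by (auto intro!: mult_nonneg_nonneg mult_left_mono simp: p_nonneg simp del: mult_1_right)
  show ?thesis using 1 2 3 by (simp add: algebra_simps abs_le_iff)
qed

lemma p_tendsto_1:
  assumes "x \<in> S"
  shows "((\<lambda>h. p h x x) \<longlongrightarrow> 1) (at_right 0)"
proof -
  have "((\<lambda>h. (p h x x - of_bool (x = x)) / h) \<longlongrightarrow> q x x) (at_right 0)"
    using generator assms unfolding is_generator_def by blast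
  moreover have "((\<lambda>h::real. h) \<longlongrightarrow> 0) (at_right 0)" by (rule tendsto_ident_at)
  ultimately have "((\<lambda>h. h * ((p h x x - of_bool (x = x)) / h) + 1) \<longlongrightarrow> 0 * q x x + 1) (at_right 0)"
    by (intro tendsto_intros)
  moreover have "\<forall>\<^sub>F h in at_right 0. h * ((p h x x - of_bool (x = x)) / h) + 1 = p h x x"
    by (auto simp: eventually_at_right_field intro!: exI[of _ 1])
  ultimately show ?thesis by (simp cong: filterlim_cong add: tendsto_cong)
qed

lemma p_continuous:
  assumes "x \<in> S" "y \<in> S"
  shows "continuous_on {0..} (\<lambda>t. p t x y)"
  unfolding continuous_on_iff
proof (intro ballI allI impI)
  fix t e :: real assume "t \<in> {0..}" and e: "0 < e"
  have "\<forall>\<^sub>F h in at_right 0. 1 - e < p h x x"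
    using order_tendstoD(1)[OF p_tendsto_1[OF assms(1)], of "1 - e"] e by simp
  then obtain d where d: "0 < d" "\<And>h. 0 < h \<Longrightarrow> h < d \<Longrightarrow> 1 - e < p h x x"
    by (auto simp: eventually_at_right_field)
  have near: "\<bar>p (a + h) x y - p a x y\<bar> < e" if "0 \<le> a" "0 \<le> h" "h < d" for a h
  proof (cases "h = 0")
    case False
    thus ?thesis using p_shift_bound[OF assms, of h a] d(2)[of h] that by (simp add: add.commute)
  qed (use e in simp)
  have "dist (p u x y) (p t x y) < e" if "u \<in> {0..}" "dist u t < d" for u
  proof (cases "t \<le> u")
    case True
    thus ?thesis using near[of t "u - t"] that \<open>t \<in> {0..}\<close> by (auto simp: dist_real_def)
  next
    case False
    thus ?thesis using near[of u "t - u"] that \<open>t \<in> {0..}\<close> by (auto simp: dist_real_def abs_minus_commute)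
  qed
  with d show "\<exists>d>0. \<forall>u\<in>{0..}. dist u t < d \<longrightarrow> dist (p u x y) (p t x y) < e" by blast
qed

end

section \<open>The resolvent kernel\<close>

text \<open>
  The weight of the resolvent kernel is the density of an exponential distribution.
\<close>

lemma exponential_weight:
  assumes "0 < (\<beta>::real)"
  shows "set_integrable lborel {0..} (\<lambda>t. \<beta> * exp (- \<beta> * t))"
    and "(LBINT t:{0..}. \<beta> * exp (- \<beta> * t)) = 1"
proof -
  have eq: "(\<lambda>t. indicator {0..} t *\<^sub>R (\<beta> * exp (- \<beta> * t))) = exponential_density \<beta>"
    by (auto simp: exponential_density_def indicator_def fun_eq_iff mult.commute)
  interpret prob_space "density lborel (exponential_density \<beta>)"
    using assms by (rule prob_space_exponential_density)
  have "(\<integral>\<^sup>+t. exponential_density \<beta> t \<partial>lborel) = 1"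
    using emeasure_space_1 by (simp add: emeasure_density)
  hence "has_bochner_integral lborel (exponential_density \<beta>) 1"
    using assms by (intro has_bochner_integral_nn_integral)
      (auto simp: exponential_density_def)
  thus "set_integrable lborel {0..} (\<lambda>t. \<beta> * exp (- \<beta> * t))"
    and "(LBINT t:{0..}. \<beta> * exp (- \<beta> * t)) = 1"
    unfolding set_integrable_def set_lebesgue_integral_def eq
    by (auto simp: has_bochner_integral_iff)
qed

lemma discounted_integrable:
  assumes \<beta>: "0 < (\<beta>::real)" and cont: "continuous_on {0..} u"
    and u: "\<And>t. 0 \<le> t \<Longrightarrow> 0 \<le> u t \<and> u t \<le> 1"
  shows "set_integrable lborel {0..} (\<lambda>t. \<beta> * exp (- \<beta> * t) * u t)"
proof (rule set_integrable_bound[OF exponential_weight(1)[OF \<beta>]])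
  have "continuous_on {0..} (\<lambda>t. \<beta> * exp (- \<beta> * t) * u t)"
    by (intro continuous_intros cont)
  thus "set_borel_measurable lborel {0..} (\<lambda>t. \<beta> * exp (- \<beta> * t) * u t)"
    using set_measurable_continuous_on[of "{0..}" "\<lambda>t. \<beta> * exp (- \<beta> * t) * u t"]
    by (simp add: set_borel_measurable_def)
  have "\<bar>\<beta> * exp (- \<beta> * t) * u t\<bar> \<le> \<bar>\<beta> * exp (- \<beta> * t)\<bar>" if "0 \<le> t" for t
    using u[OF that] \<beta> by (simp add: abs_mult mult_left_le)
  thus "AE t in lborel. t \<in> {0..} \<longrightarrow> norm (\<beta> * exp (- \<beta> * t) * u t) \<le> norm (\<beta> * exp (- \<beta> * t))"
    by auto
qed

text \<open>
  Shifting time by \<open>h\<close> multiplies a discounted integral by \<open>exp (\<beta> h)\<close> after the piece over \<open>[0, h)\<close> has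
  been removed; \<open>m\<close> bounds that piece from below.
\<close>

lemma discounted_shift:
  assumes \<beta>: "0 < (\<beta>::real)" and cont: "continuous_on {0..} u"
    and u: "\<And>t. 0 \<le> t \<Longrightarrow> 0 \<le> u t \<and> u t \<le> 1" and h: "0 < h"
    and m: "0 \<le> m" "\<And>t. 0 \<le> t \<Longrightarrow> t < h \<Longrightarrow> m \<le> u t"
  shows "(LBINT t:{0..}. \<beta> * exp (- \<beta> * t) * u (h + t))
     \<le> exp (\<beta> * h) * (LBINT t:{0..}. \<beta> * exp (- \<beta> * t) * u t) - \<beta> * h * m"
proof -
  let ?g = "\<lambda>t. \<beta> * exp (- \<beta> * t) * u t"
  have int: "set_integrable lborel {0..} ?g" by (rule discounted_integrable[OF assms(1-3)])
  have int1: "set_integrable lborel {0..<h} ?g" and int2: "set_integrable lborel {h..} ?g"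
    using h by (intro set_integrable_subset[OF int]; auto)+
  have "{0..} = {0..<h} \<union> {h..}" "{0..<h} \<inter> {h..} = {}" using h by auto
  hence split: "(LBINT t:{0..}. ?g t) = (LBINT t:{0..<h}. ?g t) + (LBINT t:{h..}. ?g t)"
    using set_integral_Un[OF _ int1 int2] by simp
  have "(LBINT t:{h..}. ?g t) = (LBINT t. indicator {h..} (h + 1 * t) *\<^sub>R ?g (h + 1 * t))"
    unfolding set_lebesgue_integral_def by (subst lborel_integral_real_affine[of 1 _ h]) simp_all
  also have "\<dots> = (LBINT t:{0..}. exp (- \<beta> * h) * (\<beta> * exp (- \<beta> * t) * u (h + t)))"
    unfolding set_lebesgue_integral_def
  proof (intro Bochner_Integration.integral_cong refl)
    fix t
    have "exp (- \<beta> * (h + t)) = exp (- \<beta> * h) * exp (- \<beta> * t)"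
      by (simp only: distrib_left exp_add)
    thus "indicator {h..} (h + 1 * t) *\<^sub>R ?g (h + 1 * t)
        = indicator {0..} t *\<^sub>R (exp (- \<beta> * h) * (\<beta> * exp (- \<beta> * t) * u (h + t)))"
      by (simp add: indicator_def)
  qed
  finally have shift: "(LBINT t:{h..}. ?g t) = exp (- \<beta> * h) * (LBINT t:{0..}. \<beta> * exp (- \<beta> * t) * u (h + t))"
    by simp
  have "(LBINT t:{0..<h}. \<beta> * exp (- \<beta> * h) * m) \<le> (LBINT t:{0..<h}. ?g t)"
  proof (rule set_integral_mono[OF _ int1])
    show "set_integrable lborel {0..<h} (\<lambda>t. \<beta> * exp (- \<beta> * h) * m)"
      using h by (simp add: set_integrable_def)
    fix t assume "t \<in> {0..<h}"
    thus "\<beta> * exp (- \<beta> * h) * m \<le> ?g t"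
      using m \<beta> by (intro mult_mono) auto
  qed
  moreover have "(LBINT t:{0..<h}. \<beta> * exp (- \<beta> * h) * m) = h * (\<beta> * exp (- \<beta> * h) * m)"
    using h by (simp add: set_integral_const)
  ultimately have low: "h * (\<beta> * exp (- \<beta> * h) * m) \<le> (LBINT t:{0..<h}. ?g t)" by (simp only:)
  have e: "exp (\<beta> * h) * exp (- \<beta> * h) = 1" by (simp add: exp_add[symmetric])
  have "(LBINT t:{0..}. \<beta> * exp (- \<beta> * t) * u (h + t)) = exp (\<beta> * h) * (LBINT t:{h..}. ?g t)"
    unfolding shift using e by (simp add: mult.assoc[symmetric])
  also have "\<dots> = exp (\<beta> * h) * (LBINT t:{0..}. ?g t) - exp (\<beta> * h) * (LBINT t:{0..<h}. ?g t)"
    unfolding split by (simp add: algebra_simps)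
  also have "\<dots> \<le> exp (\<beta> * h) * (LBINT t:{0..}. ?g t) - exp (\<beta> * h) * (h * (\<beta> * exp (- \<beta> * h) * m))"
    using low by simp
  also have "exp (\<beta> * h) * (h * (\<beta> * exp (- \<beta> * h) * m)) = (exp (\<beta> * h) * exp (- \<beta> * h)) * (\<beta> * h * m)"
    by (simp add: mult_ac)
  finally show ?thesis unfolding e by simp
qed

context regular_chain
begin

lemma resolvent_integrable:
  assumes "0 < \<beta>" "x \<in> S" "y \<in> S"
  shows "set_integrable lborel {0..} (\<lambda>t. \<beta> * exp (- \<beta> * t) * p t x y)"
  using assms by (intro discounted_integrable p_continuous) (auto simp: p_nonneg p_le_1)

lemma resolvent_nonneg:
  assumes "0 < \<beta>" shows "0 \<le> resolvent_kernel Pr X \<beta> x y"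
  unfolding resolvent_kernel_def set_lebesgue_integral_def
  using assms by (intro Bochner_Integration.integral_nonneg) (auto simp: p_nonneg)

lemma sum_resolvent_le_1:
  assumes "0 < \<beta>" "x \<in> S" "finite F" "F \<subseteq> S"
  shows "(\<Sum>z\<in>F. resolvent_kernel Pr X \<beta> x z) \<le> 1"
proof -
  have int: "set_integrable lborel {0..} (\<lambda>t. \<beta> * exp (- \<beta> * t) * p t x z)" if "z \<in> F" for z
    using assms that by (intro resolvent_integrable) auto
  have "(\<Sum>z\<in>F. resolvent_kernel Pr X \<beta> x z) = (LBINT t:{0..}. \<Sum>z\<in>F. \<beta> * exp (- \<beta> * t) * p t x z)"
    unfolding resolvent_kernel_def set_lebesgue_integral_def scaleR_sum_right
    using int by (intro Bochner_Integration.integral_sum[symmetric]) (simp add: set_integrable_def)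
  also have "\<dots> \<le> (LBINT t:{0..}. \<beta> * exp (- \<beta> * t))"
  proof (rule set_integral_mono[OF _ exponential_weight(1)[OF assms(1)]])
    show "set_integrable lborel {0..} (\<lambda>t. \<Sum>z\<in>F. \<beta> * exp (- \<beta> * t) * p t x z)"
      using int unfolding set_integrable_def scaleR_sum_right by auto
    fix t :: real assume "t \<in> {0..}"
    thus "(\<Sum>z\<in>F. \<beta> * exp (- \<beta> * t) * p t x z) \<le> \<beta> * exp (- \<beta> * t)"
      using sum_p_le_1[of x t F] assms by (simp add: sum_distrib_left[symmetric] mult_left_le)
  qed
  finally show ?thesis using exponential_weight(2)[OF assms(1)] by simp
qed

text \<open>
  One half of the backward equation \<open>(\<beta> - Q) R = \<beta> I\<close> for the resolvent kernel \<open>R\<close>, on each finite set.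
  By Chapman--Kolmogorov, applying the time-\<open>h\<close> transition matrix to \<open>R\<close> shifts the discounted integral;
  dividing by \<open>h\<close> and letting \<open>h\<close> tend to 0 gives the claim.  Restricting the sum to \<open>F\<close> loses
  nonnegative terms.  The factor \<open>c < 1\<close> in the proof is a lower bound for the probability of being in the
  initial state at small times.
\<close>

lemma resolvent_supersolution:
  assumes \<beta>: "0 < \<beta>" and F: "finite F" "F \<subseteq> S" "x \<in> F" and y: "y \<in> S"
  shows "\<beta> * of_bool (x = y) \<le> shifted \<beta> F (\<lambda>z. resolvent_kernel Pr X \<beta> z y) x"
proof (rule field_le_mult_one_interval)
  fix c :: real assume c: "0 < c" "c < 1"
  let ?r = "\<lambda>z. resolvent_kernel Pr X \<beta> z y"
  have x: "x \<in> S" using F by auto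
  have "\<forall>\<^sub>F h in at_right 0. c < p h x x"
    using order_tendstoD(1)[OF p_tendsto_1[OF x]] c by auto
  then obtain d where d: "0 < d" "\<And>h. 0 < h \<Longrightarrow> h < d \<Longrightarrow> c < p h x x"
    by (auto simp: eventually_at_right_field)
  have est: "(\<Sum>z\<in>F. (p h x z - of_bool (x = z)) / h * ?r z)
      \<le> (exp (\<beta> * h) - 1) / h * ?r x - \<beta> * (c * of_bool (x = y))" if h: "0 < h" "h < d" for h
  proof -
    have int: "set_integrable lborel {0..} (\<lambda>t. p h x z * (\<beta> * exp (- \<beta> * t) * p t z y))" if "z \<in> F" for z
      using F that y by (intro set_integrable_mult_right resolvent_integrable[OF \<beta>]) auto
    have "(\<Sum>z\<in>F. p h x z * ?r z)
        = (LBINT t:{0..}. \<Sum>z\<in>F. p h x z * (\<beta> * exp (- \<beta> * t) * p t z y))"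
    proof -
      have "(\<Sum>z\<in>F. p h x z * ?r z) = (\<Sum>z\<in>F. LBINT t:{0..}. p h x z * (\<beta> * exp (- \<beta> * t) * p t z y))"
        unfolding resolvent_kernel_def by simp
      also have "\<dots> = (LBINT t:{0..}. \<Sum>z\<in>F. p h x z * (\<beta> * exp (- \<beta> * t) * p t z y))"
        unfolding set_lebesgue_integral_def scaleR_sum_right
        using int by (intro Bochner_Integration.integral_sum[symmetric]) (simp add: set_integrable_def)
      finally show ?thesis .
    qed
    also have "\<dots> \<le> (LBINT t:{0..}. \<beta> * exp (- \<beta> * t) * p (h + t) x y)"
    proof (rule set_integral_mono)
      show "set_integrable lborel {0..} (\<lambda>t. \<Sum>z\<in>F. p h x z * (\<beta> * exp (- \<beta> * t) * p t z y))"
        using int unfolding set_integrable_def scaleR_sum_right by auto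
      have "continuous_on {0..} (\<lambda>t. p (h + t) x y)"
        using h by (intro continuous_on_compose2[OF p_continuous[OF x y]] continuous_intros) auto
      thus "set_integrable lborel {0..} (\<lambda>t. \<beta> * exp (- \<beta> * t) * p (h + t) x y)"
        using x by (intro discounted_integrable[OF \<beta>]) (auto simp: p_nonneg p_le_1)
      fix t :: real assume "t \<in> {0..}"
      hence "(\<Sum>z\<in>F. p h x z * p t z y) \<le> p (h + t) x y"
        using F y x h by (intro chapman_kolmogorov_le) auto
      hence "\<beta> * exp (- \<beta> * t) * (\<Sum>z\<in>F. p h x z * p t z y) \<le> \<beta> * exp (- \<beta> * t) * p (h + t) x y"
        using \<beta> by (intro mult_left_mono) auto
      thus "(\<Sum>z\<in>F. p h x z * (\<beta> * exp (- \<beta> * t) * p t z y)) \<le> \<beta> * exp (- \<beta> * t) * p (h + t) x y"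
        by (simp add: sum_distrib_left mult_ac)
    qed
    also have "\<dots> \<le> exp (\<beta> * h) * ?r x - \<beta> * h * (c * of_bool (x = y))"
      unfolding resolvent_kernel_def
    proof (rule discounted_shift[OF \<beta> p_continuous[OF x y] _ h(1)])
      fix t assume "0 \<le> t" "t < h"
      thus "c * of_bool (x = y) \<le> p t x y"
        using d(2)[of t] h c by (cases "t = 0") (auto simp: p_0 x p_nonneg)
    qed (use c x in \<open>auto simp: p_nonneg p_le_1\<close>)
    finally have "(\<Sum>z\<in>F. p h x z * ?r z) - ?r x \<le> (exp (\<beta> * h) - 1) * ?r x - \<beta> * h * (c * of_bool (x = y))"
      by (simp add: algebra_simps)
    moreover have "(\<Sum>z\<in>F. of_bool (x = z) * ?r z) = ?r x" using F by simp
    ultimately have "((\<Sum>z\<in>F. p h x z * ?r z) - (\<Sum>z\<in>F. of_bool (x = z) * ?r z)) / h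
        \<le> ((exp (\<beta> * h) - 1) * ?r x - \<beta> * h * (c * of_bool (x = y))) / h"
      using h by (intro divide_right_mono) auto
    moreover have "((\<Sum>z\<in>F. p h x z * ?r z) - (\<Sum>z\<in>F. of_bool (x = z) * ?r z)) / h
        = (\<Sum>z\<in>F. (p h x z - of_bool (x = z)) / h * ?r z)"
      unfolding sum_subtractf[symmetric] sum_divide_distrib by (simp add: left_diff_distrib diff_divide_distrib)
    moreover have "((exp (\<beta> * h) - 1) * ?r x - \<beta> * h * (c * of_bool (x = y))) / h
        = (exp (\<beta> * h) - 1) / h * ?r x - \<beta> * (c * of_bool (x = y))"
      using h by (simp add: field_simps)
    ultimately show ?thesis by simp
  qed
  have "((\<lambda>h. (exp (\<beta> * h) - 1) / h) \<longlongrightarrow> \<beta>) (at_right 0)"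
  proof -
    have "((\<lambda>h. exp (\<beta> * h)) has_real_derivative \<beta>) (at 0)"
      by (auto intro!: derivative_eq_intros)
    hence "((\<lambda>h. (exp (\<beta> * h) - 1) / h) \<longlongrightarrow> \<beta>) (at 0)"
      by (simp add: has_field_derivative_iff)
    thus ?thesis by (rule filterlim_mono) (auto simp: at_le)
  qed
  hence R: "((\<lambda>h. (exp (\<beta> * h) - 1) / h * ?r x - \<beta> * (c * of_bool (x = y)))
      \<longlongrightarrow> \<beta> * ?r x - \<beta> * (c * of_bool (x = y))) (at_right 0)"
    by (intro tendsto_intros)
  have "((\<lambda>h. (p h x z - of_bool (x = z)) / h) \<longlongrightarrow> q x z) (at_right 0)" if "z \<in> F" for z
    using generator that F x unfolding is_generator_def by blast
  hence L: "((\<lambda>h. \<Sum>z\<in>F. (p h x z - of_bool (x = z)) / h * ?r z) \<longlongrightarrow> (\<Sum>z\<in>F. q x z * ?r z)) (at_right 0)"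
    by (intro tendsto_intros)
  have "(\<Sum>z\<in>F. q x z * ?r z) \<le> \<beta> * ?r x - \<beta> * (c * of_bool (x = y))"
    using est d(1) by (intro tendsto_le[OF _ R L]) (auto simp: eventually_at_right_field)
  thus "c * (\<beta> * of_bool (x = y)) \<le> shifted \<beta> F ?r x"
    by (simp add: shifted_def mult_ac)
qed

end

section \<open>Non-explosion in terms of finite sets\<close>

lemma finite_subset_incseq:
  assumes "finite A" "incseq E" "A \<subseteq> (\<Union>m::nat. E m)"
  shows "\<exists>m. A \<subseteq> E m"
  using assms(1,3)
proof (induction A rule: finite_induct)
  case (insert a A)
  then obtain m k where "A \<subseteq> E m" "a \<in> E k" by auto
  hence "insert a A \<subseteq> E (max m k)"
    using incseqD[OF assms(2), of m "max m k"] incseqD[OF assms(2), of k "max m k"] by auto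
  thus ?case by blast
qed simp

context regular_chain
begin

text \<open>
  The subdistribution of the chain at the \<open>k\<close>-th point of a mesh of width \<open>h\<close>, restricted to the paths
  that are in \<open>F\<close> at all mesh points up to that one.
\<close>

definition mesh_row :: "'s \<Rightarrow> 's set \<Rightarrow> real \<Rightarrow> nat \<Rightarrow> 's \<Rightarrow> real" where
  "mesh_row x F h k z = \<P>(\<omega> in Pr x. (\<forall>i\<le>k. X (real i * h) \<omega> \<in> F) \<and> X (real k * h) \<omega> = z)"

lemma stay_event:
  assumes "x \<in> S" "0 < h"
  shows "{\<omega> \<in> space (Pr x). \<forall>i\<le>k. X (real i * h) \<omega> \<in> Z i} \<in> sets (Pr x)"
proof -
  have "{\<omega> \<in> space (Pr x). \<forall>i\<in>{..k}. X (real i * h) \<omega> \<in> Z i} \<in> sets (Pr x)"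
    using assms by (intro sets.sets_Collect_finite_All' events assms mult_nonneg_nonneg) simp_all
  thus ?thesis by (simp only: Ball_def atMost_iff)
qed

lemma path_event:
  assumes "x \<in> S" "0 < h"
  shows "{\<omega> \<in> space (Pr x). \<forall>i\<le>k. X (real i * h) \<omega> = z i} \<in> sets (Pr x)"
  using stay_event[OF assms, of k "\<lambda>i. {z i}"] by (simp only: singleton_iff)

lemma mesh_row_0: "x \<in> F \<Longrightarrow> x \<in> S \<Longrightarrow> 0 < h \<Longrightarrow> z \<in> F \<Longrightarrow> mesh_row x F h 0 z = of_bool (x = z)"
proof -
  assume a: "x \<in> F" "x \<in> S" "0 < h" "z \<in> F"
  hence "mesh_row x F h 0 z = p 0 x z"
    unfolding mesh_row_def trans_prob_def by (intro arg_cong[where f = "measure (Pr x)"]) auto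
  thus ?thesis using a by (simp add: p_0)
qed

lemma mesh_row_nonneg: "0 \<le> mesh_row x F h k z"
  by (simp add: mesh_row_def)

lemma sum_mesh_row:
  assumes x: "x \<in> S" and h: "0 < h" and F: "finite F"
  shows "(\<Sum>z\<in>F. mesh_row x F h k z) = \<P>(\<omega> in Pr x. \<forall>i\<le>k. X (real i * h) \<omega> \<in> F)"
proof -
  interpret prob_space "Pr x" using x by (rule prob_space_Pr)
  have ev: "{\<omega> \<in> space (Pr x). (\<forall>i\<le>k. X (real i * h) \<omega> \<in> F) \<and> X (real k * h) \<omega> = z} \<in> sets (Pr x)" for z
    using h by (intro sets.sets_Collect_conj stay_event event_eq x) auto
  have "(\<Sum>z\<in>F. mesh_row x F h k z)
      = prob (\<Union>z\<in>F. {\<omega> \<in> space (Pr x). (\<forall>i\<le>k. X (real i * h) \<omega> \<in> F) \<and> X (real k * h) \<omega> = z})"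
    unfolding mesh_row_def using F ev
    by (intro finite_measure_finite_Union[symmetric] image_subsetI) (blast | unfold disjoint_family_on_def)+
  also have "\<dots> = prob {\<omega> \<in> space (Pr x). \<forall>i\<le>k. X (real i * h) \<omega> \<in> F}"
    by (intro arg_cong[where f = prob]) auto
  finally show ?thesis .
qed

text \<open>
  The restricted chain on the mesh evolves by the transition matrix over one mesh width: decompose the
  event according to the finitely many states in \<open>F\<close> visited at the mesh points.
\<close>

lemma mesh_row_Suc:
  assumes x: "x \<in> S" and h: "0 < h" and F: "finite F" "F \<subseteq> S" and z: "z \<in> F"
  shows "mesh_row x F h (Suc k) z = (\<Sum>y\<in>F. mesh_row x F h k y * p h y z)"
proof -
  interpret prob_space "Pr x" using x by (rule prob_space_Pr)
  let ?P = "PiE {..k} (\<lambda>_. F)"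
  let ?D = "\<lambda>\<zeta>. {\<omega> \<in> space (Pr x). \<forall>i\<le>k. X (real i * h) \<omega> = \<zeta> i}"
  let ?E = "\<lambda>\<zeta>. {\<omega> \<in> space (Pr x). (\<forall>i\<le>k. X (real i * h) \<omega> = \<zeta> i) \<and> X (real (Suc k) * h) \<omega> = z}"
  have P: "finite ?P" using F by (intro finite_PiE) auto
  have D: "?D \<zeta> \<in> sets (Pr x)" for \<zeta> using path_event[OF x h] .
  have E: "?E \<zeta> \<in> sets (Pr x)" for \<zeta>
    using h by (intro sets.sets_Collect_conj path_event event_eq x) auto
  have distinct: "\<zeta> = \<xi>" if "\<zeta> \<in> ?P" "\<xi> \<in> ?P" "\<omega> \<in> ?D \<zeta>" "\<omega> \<in> ?D \<xi>" for \<zeta> \<xi> \<omega>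
    by (rule PiE_ext[OF that(1,2)]) (use that(3,4) in auto)
  have path: "\<exists>\<zeta>\<in>?P. \<omega> \<in> ?D \<zeta>" if "\<omega> \<in> space (Pr x)" "\<forall>i\<le>k. X (real i * h) \<omega> \<in> F" for \<omega>
    using that by (intro bexI[of _ "\<lambda>i\<in>{..k}. X (real i * h) \<omega>"]) auto
  have Pmem: "\<zeta> i \<in> F" if "\<zeta> \<in> ?P" "i \<le> k" for \<zeta> i using that by (auto simp: PiE_mem)
  have row: "mesh_row x F h k y = (\<Sum>\<zeta>\<in>{\<zeta>\<in>?P. \<zeta> k = y}. prob (?D \<zeta>))" for y
  proof -
    have "{\<omega> \<in> space (Pr x). (\<forall>i\<le>k. X (real i * h) \<omega> \<in> F) \<and> X (real k * h) \<omega> = y}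
        = (\<Union>\<zeta>\<in>{\<zeta>\<in>?P. \<zeta> k = y}. ?D \<zeta>)" (is "?L = ?R")
    proof
      show "?L \<subseteq> ?R"
      proof
        fix \<omega> assume w: "\<omega> \<in> ?L"
        then obtain \<zeta> where "\<zeta> \<in> ?P" "\<omega> \<in> ?D \<zeta>" using path[of \<omega>] by blast
        moreover from this have "\<zeta> k = y" using w by force
        ultimately show "\<omega> \<in> ?R" by blast
      qed
      show "?R \<subseteq> ?L"
      proof
        fix \<omega> assume "\<omega> \<in> ?R"
        then obtain \<zeta> where "\<zeta> \<in> ?P" "\<zeta> k = y" "\<omega> \<in> ?D \<zeta>" by blast
        thus "\<omega> \<in> ?L" using Pmem[of \<zeta>] by simp
      qed
    qed
    hence "mesh_row x F h k y = prob (\<Union>\<zeta>\<in>{\<zeta>\<in>?P. \<zeta> k = y}. ?D \<zeta>)"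
      by (simp only: mesh_row_def)
    also have "\<dots> = (\<Sum>\<zeta>\<in>{\<zeta>\<in>?P. \<zeta> k = y}. prob (?D \<zeta>))"
    proof (rule finite_measure_finite_Union)
      show "finite {\<zeta>\<in>?P. \<zeta> k = y}" by (rule finite_subset[OF _ P]) blast
      show "?D ` {\<zeta>\<in>?P. \<zeta> k = y} \<subseteq> sets (Pr x)" using D by blast
      show "disjoint_family_on ?D {\<zeta>\<in>?P. \<zeta> k = y}"
        unfolding disjoint_family_on_def using distinct by blast
    qed
    finally show ?thesis .
  qed
  have "mesh_row x F h (Suc k) z = prob (\<Union>\<zeta>\<in>?P. ?E \<zeta>)"
  proof -
    have "{\<omega> \<in> space (Pr x). (\<forall>i\<le>Suc k. X (real i * h) \<omega> \<in> F) \<and> X (real (Suc k) * h) \<omega> = z}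
        = (\<Union>\<zeta>\<in>?P. ?E \<zeta>)" (is "?L = ?R")
    proof
      show "?L \<subseteq> ?R"
      proof
        fix \<omega> assume w: "\<omega> \<in> ?L"
        then obtain \<zeta> where "\<zeta> \<in> ?P" "\<omega> \<in> ?D \<zeta>" using path[of \<omega>] le_SucI by blast
        thus "\<omega> \<in> ?R" using w by blast
      qed
      show "?R \<subseteq> ?L"
      proof
        fix \<omega> assume "\<omega> \<in> ?R"
        then obtain \<zeta> where "\<zeta> \<in> ?P" "\<omega> \<in> ?E \<zeta>" by blast
        hence "X (real i * h) \<omega> \<in> F" if "i \<le> Suc k" for i
          using Pmem[of \<zeta> i] z that by (cases "i = Suc k") simp_all
        thus "\<omega> \<in> ?L" using \<open>\<omega> \<in> ?E \<zeta>\<close> by blast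
      qed
    qed
    thus ?thesis by (simp only: mesh_row_def)
  qed
  also have "\<dots> = (\<Sum>\<zeta>\<in>?P. prob (?E \<zeta>))"
  proof (rule finite_measure_finite_Union[OF P])
    show "?E ` ?P \<subseteq> sets (Pr x)" using E by blast
    have "?E \<zeta> \<inter> ?E \<xi> = {}" if "\<zeta> \<in> ?P" "\<xi> \<in> ?P" "\<zeta> \<noteq> \<xi>" for \<zeta> \<xi>
    proof -
      have "\<omega> \<notin> ?D \<zeta> \<or> \<omega> \<notin> ?D \<xi>" for \<omega> using distinct[OF that(1,2)] that(3) by blast
      thus ?thesis by blast
    qed
    thus "disjoint_family_on ?E ?P" by (simp only: disjoint_family_on_def) blast
  qed
  also have "\<dots> = (\<Sum>\<zeta>\<in>?P. prob (?D \<zeta>) * p h (\<zeta> k) z)"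
  proof (intro sum.cong refl)
    fix \<zeta> assume "\<zeta> \<in> ?P"
    hence "\<zeta> i \<in> S" if "i \<le> k" for i using Pmem that F by blast
    thus "prob (?E \<zeta>) = prob (?D \<zeta>) * p h (\<zeta> k) z"
      using path_step[OF x h, of k \<zeta> z 0] z F(2) by (simp only: add_0 subsetD order_refl)
  qed
  also have "\<dots> = (\<Sum>y\<in>F. \<Sum>\<zeta>\<in>{\<zeta>\<in>?P. \<zeta> k = y}. prob (?D \<zeta>) * p h (\<zeta> k) z)"
    using P F Pmem by (intro sum.group[symmetric]) auto
  also have "\<dots> = (\<Sum>y\<in>F. mesh_row x F h k y * p h y z)"
    by (simp add: row sum_distrib_right)
  finally show ?thesis .
qed

text \<open>
  If \<open>(1 + \<gamma> h) a \<ge> \<gamma> h + P\<^sub>h a\<close> held without the error \<open>h \<delta>\<close>, then \<open>a\<close> would be at least the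
  probability that a geometric clock with success probability \<open>1 - \<rho>\<close>, where \<open>\<rho> = 1 / (1 + \<gamma> h)\<close>,
  rings before the first mesh point at which the chain is outside of \<open>F\<close>.  This contains the event that
  the clock rings within \<open>N\<close> steps and the chain is in \<open>F\<close> up to step \<open>N\<close>; Bernoulli's inequality bounds
  the probability \<open>\<rho> ^ N\<close> that the clock stays silent.  Over \<open>N\<close> steps the errors add up to \<open>N h \<delta>\<close>.
\<close>

lemma mesh_survival_le:
  assumes \<gamma>: "0 < \<gamma>" and F: "finite F" "F \<subseteq> S" and x: "x \<in> F" and h: "0 < h" and \<delta>: "0 \<le> \<delta>"
    and a: "\<And>z. z \<in> F \<Longrightarrow> 0 \<le> a z"
    and step: "\<And>z. z \<in> F \<Longrightarrow> (\<Sum>y\<in>F. p h z y * a y) \<le> (1 + \<gamma> * h) * a z - \<gamma> * h + h * \<delta>"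
  shows "(1 - 1 / (1 + real N * \<gamma> * h)) * \<P>(\<omega> in Pr x. \<forall>i\<le>N. X (real i * h) \<omega> \<in> F)
    \<le> a x + real N * h * \<delta>"
proof -
  have xS: "x \<in> S" using x F by auto
  interpret prob_space "Pr x" using xS by (rule prob_space_Pr)
  define s where "s = mesh_row x F h"
  define \<sigma> where "\<sigma> k = (\<Sum>z\<in>F. s k z)" for k
  define \<rho> where "\<rho> = 1 / (1 + \<gamma> * h)"
  have s: "0 \<le> s k z" for k z by (simp add: s_def mesh_row_nonneg)
  have \<sigma>_eq: "\<sigma> k = prob {\<omega> \<in> space (Pr x). \<forall>i\<le>k. X (real i * h) \<omega> \<in> F}" for k
    unfolding \<sigma>_def s_def by (rule sum_mesh_row[OF xS h F(1)])
  have \<sigma>_le_1: "\<sigma> k \<le> 1" for k by (simp add: \<sigma>_eq)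
  have \<sigma>_nonneg: "0 \<le> \<sigma> k" for k by (simp add: \<sigma>_eq)
  have \<sigma>_anti: "\<sigma> N \<le> \<sigma> k" if "k \<le> N" for k
    unfolding \<sigma>_eq using that by (intro finite_measure_mono stay_event xS h) auto
  have gh: "0 < \<gamma> * h" using \<gamma> h by simp
  have \<rho>: "0 < \<rho>" "\<rho> \<le> 1" "\<rho> * (1 + \<gamma> * h) = 1" "\<rho> * (\<gamma> * h) = 1 - \<rho>"
    using gh by (auto simp: \<rho>_def field_simps)
  have row_step: "\<rho> * (\<Sum>z\<in>F. s (Suc k) z * a z) + (1 - \<rho>) * \<sigma> k - h * \<delta> \<le> (\<Sum>z\<in>F. s k z * a z)" for k
  proof -
    have "(\<Sum>z\<in>F. s (Suc k) z * a z) = (\<Sum>z\<in>F. \<Sum>y\<in>F. s k y * p h y z * a z)"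
      unfolding s_def using F h xS by (intro sum.cong refl) (simp add: mesh_row_Suc sum_distrib_right)
    also have "\<dots> = (\<Sum>y\<in>F. s k y * (\<Sum>z\<in>F. p h y z * a z))"
      by (subst sum.swap) (simp add: sum_distrib_left mult_ac)
    also have "\<dots> \<le> (\<Sum>y\<in>F. s k y * ((1 + \<gamma> * h) * a y - \<gamma> * h + h * \<delta>))"
      using step s by (intro sum_mono mult_left_mono) auto
    also have "\<dots> = (1 + \<gamma> * h) * (\<Sum>y\<in>F. s k y * a y) - \<gamma> * h * \<sigma> k + h * \<delta> * \<sigma> k"
      unfolding \<sigma>_def by (simp add: algebra_simps sum.distrib sum_subtractf sum_distrib_left)
    finally have "\<rho> * (\<Sum>z\<in>F. s (Suc k) z * a z)
        \<le> \<rho> * ((1 + \<gamma> * h) * (\<Sum>y\<in>F. s k y * a y) - \<gamma> * h * \<sigma> k + h * \<delta> * \<sigma> k)"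
      using \<rho> by (intro mult_left_mono) auto
    also have "\<dots> = (\<rho> * (1 + \<gamma> * h)) * (\<Sum>y\<in>F. s k y * a y) - (\<rho> * (\<gamma> * h)) * \<sigma> k + h * \<delta> * (\<rho> * \<sigma> k)"
      by (simp add: algebra_simps)
    also have "\<dots> \<le> (\<Sum>y\<in>F. s k y * a y) - (1 - \<rho>) * \<sigma> k + h * \<delta>"
    proof -
      have "\<rho> * \<sigma> k \<le> 1" using \<rho> \<sigma>_le_1[of k] \<sigma>_nonneg[of k] by (simp add: mult_le_one)
      hence "h * \<delta> * (\<rho> * \<sigma> k) \<le> h * \<delta>" using h \<delta> by (intro mult_left_le) auto
      thus ?thesis using \<rho> by simp
    qed
    finally show ?thesis by simp
  qed
  have "\<rho> ^ k * (\<Sum>z\<in>F. s k z * a z) + (1 - \<rho> ^ k) * \<sigma> N - real k * h * \<delta> \<le> a x" if "k \<le> N" for k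
    using that
  proof (induction k)
    case 0
    have "(\<Sum>z\<in>F. s 0 z * a z) = (\<Sum>z\<in>F. of_bool (x = z) * a z)"
      using x xS h unfolding s_def by (intro sum.cong refl) (simp add: mesh_row_0)
    thus ?case using F x by simp
  next
    case (Suc k)
    have lk: "0 \<le> \<rho> ^ k" "\<rho> ^ k \<le> 1" using \<rho> by (auto intro: power_le_one)
    have "(1 - \<rho>) * \<sigma> N \<le> (1 - \<rho>) * \<sigma> k" using \<sigma>_anti Suc \<rho> by (intro mult_left_mono) auto
    hence "\<rho> ^ k * (\<rho> * (\<Sum>z\<in>F. s (Suc k) z * a z) + (1 - \<rho>) * \<sigma> N - h * \<delta>) \<le> \<rho> ^ k * (\<Sum>z\<in>F. s k z * a z)"
      using row_step[of k] lk by (intro mult_left_mono) auto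
    moreover have "\<rho> ^ k * (h * \<delta>) \<le> h * \<delta>" using lk h \<delta> by (intro mult_left_le_one_le) auto
    ultimately show ?case using Suc by (simp add: algebra_simps)
  qed
  note iterate = this
  have "(1 - \<rho> ^ N) * \<sigma> N \<le> a x + real N * h * \<delta>"
  proof -
    have "0 \<le> \<rho> ^ N * (\<Sum>z\<in>F. s N z * a z)"
      using \<rho> s a by (intro mult_nonneg_nonneg sum_nonneg) auto
    thus ?thesis using iterate[of N] by simp
  qed
  moreover have "(1 - 1 / (1 + real N * \<gamma> * h)) * \<sigma> N \<le> (1 - \<rho> ^ N) * \<sigma> N"
  proof (intro mult_right_mono \<sigma>_nonneg)
    have B: "1 + real N * (\<gamma> * h) \<le> (1 + \<gamma> * h) ^ N"
      using gh by (intro Bernoulli_inequality) simp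
    have "\<rho> ^ N = 1 / (1 + \<gamma> * h) ^ N" by (simp add: \<rho>_def power_divide)
    also have "\<dots> \<le> 1 / (1 + real N * (\<gamma> * h))"
      using B gh by (intro divide_left_mono) (auto intro!: mult_pos_pos add_pos_nonneg)
    finally show "1 - 1 / (1 + real N * \<gamma> * h) \<le> 1 - \<rho> ^ N" by (simp add: mult.assoc)
  qed
  ultimately show ?thesis by (simp add: \<sigma>_eq)
qed

text \<open>
  The limit of the preceding inequality along meshes of width \<open>T / N\<close>: on the finite set \<open>F\<close> the
  difference quotient of the transition matrix is uniformly close to \<open>Q\<close>, and the mesh points are rational
  multiples of \<open>T\<close>.  Rational multiples keep the confinement event measurable.
\<close>

lemma confinement_le:
  assumes \<gamma>: "0 < \<gamma>" and F: "finite F" "F \<subseteq> S" and x: "x \<in> F" and T: "0 < T"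
  shows "(1 - 1 / (1 + \<gamma> * T)) * \<P>(\<omega> in Pr x. \<forall>r\<in>\<rat> \<inter> {0..1}. X (r * T) \<omega> \<in> F)
    \<le> green_fun \<gamma> F (\<lambda>_. \<gamma>) x" (is "?c * ?G \<le> ?a x")
proof (rule field_le_epsilon)
  fix e :: real assume e: "0 < e"
  have xS: "x \<in> S" using x F by auto
  interpret prob_space "Pr x" using xS by (rule prob_space_Pr)
  have a: "0 \<le> ?a z" for z using \<gamma> by (intro green_fun_nonneg[OF F]) auto
  define \<delta> where "\<delta> = e / T"
  have \<delta>: "0 < \<delta>" using e T by (simp add: \<delta>_def)
  have lim: "((\<lambda>h. \<Sum>y\<in>F. (p h z y - of_bool (z = y)) / h * ?a y) \<longlongrightarrow> (\<Sum>y\<in>F. q z y * ?a y)) (at_right 0)"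
    if "z \<in> F" for z
    using generator that F unfolding is_generator_def by (intro tendsto_intros) blast
  have "\<forall>\<^sub>F h in at_right 0. \<forall>z\<in>F. (\<Sum>y\<in>F. (p h z y - of_bool (z = y)) / h * ?a y) < (\<Sum>y\<in>F. q z y * ?a y) + \<delta>"
    using order_tendstoD(2)[OF lim] \<delta> F by (intro eventually_ball_finite) auto
  then obtain d where d: "0 < d"
    "\<And>h z. 0 < h \<Longrightarrow> h < d \<Longrightarrow> z \<in> F \<Longrightarrow>
      (\<Sum>y\<in>F. (p h z y - of_bool (z = y)) / h * ?a y) < (\<Sum>y\<in>F. q z y * ?a y) + \<delta>"
    by (auto simp: eventually_at_right_field)
  obtain N where N: "T / d < real N" using reals_Archimedean2 by blast
  have "0 < T / d" using T d by simp
  hence N0: "0 < N" using N by (cases N) auto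
  define h where "h = T / real N"
  have h: "0 < h" "h < d" "real N * h = T" using N N0 T d by (auto simp: h_def field_simps)
  have "(\<Sum>y\<in>F. p h z y * ?a y) \<le> (1 + \<gamma> * h) * ?a z - \<gamma> * h + h * \<delta>" if z: "z \<in> F" for z
  proof -
    have "(\<Sum>y\<in>F. q z y * ?a y) = \<gamma> * ?a z - \<gamma>"
      using shifted_green_fun[OF F _ z, of \<gamma> "\<lambda>_. \<gamma>"] \<gamma> by (simp add: shifted_def)
    moreover have "h * (\<Sum>y\<in>F. (p h z y - of_bool (z = y)) / h * ?a y) = (\<Sum>y\<in>F. p h z y * ?a y) - ?a z"
    proof -
      have "h * (\<Sum>y\<in>F. (p h z y - of_bool (z = y)) / h * ?a y)
          = (\<Sum>y\<in>F. p h z y * ?a y - of_bool (z = y) * ?a y)"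
        unfolding sum_distrib_left using h by (intro sum.cong refl) (simp add: left_diff_distrib)
      thus ?thesis using F z by (simp add: sum_subtractf)
    qed
    moreover have "h * (\<Sum>y\<in>F. (p h z y - of_bool (z = y)) / h * ?a y) \<le> h * ((\<Sum>y\<in>F. q z y * ?a y) + \<delta>)"
      using d(2)[OF h(1,2) z] h by (intro mult_left_mono) auto
    ultimately have "(\<Sum>y\<in>F. p h z y * ?a y) - ?a z \<le> h * (\<gamma> * ?a z - \<gamma> + \<delta>)" by simp
    thus ?thesis by (simp add: algebra_simps)
  qed
  from mesh_survival_le[OF \<gamma> F x h(1) less_imp_le[OF \<delta>] a this, of N]
  have "(1 - 1 / (1 + real N * \<gamma> * h)) * \<P>(\<omega> in Pr x. \<forall>i\<le>N. X (real i * h) \<omega> \<in> F)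
      \<le> ?a x + real N * h * \<delta>" .
  moreover have "real N * \<gamma> * h = \<gamma> * T" "real N * h * \<delta> = e"
    using h T by (simp_all add: mult_ac \<delta>_def)
  ultimately have "?c * \<P>(\<omega> in Pr x. \<forall>i\<le>N. X (real i * h) \<omega> \<in> F) \<le> ?a x + e" by simp
  moreover have "?c * ?G \<le> ?c * \<P>(\<omega> in Pr x. \<forall>i\<le>N. X (real i * h) \<omega> \<in> F)"
  proof (intro mult_left_mono finite_measure_mono stay_event xS h(1))
    show "{\<omega> \<in> space (Pr x). \<forall>r\<in>\<rat> \<inter> {0..1}. X (r * T) \<omega> \<in> F}
        \<subseteq> {\<omega> \<in> space (Pr x). \<forall>i\<le>N. X (real i * h) \<omega> \<in> F}"
    proof clarsimp
      fix \<omega> i assume r: "\<forall>r\<in>\<rat> \<inter> {0..1}. X (r * T) \<omega> \<in> F" and i: "i \<le> N"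
      have "real i / real N \<in> \<rat> \<inter> {0..1}" using i N0 by auto
      from r[rule_format, OF this] show "X (real i * h) \<omega> \<in> F" by (simp add: h_def)
    qed
    have "0 \<le> \<gamma> * T" using \<gamma> T by simp
    thus "0 \<le> ?c" by simp
  qed
  ultimately show "?c * ?G \<le> ?a x + e" by linarith
qed

text \<open>
  A path on \<open>[0, T]\<close> has finite range, so the probability of confinement to \<open>E m\<close> tends to 1 for each
  \<open>T\<close>; taking \<open>T\<close> large makes the factor in \<open>confinement_le\<close> close to 1.
\<close>

theorem nonexplosion:
  assumes \<gamma>: "0 < \<gamma>" and E: "\<And>m. finite (E m)" "incseq E" "(\<Union>m. E m) = S" and x: "x \<in> S"
  shows "(\<lambda>m. green_fun \<gamma> (E m) (\<lambda>_. \<gamma>) x) \<longlonglongrightarrow> 1"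
proof (rule LIMSEQ_I)
  fix e :: real assume e: "0 < e"
  interpret prob_space "Pr x" using x by (rule prob_space_Pr)
  have ES: "E m \<subseteq> S" for m using E by auto
  \<comment> \<open>chosen such that \<open>1 / (1 + \<gamma> T) < e / 2\<close>\<close>
  define T where "T = 2 / (e * \<gamma>)"
  have T: "0 < T" using e \<gamma> by (simp add: T_def)
  define G where "G m = {\<omega> \<in> space (Pr x). \<forall>r\<in>\<rat> \<inter> {0..1}. X (r * T) \<omega> \<in> E m}" for m
  have G_sets: "G m \<in> sets (Pr x)" for m
  proof -
    have "G m = (\<Inter>r\<in>\<rat> \<inter> {0..1}. {\<omega> \<in> space (Pr x). X (r * T) \<omega> \<in> E m})"
    proof (rule subset_antisym)
      show "(\<Inter>r\<in>\<rat> \<inter> {0..1}. {\<omega> \<in> space (Pr x). X (r * T) \<omega> \<in> E m}) \<subseteq> G m"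
        unfolding G_def using Rats_0 atLeastAtMost_iff[of 0 0 "1::real"] by fastforce
    qed (unfold G_def, blast)
    also have "\<dots> \<in> sets (Pr x)"
    proof (rule sets.countable_INT')
      show "countable (\<rat> \<inter> {0..1::real})" using countable_rat by blast
      show "\<rat> \<inter> {0..1::real} \<noteq> {}" using Rats_0 by (auto intro!: exI[of _ 0])
      show "(\<lambda>r. {\<omega> \<in> space (Pr x). X (r * T) \<omega> \<in> E m}) ` (\<rat> \<inter> {0..1}) \<subseteq> sets (Pr x)"
        using T by (intro image_subsetI events x) simp
    qed
    finally show ?thesis .
  qed
  have G_UN: "(\<Union>m. G m) \<in> sets (Pr x)" using G_sets by (intro sets.countable_UN) blast
  have "prob (\<Union>m. G m) = 1"
  proof -
    have "AE \<omega> in Pr x. regular_jump_path (\<lambda>t. X t \<omega>)"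
      using chain x by (simp add: regular_jump_chain_def)
    hence "AE \<omega> in Pr x. \<omega> \<in> (\<Union>m. G m)"
      using AE_space
    proof eventually_elim
      case (elim \<omega>)
      have "(\<lambda>t. X t \<omega>) ` {0..T} \<subseteq> (\<Union>m. E m)"
        using state_in[OF x _ elim(2)] E(3) by auto
      then obtain m where m: "(\<lambda>t. X t \<omega>) ` {0..T} \<subseteq> E m"
        using finite_subset_incseq[OF regular_jump_path_finite_range[OF elim(1)] E(2)] by blast
      have "r * T \<in> {0..T}" if "r \<in> {0..1}" for r
        using that T by (auto simp: mult_left_le_one_le)
      hence "\<omega> \<in> G m" using m elim(2) by (auto simp: G_def)
      thus ?case by blast
    qed
    thus ?thesis using G_UN by (simp only: prob_eq_1)
  qed
  moreover have "incseq G" using E(2) by (force simp: G_def incseq_def)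
  ultimately have "(\<lambda>m. prob (G m)) \<longlonglongrightarrow> 1"
    using finite_Lim_measure_incseq[of G] G_sets by auto
  hence "\<forall>\<^sub>F m in sequentially. 1 - e / 2 < prob (G m)" using e by (intro order_tendstoD(1)) auto
  moreover have "\<forall>\<^sub>F m in sequentially. x \<in> E m"
  proof -
    obtain m0 where "x \<in> E m0" using x E by auto
    thus ?thesis using E(2) by (auto simp: eventually_sequentially incseq_def)
  qed
  ultimately have "\<forall>\<^sub>F m in sequentially. norm (green_fun \<gamma> (E m) (\<lambda>_. \<gamma>) x - 1) < e"
  proof eventually_elim
    case (elim m)
    have "green_fun \<gamma> (E m) (\<lambda>_. \<gamma>) x \<le> 1"
      using \<gamma> row_sum_nonpos[OF E(1) ES] by (intro green_comparison[OF E(1) ES _ _ elim(2)]) (auto simp: shifted_def)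
    moreover have "(1 - 1 / (1 + \<gamma> * T)) * prob (G m) \<le> green_fun \<gamma> (E m) (\<lambda>_. \<gamma>) x"
      using confinement_le[OF \<gamma> E(1) ES elim(2) T] by (simp add: G_def)
    moreover have "1 - e < (1 - 1 / (1 + \<gamma> * T)) * prob (G m)"
    proof -
      have "1 / (1 + \<gamma> * T) < e / 2" using e \<gamma> by (simp add: T_def field_simps)
      moreover have "1 / (1 + \<gamma> * T) * prob (G m) \<le> 1 / (1 + \<gamma> * T)"
        using \<gamma> T by (intro mult_left_le) auto
      ultimately show ?thesis using elim(1) by (simp add: left_diff_distrib)
    qed
    ultimately show ?case by simp
  qed
  thus "\<exists>no. \<forall>n\<ge>no. norm (green_fun \<gamma> (E n) (\<lambda>_. \<gamma>) x - 1) < e"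
    by (simp add: eventually_sequentially)
qed

end

section \<open>Hitting a reference state\<close>

text \<open>
  Dominated convergence for sums over a sequence of finite sets, with summands that vary along the
  sequence.
\<close>

lemma tendsto_sum_dominated:
  fixes f :: "nat \<Rightarrow> 's \<Rightarrow> real"
  assumes E: "\<And>m. finite (E m)" "\<And>m. E m \<subseteq> S"
    and g: "g summable_on S"
    and f: "\<forall>\<^sub>F m in sequentially. \<forall>x\<in>E m. 0 \<le> f m x \<and> f m x \<le> g x"
    and lim: "\<And>x. x \<in> S \<Longrightarrow> (\<lambda>m. f m x) \<longlonglongrightarrow> 0"
  shows "(\<lambda>m. \<Sum>x\<in>E m. f m x) \<longlonglongrightarrow> 0"
proof (rule tendstoI)
  fix e :: real assume e: "0 < e"
  obtain I where "(g has_sum I) S" using g by (auto simp: summable_on_def)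
  then obtain F where F: "finite F" "F \<subseteq> S"
    and cauchy: "\<And>Y. finite Y \<Longrightarrow> F \<subseteq> Y \<Longrightarrow> Y \<subseteq> S \<Longrightarrow> dist (sum g Y) I < e / 4"
    using e unfolding has_sum_def by (metis (no_types, lifting) eventually_finite_subsets_at_top tendstoD zero_less_divide_iff zero_less_numeral)
  have tail: "(\<Sum>x\<in>E m - F. g x) < e / 2" for m
  proof -
    have "sum g (F \<union> (E m - F)) = sum g F + sum g (E m - F)"
      using F E by (intro sum.union_disjoint) auto
    moreover have "dist (sum g (F \<union> (E m - F))) I < e / 4" "dist (sum g F) I < e / 4"
      using F E(1)[of m] E(2)[of m] by (intro cauchy; auto)+
    ultimately show ?thesis unfolding dist_real_def by linarith
  qed
  have "(\<lambda>m. \<Sum>x\<in>F. \<bar>f m x\<bar>) \<longlonglongrightarrow> (\<Sum>x\<in>F. 0)"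
    using F lim by (intro tendsto_sum tendsto_rabs_zero) auto
  hence "\<forall>\<^sub>F m in sequentially. (\<Sum>x\<in>F. \<bar>f m x\<bar>) < e / 2"
    using e by (intro order_tendstoD(2)) auto
  thus "\<forall>\<^sub>F m in sequentially. dist (\<Sum>x\<in>E m. f m x) 0 < e"
    using f
  proof eventually_elim
    case (elim m)
    have "(\<Sum>x\<in>E m. f m x) = (\<Sum>x\<in>E m \<inter> F. f m x) + (\<Sum>x\<in>E m - F. f m x)"
      using E by (subst sum.union_disjoint[symmetric]) (auto simp: Int_Diff_Un)
    also have "(\<Sum>x\<in>E m \<inter> F. f m x) \<le> (\<Sum>x\<in>F. \<bar>f m x\<bar>)"
      using F by (intro order_trans[OF sum_mono sum_mono2]) auto
    also have "(\<Sum>x\<in>E m - F. f m x) \<le> (\<Sum>x\<in>E m - F. g x)"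
      using elim(2) by (intro sum_mono) auto
    finally have "(\<Sum>x\<in>E m. f m x) < e" using elim(1) tail[of m] by simp
    moreover have "0 \<le> (\<Sum>x\<in>E m. f m x)" using elim(2) by (intro sum_nonneg) auto
    ultimately show ?case by simp
  qed
qed

context irreducible_rates
begin

lemma green_abs_le:
  assumes A: "finite A" "A \<subseteq> S" and \<gamma>: "0 \<le> \<gamma>" and le: "\<And>z. z \<in> A \<Longrightarrow> \<bar>f z\<bar> \<le> 1"
  shows "\<bar>green_fun \<gamma> A f x\<bar> \<le> green_fun \<gamma> A (\<lambda>_. 1) x"
proof -
  have "\<bar>green_fun \<gamma> A f x\<bar> \<le> (\<Sum>z\<in>A. \<bar>green \<gamma> A x z * f z\<bar>)"
    unfolding green_fun_def by (rule sum_abs)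
  also have "\<dots> \<le> (\<Sum>z\<in>A. green \<gamma> A x z * 1)"
    using green_nonneg[OF A \<gamma>] le by (intro sum_mono) (simp add: abs_mult mult_left_le)
  finally show ?thesis by (simp add: green_fun_def)
qed

lemma shifted_insert:
  assumes "finite F" "y \<in> F"
  shows "shifted \<gamma> (F - {y}) h x = shifted \<gamma> F h x + q x y * h y"
  using assms by (simp add: shifted_def sum.remove[of F y])

text \<open>
  Let \<open>z\<close> be the mean time in \<open>C\<close> before hitting \<open>y\<close> or leaving \<open>F\<close>.  It is largest on \<open>C\<close>, say with
  maximum \<open>s\<close>.  Since \<open>(\<beta> - Q\<^sub>F) z \<le> \<beta> z + 1\<^sub>C\<close>, the supersolution property of \<open>r\<close> yields
  \<open>z \<le> r (z + 1\<^sub>C / \<beta>)\<close>.  On \<open>C\<close> the kernel \<open>r\<close> puts mass at least \<open>\<phi>\<close> on \<open>y\<close>, where \<open>z\<close> vanishes,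
  so \<open>s \<le> (1 - \<phi>) s + 1 / \<beta>\<close>.
\<close>

theorem occupation_bound:
  fixes r :: "'s \<Rightarrow> 's \<Rightarrow> real"
  assumes F: "finite F" "F \<subseteq> S" and y: "y \<in> F" and C: "C \<subseteq> F" and \<beta>: "0 < \<beta>"
    and r: "\<And>x z. 0 \<le> r x z" "\<And>x. x \<in> F \<Longrightarrow> (\<Sum>z\<in>F. r x z) \<le> 1"
    and super: "\<And>x z. x \<in> F \<Longrightarrow> z \<in> F \<Longrightarrow> \<beta> * of_bool (x = z) \<le> shifted \<beta> F (\<lambda>x. r x z) x"
    and \<phi>: "0 < \<phi>" "\<And>x. x \<in> C \<Longrightarrow> \<phi> \<le> r x y"
  shows "green_fun 0 (F - {y}) (indicator C) x \<le> 1 / (\<beta> * \<phi>)"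
proof -
  define A where "A = F - {y}"
  have A: "finite A" "A \<subseteq> S" using F by (auto simp: A_def)
  define z where "z = green_fun 0 A (indicator C)"
  have z0: "0 \<le> z x" for x unfolding z_def by (intro green_fun_nonneg[OF A]) auto
  have zA: "z x = 0" if "x \<notin> A" for x unfolding z_def using that by (intro green_fun_zero[OF A]) auto
  have zeq: "shifted 0 A z x = indicator C x" if "x \<in> A" for x
    unfolding z_def using that by (intro shifted_green_fun[OF A]) auto
  define s where "s = Max (insert 0 (z ` (C \<inter> A)))"
  have finC: "finite (C \<inter> A)" using A by auto
  have s0: "0 \<le> s" and s_ge: "x \<in> C \<inter> A \<Longrightarrow> z x \<le> s" for x
    using finC by (auto simp: s_def)
  have z_le: "z x \<le> s" for x
  proof (cases "x \<in> A - C")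
    case True
    have "0 \<le> s - z x"
    proof (rule minimum_principle[of "A - C" 0 "\<lambda>x. s - z x"])
      fix u assume u: "u \<in> A - C"
      have "shifted 0 (A - C) (\<lambda>x. s - z x) u
          = shifted 0 A (\<lambda>x. s - z x) u + (\<Sum>w\<in>C \<inter> A. q u w * (s - z w))"
      proof -
        have "(\<Sum>w\<in>A. q u w * (s - z w)) = (\<Sum>w\<in>A - C. q u w * (s - z w)) + (\<Sum>w\<in>C \<inter> A. q u w * (s - z w))"
          using A by (subst sum.union_disjoint[symmetric]) (auto intro: sum.cong)
        thus ?thesis by (simp add: shifted_def)
      qed
      moreover have "shifted 0 A (\<lambda>x. s - z x) u = - s * (\<Sum>w\<in>A. q u w)"
        using zeq[of u] u by (simp add: shifted_def right_diff_distrib sum_subtractf sum_distrib_left sum_negf mult.commute)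
      moreover have "0 \<le> - s * (\<Sum>w\<in>A. q u w)"
        using s0 row_sum_nonpos[OF A, of u] u by (simp add: mult_nonneg_nonpos)
      moreover have "0 \<le> (\<Sum>w\<in>C \<inter> A. q u w * (s - z w))"
        using u A s_ge by (intro sum_nonneg mult_nonneg_nonneg rate_nonneg) (auto simp: subset_iff)
      ultimately show "0 \<le> shifted 0 (A - C) (\<lambda>x. s - z x) u" by simp
    qed (use A True in auto)
    thus ?thesis by simp
  next
    case False
    thus ?thesis using s_ge[of x] s0 zA[of x] by (cases "x \<in> A") auto
  qed
  have C_bound: "z x \<le> s * (1 - \<phi>) + 1 / \<beta>" if x: "x \<in> C \<inter> A" for x
  proof -
    define k where "k w = z w + indicator C w / \<beta>" for w
    have k0: "0 \<le> k w" for w using z0 \<beta> by (simp add: k_def)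
    \<comment> \<open>\<open>\<psi>\<close> is a supersolution of the system \<open>(\<beta> - Q\<^sub>F) z \<le> \<beta> z + 1\<^sub>C\<close> satisfied by \<open>z\<close>\<close>
    define \<psi> where "\<psi> x = (\<Sum>w\<in>F. k w * r x w)" for x
    have xF: "x \<in> F" using x by (auto simp: A_def)
    have "0 \<le> \<psi> x - z x"
    proof (rule minimum_principle[OF F, of \<beta> "\<lambda>x. \<psi> x - z x"])
      fix u assume u: "u \<in> F"
      have "shifted \<beta> F \<psi> u = (\<Sum>w\<in>F. k w * shifted \<beta> F (\<lambda>x. r x w) u)"
        unfolding shifted_def \<psi>_def sum_distrib_left right_diff_distrib sum_subtractf
        by (subst sum.swap) (simp add: mult_ac)
      also have "\<dots> \<ge> (\<Sum>w\<in>F. k w * (\<beta> * of_bool (u = w)))"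
        using super u k0 by (intro sum_mono mult_left_mono) auto
      also (xtrans) have "(\<Sum>w\<in>F. k w * (\<beta> * of_bool (u = w))) = \<beta> * k u"
      proof -
        have "(\<Sum>w\<in>F. k w * (\<beta> * of_bool (u = w))) = (\<Sum>w\<in>F. if u = w then \<beta> * k w else 0)"
          by (intro sum.cong) auto
        thus ?thesis using F u by simp
      qed
      finally have 1: "\<beta> * z u + indicator C u \<le> shifted \<beta> F \<psi> u" using \<beta> by (simp add: k_def distrib_left)
      have eq: "shifted \<beta> F z u = \<beta> * z u + shifted 0 A z u"
        using shifted_insert[OF F(1) y, of \<beta> z u] zA[of y] by (simp add: A_def shifted_def)
      have "shifted \<beta> F z u \<le> \<beta> * z u + indicator C u"
      proof (cases "u = y")
        case True
        have "0 \<le> (\<Sum>w\<in>A. q u w * z w)"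
          using z0 True y F by (intro sum_nonneg mult_nonneg_nonneg rate_nonneg) (auto simp: A_def)
        thus ?thesis unfolding eq by (simp add: shifted_def indicator_def)
      next
        case False
        thus ?thesis unfolding eq using zeq[of u] u by (simp add: A_def)
      qed
      thus "0 \<le> shifted \<beta> F (\<lambda>x. \<psi> x - z x) u" using 1 by (simp add: shifted_diff)
    qed (use \<beta> xF in auto)
    hence "z x \<le> \<psi> x" by simp
    also have "\<psi> x = (\<Sum>w\<in>F. z w * r x w) + (\<Sum>w\<in>F. indicator C w / \<beta> * r x w)"
      by (simp add: \<psi>_def k_def distrib_right sum.distrib)
    also have "(\<Sum>w\<in>F. indicator C w / \<beta> * r x w) \<le> (\<Sum>w\<in>F. 1 / \<beta> * r x w)"
      using \<beta> r by (intro sum_mono mult_right_mono) (auto simp: indicator_def)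
    also have "\<dots> \<le> 1 / \<beta>"
      using divide_right_mono[OF r(2)[OF xF], of \<beta>] \<beta> by (simp add: sum_divide_distrib)
    also have "(\<Sum>w\<in>F. z w * r x w) = (\<Sum>w\<in>A. z w * r x w)"
      using sum.remove[OF F(1) y, of "\<lambda>w. z w * r x w"] zA[of y] by (simp add: A_def)
    also have "\<dots> \<le> (\<Sum>w\<in>A. s * r x w)"
      using z_le r by (intro sum_mono mult_right_mono) auto
    also have "\<dots> = s * (\<Sum>w\<in>A. r x w)" by (simp add: sum_distrib_left)
    also have "\<dots> \<le> s * (1 - \<phi>)"
    proof (intro mult_left_mono s0)
      have "(\<Sum>w\<in>F. r x w) = r x y + (\<Sum>w\<in>A. r x w)"
        unfolding A_def by (rule sum.remove[OF F(1) y])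
      thus "(\<Sum>w\<in>A. r x w) \<le> 1 - \<phi>" using r(2)[OF xF] \<phi>(2)[of x] x by simp
    qed
    finally show ?thesis by simp
  qed
  have "s * (\<beta> * \<phi>) \<le> 1"
  proof (cases "s = 0")
    case False
    have "s \<in> insert 0 (z ` (C \<inter> A))" unfolding s_def using finC by (intro Max_in) auto
    then obtain x where "x \<in> C \<inter> A" "s = z x" using False by auto
    hence "s \<le> s * (1 - \<phi>) + 1 / \<beta>" using C_bound[of x] by simp
    thus ?thesis using \<beta> by (simp add: field_simps)
  qed simp
  hence "s \<le> 1 / (\<beta> * \<phi>)" using \<beta> \<phi>(1) by (simp add: field_simps)
  thus ?thesis using z_le[of x] by (simp add: z_def A_def)
qed

lemma drift_on_finite:
  assumes drift: "drift_condition S q b C v" and A: "finite A" "A \<subseteq> S" and x: "x \<in> A"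
  shows "1 - b * indicator C x \<le> shifted 0 A v x"
proof -
  have xS: "x \<in> S" using A x by auto
  have sum: "(\<lambda>z. q x z * v z) summable_on S" and
    le: "(\<Sum>\<^sub>\<infinity>z\<in>S. q x z * v z) \<le> - 1 + b * indicator C x"
    and v: "\<And>z. z \<in> S \<Longrightarrow> 0 < v z"
    using drift xS by (auto simp: drift_condition_def)
  have "(\<Sum>z\<in>A. q x z * v z) \<le> (\<Sum>\<^sub>\<infinity>z\<in>S. q x z * v z)"
    using A xS x v
    by (intro finite_sum_le_infsum[OF sum] mult_nonneg_nonneg rate_nonneg) (auto intro: less_imp_le)
  thus ?thesis using le by (simp add: shifted_def)
qed

text \<open>
  By the drift condition, \<open>v\<close> plus \<open>b\<close> times the mean time in \<open>C\<close> is a supersolution of the system for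
  the mean exit time.
\<close>

lemma hitting_time_bound:
  assumes drift: "drift_condition S q b C v" and A: "finite A" "A \<subseteq> S" and x: "x \<in> S"
    and occ: "\<And>x. green_fun 0 A (indicator C) x \<le> c"
  shows "green_fun 0 A (\<lambda>_. 1) x \<le> v x + b * c"
proof (cases "x \<in> A")
  case True
  have b: "0 < b" using drift by (simp add: drift_condition_def)
  have "green_fun 0 A (\<lambda>_. 1) x \<le> v x + b * green_fun 0 A (indicator C) x"
  proof (rule green_comparison[OF A _ _ True])
    fix z assume z: "z \<in> A"
    show "1 \<le> shifted 0 A (\<lambda>x. v x + b * green_fun 0 A (indicator C) x) z"
      unfolding shifted_add shifted_scale using drift_on_finite[OF drift A z] shifted_green_fun[OF A _ z]
      by simp
  qed simp
  also have "\<dots> \<le> v x + b * c" using b occ by simp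
  finally show ?thesis .
next
  case False
  have "0 \<le> green_fun 0 A (indicator C) x" by (intro green_fun_nonneg[OF A]) auto
  hence "0 \<le> c" using occ[of x] by linarith
  moreover have "0 < v x" "0 < b" using drift x by (auto simp: drift_condition_def)
  ultimately show ?thesis using False A by (simp add: green_fun_zero)
qed

text \<open>
  The probability of leaving \<open>F\<close> before hitting \<open>y\<close>: the expected time in a state of \<open>F - {y}\<close>, times the
  rate at which \<open>F\<close> is left from there.
\<close>

definition escape :: "'s set \<Rightarrow> 's \<Rightarrow> 's \<Rightarrow> real" where
  "escape F y = green_fun 0 (F - {y}) (\<lambda>x. - (\<Sum>z\<in>F. q x z))"

context
  fixes F y
  assumes F: "finite F" "F \<subseteq> S" and y: "y \<in> F"
begin

lemma F_minus: "finite (F - {y})" "F - {y} \<subseteq> S" using F by auto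

lemma escape_nonneg: "0 \<le> escape F y x"
  unfolding escape_def using row_sum_nonpos[OF F] by (intro green_fun_nonneg[OF F_minus]) auto

text \<open>
  The chain leaves the finite set \<open>F - {y}\<close> almost surely, either into \<open>y\<close> or out of \<open>F\<close>.
\<close>

lemma one_minus_escape:
  assumes "x \<in> F - {y}"
  shows "green_fun 0 (F - {y}) (\<lambda>x. q x y) x = 1 - escape F y x"
proof -
  have "1 - escape F y x - green_fun 0 (F - {y}) (\<lambda>x. q x y) x = 0"
  proof (rule kernel_trivial[OF F_minus _ _ assms, of 0 "\<lambda>x. 1 - escape F y x - green_fun 0 (F - {y}) (\<lambda>x. q x y) x"])
    fix u assume "u \<in> F - {y}"
    thus "shifted 0 (F - {y}) (\<lambda>x. 1 - escape F y x - green_fun 0 (F - {y}) (\<lambda>x. q x y) x) u = 0"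
      unfolding shifted_diff escape_def
      using shifted_green_fun[OF F_minus] F(1) y by (simp add: shifted_def[of 0 _ "\<lambda>x. 1"] sum.remove[of F y])
  qed simp
  thus ?thesis by simp
qed

lemma escape_le_1: "escape F y x \<le> 1"
proof (cases "x \<in> F - {y}")
  case True
  have "0 \<le> green_fun 0 (F - {y}) (\<lambda>x. q x y) x"
    using y F by (intro green_fun_nonneg[OF F_minus] rate_nonneg) auto
  thus ?thesis using one_minus_escape[OF True] by simp
next
  case False
  thus ?thesis by (simp add: escape_def green_fun_zero[OF F_minus])
qed

lemma survival_le_1: "0 < \<gamma> \<Longrightarrow> x \<in> F \<Longrightarrow> green_fun \<gamma> F (\<lambda>_. \<gamma>) x \<le> 1"
  by (rule green_comparison[OF F]) (use row_sum_nonpos[OF F] in \<open>auto simp: shifted_def\<close>)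

text \<open>
  Run a clock of rate \<open>\<gamma>\<close>.  Either \<open>F\<close> is left before the clock rings, or the clock rings before \<open>F - {y}\<close>
  is left; the latter has probability at most \<open>\<gamma>\<close> times the mean exit time.
\<close>

lemma escape_le:
  assumes \<gamma>: "0 < \<gamma>" and x: "x \<in> F - {y}"
  shows "escape F y x \<le> 1 - green_fun \<gamma> F (\<lambda>_. \<gamma>) x + \<gamma> * green_fun 0 (F - {y}) (\<lambda>_. 1) x"
  unfolding escape_def
proof (rule green_comparison[OF F_minus _ _ x])
  let ?a = "green_fun \<gamma> F (\<lambda>_. \<gamma>)"
  fix u assume u: "u \<in> F - {y}"
  have "shifted 0 F ?a u = \<gamma> - \<gamma> * ?a u"
    using shifted_green_fun[OF F, of \<gamma> u "\<lambda>_. \<gamma>"] \<gamma> u by (simp add: shifted_def)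
  moreover have "shifted 0 F (\<lambda>_. 1) u = - (\<Sum>z\<in>F. q u z)" by (simp add: shifted_def)
  moreover have "0 \<le> q u y * (1 - ?a y)"
    using u y F survival_le_1[OF \<gamma> y] by (intro mult_nonneg_nonneg rate_nonneg) auto
  moreover have "0 \<le> \<gamma> * ?a u" using \<gamma> by (intro mult_nonneg_nonneg green_fun_nonneg[OF F]) auto
  ultimately show "- (\<Sum>z\<in>F. q u z)
      \<le> shifted 0 (F - {y}) (\<lambda>x. 1 - ?a x + \<gamma> * green_fun 0 (F - {y}) (\<lambda>_. 1) x) u"
    unfolding shifted_add shifted_scale
    using shifted_green_fun[OF F_minus _ u, of 0 "\<lambda>_. 1"] shifted_insert[OF F(1) y, of 0 "\<lambda>x. 1 - ?a x" u]
    by (simp add: shifted_diff)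
qed simp

end

end

section \<open>Approximate solutions of Poisson's equation\<close>

text \<open>
  From here on the chain is represented by its rates, by non-explosion, expressed through the finite
  resolvents, and by the stationary equations.
\<close>

locale exhausted_rates = irreducible_rates S q
  for S :: "'s set" and q :: "'s \<Rightarrow> 's \<Rightarrow> real" +
  fixes E :: "nat \<Rightarrow> 's set" and \<pi> :: "'s \<Rightarrow> real"
  assumes finite_E: "finite (E m)" and incseq_E: "incseq E" and UN_E: "(\<Union>m. E m) = S"
    and nonexplosive: "0 < \<gamma> \<Longrightarrow> x \<in> S \<Longrightarrow> (\<lambda>m. green_fun \<gamma> (E m) (\<lambda>_. \<gamma>) x) \<longlonglongrightarrow> 1"
    and stationary: "stationary_distribution S q \<pi>"
begin

lemma E_subset: "E m \<subseteq> S" using UN_E by auto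

lemma eventually_in_E: "x \<in> S \<Longrightarrow> \<forall>\<^sub>F m in sequentially. x \<in> E m"
proof -
  assume "x \<in> S"
  then obtain m0 where "x \<in> E m0" using UN_E by auto
  thus ?thesis using incseq_E by (auto simp: eventually_sequentially incseq_def)
qed

lemma eventually_E_subset: "finite A \<Longrightarrow> A \<subseteq> S \<Longrightarrow> \<forall>\<^sub>F m in sequentially. A \<subseteq> E m"
  using eventually_in_E by (auto simp: subset_eq eventually_ball_finite_distrib)

lemma filterlim_E: "filterlim E (finite_subsets_at_top S) sequentially"
  unfolding filterlim_finite_subsets_at_top
proof (intro allI impI)
  fix F assume "finite F \<and> F \<subseteq> S"
  hence "\<forall>\<^sub>F m in sequentially. F \<subseteq> E m" by (intro eventually_E_subset) auto
  thus "\<forall>\<^sub>F m in sequentially. finite (E m) \<and> F \<subseteq> E m \<and> E m \<subseteq> S"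
    by eventually_elim (use finite_E E_subset in auto)
qed

lemma has_sum_tendsto_E: "(f has_sum I) S \<Longrightarrow> (\<lambda>m. \<Sum>x\<in>E m. f x) \<longlonglongrightarrow> I"
  unfolding has_sum_def by (rule filterlim_compose[OF _ filterlim_E])

lemma pi_pos: "x \<in> S \<Longrightarrow> 0 < \<pi> x"
  and pi_sum: "(\<pi> has_sum 1) S"
  and pi_balance: "y \<in> S \<Longrightarrow> ((\<lambda>x. \<pi> x * q x y) has_sum 0) S"
  using stationary by (auto simp: stationary_distribution_def)

definition mean :: "('s \<Rightarrow> real) \<Rightarrow> real" where
  "mean g = (\<Sum>\<^sub>\<infinity>x\<in>S. \<pi> x * g x)"

lemma mean_has_sum:
  assumes "\<And>x. x \<in> S \<Longrightarrow> \<bar>g x\<bar> \<le> 1"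
  shows "((\<lambda>x. \<pi> x * g x) has_sum mean g) S"
proof -
  have "(\<lambda>x. \<pi> x * g x) summable_on S"
  proof (rule Infinite_Sum.abs_summable_summable, rule summable_on_comparison_test)
    show "\<pi> summable_on S" using pi_sum by (auto simp: summable_on_def)
    fix x assume "x \<in> S"
    thus "norm (\<pi> x * g x) \<le> \<pi> x" using assms pi_pos[of x] by (simp add: abs_mult mult_left_le)
  qed auto
  thus ?thesis unfolding mean_def by (rule has_sum_infsum)
qed

context
  fixes y :: 's and K :: "'s \<Rightarrow> real"
  assumes y: "y \<in> S"
    and hitting: "\<And>x. x \<in> S \<Longrightarrow> \<forall>\<^sub>F m in sequentially. green_fun 0 (E m - {y}) (\<lambda>_. 1) x \<le> K x"
begin

lemma A_fin: "finite (E m - {y})" "E m - {y} \<subseteq> S"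
  using finite_E E_subset by auto

text \<open>
  Finite mean hitting times and non-explosion together give recurrence.  In \<open>escape_le\<close> the first
  difference tends to 0 with \<open>m\<close> for each \<open>\<gamma>\<close>, and the other term is at most \<open>\<gamma> K\<close> for all large \<open>m\<close>, so
  \<open>\<gamma>\<close> can be chosen small.
\<close>

lemma escape_tendsto_0:
  assumes x: "x \<in> S"
  shows "(\<lambda>m. escape (E m) y x) \<longlonglongrightarrow> 0"
proof (cases "x = y")
  case True
  thus ?thesis using A_fin by (simp add: escape_def green_fun_zero)
next
  case False
  have K: "0 \<le> K x"
  proof -
    obtain m where "green_fun 0 (E m - {y}) (\<lambda>_. 1) x \<le> K x"
      using eventually_happens[OF hitting[OF x]] by auto
    moreover have "0 \<le> green_fun 0 (E m - {y}) (\<lambda>_. 1) x" by (intro green_fun_nonneg[OF A_fin]) auto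
    ultimately show ?thesis by linarith
  qed
  show ?thesis
  proof (rule tendstoI)
    fix e :: real assume e: "0 < e"
    define \<gamma> where "\<gamma> = e / (2 * (K x + 1))"
    have \<gamma>: "0 < \<gamma>" "\<gamma> * K x \<le> e / 2" using e K by (auto simp: \<gamma>_def field_simps)
    have "\<forall>\<^sub>F m in sequentially. 1 - e / 2 < green_fun \<gamma> (E m) (\<lambda>_. \<gamma>) x"
      using nonexplosive[OF \<gamma>(1) x] e by (intro order_tendstoD(1)) auto
    thus "\<forall>\<^sub>F m in sequentially. dist (escape (E m) y x) 0 < e"
      using eventually_in_E[OF x] eventually_in_E[OF y] hitting[OF x]
    proof eventually_elim
      case (elim m)
      have "escape (E m) y x \<le> 1 - green_fun \<gamma> (E m) (\<lambda>_. \<gamma>) x + \<gamma> * green_fun 0 (E m - {y}) (\<lambda>_. 1) x"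
        using elim False by (intro escape_le[OF finite_E E_subset elim(3) \<gamma>(1)]) auto
      moreover have "\<gamma> * green_fun 0 (E m - {y}) (\<lambda>_. 1) x \<le> \<gamma> * K x"
        using elim \<gamma> by (intro mult_left_mono) auto
      ultimately have "escape (E m) y x < e" using elim \<gamma> by linarith
      thus ?case using escape_nonneg[OF finite_E E_subset elim(3), of x] by simp
    qed
  qed
qed

text \<open>
  Up to the factor \<open>- q y y\<close>, the expected time in \<open>x\<close> during an excursion from \<open>y\<close> that is stopped on
  its return to \<open>y\<close> or on leaving \<open>E m\<close>; normalised to be 1 at \<open>y\<close>.
\<close>

definition cycle_visits :: "nat \<Rightarrow> 's \<Rightarrow> real" where
  "cycle_visits m x = of_bool (x = y) + (\<Sum>z\<in>E m - {y}. q y z * green 0 (E m - {y}) z x)"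

definition defect :: "nat \<Rightarrow> 's \<Rightarrow> real" where
  "defect m x = \<pi> x - \<pi> y * cycle_visits m x"

lemma cycle_y: "cycle_visits m y = 1"
  by (simp add: cycle_visits_def green_zero[OF A_fin])

lemma cycle_nonneg: "x \<in> S \<Longrightarrow> 0 \<le> cycle_visits m x"
  unfolding cycle_visits_def using y A_fin
  by (intro add_nonneg_nonneg sum_nonneg mult_nonneg_nonneg rate_nonneg green_nonneg[OF A_fin]) auto

lemma sum_cycle:
  assumes "y \<in> E m"
  shows "(\<Sum>x\<in>E m. cycle_visits m x * g x) = g y + (\<Sum>z\<in>E m - {y}. q y z * green_fun 0 (E m - {y}) g z)"
proof -
  have "(\<Sum>x\<in>E m. cycle_visits m x * g x) = g y + (\<Sum>x\<in>E m - {y}. cycle_visits m x * g x)"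
    using sum.remove[OF finite_E assms, of "\<lambda>x. cycle_visits m x * g x"] by (simp add: cycle_y)
  also have "(\<Sum>x\<in>E m - {y}. cycle_visits m x * g x)
      = (\<Sum>x\<in>E m - {y}. \<Sum>z\<in>E m - {y}. q y z * green 0 (E m - {y}) z x * g x)"
    by (intro sum.cong refl) (simp add: cycle_visits_def sum_distrib_right)
  also have "\<dots> = (\<Sum>z\<in>E m - {y}. q y z * green_fun 0 (E m - {y}) g z)"
    by (subst sum.swap) (simp add: green_fun_def sum_distrib_left mult.assoc)
  finally show ?thesis .
qed

lemma sum_pi_rate_le:
  assumes F: "finite F" "F \<subseteq> S" "z \<in> F"
  shows "(\<Sum>x\<in>F. \<pi> x * q x z) \<le> 0"
proof -
  have "((\<lambda>x. \<pi> x * q x z) has_sum (0 - (\<Sum>x\<in>F. \<pi> x * q x z))) (S - F)"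
    using F by (intro has_sum_Diff[OF pi_balance] has_sum_finite) auto
  hence "0 \<le> 0 - (\<Sum>x\<in>F. \<pi> x * q x z)"
    by (rule has_sum_nonneg) (use F in \<open>auto intro!: mult_nonneg_nonneg rate_nonneg less_imp_le[OF pi_pos]\<close>)
  thus ?thesis by simp
qed

text \<open>
  Away from \<open>y\<close> the cycle occupation satisfies the stationary equations within \<open>E m\<close>.
\<close>

lemma cycle_balance:
  assumes "y \<in> E m" and z: "z \<in> E m - {y}"
  shows "(\<Sum>x\<in>E m - {y}. cycle_visits m x * q x z) = - q y z"
proof -
  have left: "(\<Sum>x\<in>E m - {y}. green 0 (E m - {y}) w x * q x z) = - of_bool (w = z)" if "w \<in> E m - {y}" for w
    using green_left[OF A_fin _ that z, of 0] by simp
  have "(\<Sum>x\<in>E m - {y}. cycle_visits m x * q x z)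
      = (\<Sum>x\<in>E m - {y}. \<Sum>w\<in>E m - {y}. q y w * (green 0 (E m - {y}) w x * q x z))"
    by (intro sum.cong refl) (simp add: cycle_visits_def sum_distrib_right mult.assoc)
  also have "\<dots> = (\<Sum>w\<in>E m - {y}. q y w * (\<Sum>x\<in>E m - {y}. green 0 (E m - {y}) w x * q x z))"
    by (subst sum.swap) (simp add: sum_distrib_left)
  also have "\<dots> = (\<Sum>w\<in>E m - {y}. q y w * (- of_bool (w = z)))"
    by (intro sum.cong refl) (simp only: left)
  also have "\<dots> = - q y z" using A_fin(1) z by (simp add: sum_negf)
  finally show ?thesis .
qed

lemma defect_balance_le:
  assumes m: "y \<in> E m" and z: "z \<in> E m - {y}"
  shows "(\<Sum>x\<in>E m - {y}. defect m x * q x z) \<le> 0"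
proof -
  have "(\<Sum>x\<in>E m. \<pi> x * q x z) \<le> 0" using z by (intro sum_pi_rate_le finite_E E_subset) auto
  hence "\<pi> y * q y z + (\<Sum>x\<in>E m - {y}. \<pi> x * q x z) \<le> 0"
    using sum.remove[OF finite_E m, of "\<lambda>x. \<pi> x * q x z"] by simp
  moreover have "(\<Sum>x\<in>E m - {y}. defect m x * q x z)
      = (\<Sum>x\<in>E m - {y}. \<pi> x * q x z) - \<pi> y * (\<Sum>x\<in>E m - {y}. cycle_visits m x * q x z)"
    by (simp add: defect_def left_diff_distrib sum_subtractf sum_distrib_left mult.assoc)
  ultimately show ?thesis using cycle_balance[OF m z] by simp
qed

text \<open>
  The defect solves \<open>- defect Q \<ge> 0\<close> on \<open>E m - {y}\<close>, because \<open>\<pi>\<close> also receives mass from outside of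
  \<open>E m\<close>; multiplication by the nonnegative inverse preserves the sign.
\<close>

lemma defect_nonneg:
  assumes m: "y \<in> E m" and x: "x \<in> E m"
  shows "0 \<le> defect m x"
proof (cases "x = y")
  case True
  thus ?thesis by (simp add: defect_def cycle_y)
next
  case False
  let ?A = "E m - {y}"
  have xA: "x \<in> ?A" using x False by simp
  have "0 \<le> (\<Sum>z\<in>?A. - (\<Sum>u\<in>?A. defect m u * q u z) * green 0 ?A z x)"
    using defect_balance_le[OF m] by (intro sum_nonneg mult_nonneg_nonneg green_nonneg[OF A_fin]) auto
  also have "\<dots> = (\<Sum>z\<in>?A. \<Sum>u\<in>?A. defect m u * (- (q u z * green 0 ?A z x)))"
    unfolding sum_distrib_right sum_negf[symmetric] by (intro sum.cong refl) simp
  also have "\<dots> = (\<Sum>u\<in>?A. defect m u * shifted 0 ?A (\<lambda>z. green 0 ?A z x) u)"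
    by (subst sum.swap) (simp add: shifted_def sum_distrib_left sum_negf)
  also have "\<dots> = (\<Sum>u\<in>?A. defect m u * of_bool (u = x))"
    using green_right[OF A_fin _ _ xA] by (intro sum.cong refl) simp
  also have "\<dots> = defect m x" using A_fin(1) xA by simp
  finally show ?thesis .
qed

lemma defect_le_pi: "x \<in> S \<Longrightarrow> defect m x \<le> \<pi> x"
  using pi_pos[OF y] cycle_nonneg[of x m] by (simp add: defect_def)

lemma defect_inflow:
  assumes m: "y \<in> E m" and x: "x \<in> E m" "x \<noteq> y" and z: "z \<in> E m - {y}" "x \<noteq> z"
  shows "defect m x * q x z \<le> - q z z * defect m z"
proof -
  let ?A = "E m - {y}"
  have "(\<Sum>u\<in>{x, z}. defect m u * q u z) \<le> (\<Sum>u\<in>?A. defect m u * q u z)"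
    using x z E_subset[of m] defect_nonneg[OF m]
    by (intro sum_mono2 A_fin mult_nonneg_nonneg rate_nonneg) auto
  also have "\<dots> \<le> 0" by (rule defect_balance_le[OF m z(1)])
  finally show ?thesis using z by (simp add: mult.commute)
qed

text \<open>
  The right-hand side is \<open>\<pi> y\<close> times the rate at which excursions start at \<open>y\<close> and leave \<open>E m\<close> before
  their return.
\<close>

lemma defect_inflow_y:
  assumes m: "y \<in> E m" and x: "x \<in> E m" "x \<noteq> y"
  shows "defect m x * q x y
    \<le> \<pi> y * ((\<Sum>z\<in>E m - {y}. q y z * escape (E m) y z) - (\<Sum>z\<in>E m. q y z))"
proof -
  let ?A = "E m - {y}"
  have "defect m x * q x y = (\<Sum>u\<in>{x}. defect m u * q u y)" by simp
  also have "\<dots> \<le> (\<Sum>u\<in>?A. defect m u * q u y)"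
    using x E_subset[of m] y defect_nonneg[OF m]
    by (intro sum_mono2 A_fin mult_nonneg_nonneg rate_nonneg) auto
  also have "\<dots> = (\<Sum>u\<in>?A. \<pi> u * q u y) - \<pi> y * (\<Sum>u\<in>?A. cycle_visits m u * q u y)"
    by (simp add: defect_def left_diff_distrib sum_subtractf sum_distrib_left mult.assoc)
  also have "(\<Sum>u\<in>?A. cycle_visits m u * q u y) = (\<Sum>z\<in>?A. q y z * (1 - escape (E m) y z))"
  proof -
    have "(\<Sum>u\<in>?A. cycle_visits m u * q u y) = (\<Sum>z\<in>?A. q y z * green_fun 0 ?A (\<lambda>x. q x y) z)"
      using sum_cycle[OF m, of "\<lambda>x. q x y"] sum.remove[OF finite_E m, of "\<lambda>u. cycle_visits m u * q u y"]
      by (simp add: cycle_y)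
    also have "\<dots> = (\<Sum>z\<in>?A. q y z * (1 - escape (E m) y z))"
      using one_minus_escape[OF finite_E E_subset m] by (intro sum.cong refl) simp
    finally show ?thesis .
  qed
  also have "(\<Sum>u\<in>?A. \<pi> u * q u y) - \<pi> y * (\<Sum>z\<in>?A. q y z * (1 - escape (E m) y z))
      = (\<Sum>u\<in>E m. \<pi> u * q u y) + \<pi> y * ((\<Sum>z\<in>?A. q y z * escape (E m) y z) - (\<Sum>z\<in>E m. q y z))"
    using sum.remove[OF finite_E m, of "\<lambda>u. \<pi> u * q u y"] sum.remove[OF finite_E m, of "\<lambda>z. q y z"]
    by (simp add: right_diff_distrib sum_subtractf distrib_left)
  also have "(\<Sum>u\<in>E m. \<pi> u * q u y) \<le> 0" by (rule sum_pi_rate_le[OF finite_E E_subset m])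
  finally show ?thesis by simp
qed

text \<open>
  The defect is small at the states that lead directly to \<open>y\<close>, since excursions return with probability
  tending to 1.  By \<open>defect_inflow\<close> smallness at a state passes to all states leading to it, so
  irreducibility spreads it over the whole state space.
\<close>

lemma defect_tendsto_0:
  assumes x: "x \<in> S"
  shows "(\<lambda>m. defect m x) \<longlonglongrightarrow> 0"
proof -
  let ?err = "\<lambda>m. \<pi> y * ((\<Sum>z\<in>E m - {y}. q y z * escape (E m) y z) - (\<Sum>z\<in>E m. q y z))"
  have ev_y: "\<forall>\<^sub>F m in sequentially. y \<in> E m" by (rule eventually_in_E[OF y])
  have err: "?err \<longlonglongrightarrow> 0"
  proof -
    have "(\<lambda>m. \<Sum>z\<in>E m - {y}. q y z * escape (E m) y z) \<longlonglongrightarrow> 0"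
    proof (rule tendsto_sum_dominated[where S = "S - {y}" and g = "q y"])
      show "q y summable_on S - {y}"
        using exit_rate[of "{y}" y] y by (auto simp: summable_on_def)
      show "\<forall>\<^sub>F m in sequentially. \<forall>z\<in>E m - {y}. 0 \<le> q y z * escape (E m) y z \<and> q y z * escape (E m) y z \<le> q y z"
        using ev_y
      proof eventually_elim
        case (elim m)
        have "0 \<le> q y z" if "z \<in> E m - {y}" for z
          using that y E_subset[of m] by (intro rate_nonneg) auto
        thus ?case
          using escape_nonneg[OF finite_E E_subset elim] escape_le_1[OF finite_E E_subset elim]
          by (auto intro!: mult_nonneg_nonneg mult_left_le)
      qed
    next
      fix z assume "z \<in> S - {y}"
      thus "(\<lambda>m. q y z * escape (E m) y z) \<longlonglongrightarrow> 0"
        using tendsto_mult[OF tendsto_const escape_tendsto_0] by fastforce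
    qed (use finite_E E_subset in auto)
    moreover have "(\<lambda>m. \<Sum>z\<in>E m. q y z) \<longlonglongrightarrow> 0"
      by (rule has_sum_tendsto_E[OF row_has_sum[OF y]])
    ultimately have "?err \<longlonglongrightarrow> \<pi> y * (0 - 0)" by (intro tendsto_intros)
    thus ?thesis by simp
  qed
  have sandwich: "(\<lambda>m. defect m x) \<longlonglongrightarrow> 0"
    if x: "x \<in> S" and c: "0 < c" and ub: "\<forall>\<^sub>F m in sequentially. defect m x * c \<le> u m" and u: "u \<longlonglongrightarrow> 0" for x c u
  proof (rule tendsto_sandwich[of "\<lambda>_. 0" _ _ "\<lambda>m. u m / c"])
    show "\<forall>\<^sub>F m in sequentially. 0 \<le> defect m x"
      using ev_y eventually_in_E[OF x] by eventually_elim (rule defect_nonneg)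
    show "\<forall>\<^sub>F m in sequentially. defect m x \<le> u m / c"
      using ub by eventually_elim (use c in \<open>simp add: field_simps\<close>)
    show "(\<lambda>m. u m / c) \<longlonglongrightarrow> 0" using tendsto_divide[OF u tendsto_const[of c]] c by simp
  qed auto
  have "(x, y) \<in> {(a, b). a \<in> S \<and> b \<in> S \<and> a \<noteq> b \<and> 0 < q a b}\<^sup>*"
    using irreducible x y by (auto simp: irreducible_generator_def)
  thus ?thesis
  proof (induction rule: converse_rtrancl_induct)
    case base
    show ?case by (simp add: defect_def cycle_y)
  next
    case (step a z)
    hence a: "a \<in> S" "z \<in> S" "a \<noteq> z" "0 < q a z" by auto
    show ?case
    proof (cases "a = y")
      case True
      thus ?thesis by (simp add: defect_def cycle_y)
    next
      case ay: False
      show ?thesis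
      proof (cases "z = y")
        case True
        have "\<forall>\<^sub>F m in sequentially. defect m a * q a y \<le> ?err m"
          using ev_y eventually_in_E[OF a(1)] by eventually_elim (rule defect_inflow_y[OF _ _ ay])
        from sandwich[OF a(1) _ this err] show ?thesis using a True by simp
      next
        case False
        have "\<forall>\<^sub>F m in sequentially. defect m a * q a z \<le> - q z z * defect m z"
          using ev_y eventually_in_E[OF a(1)] eventually_in_E[OF a(2)]
        proof eventually_elim
          case (elim m)
          show ?case by (rule defect_inflow) (use elim ay False a in simp_all)
        qed
        moreover have "(\<lambda>m. - q z z * defect m z) \<longlonglongrightarrow> 0"
          using tendsto_mult[OF tendsto_const[of "- q z z"] step.IH] by simp
        ultimately show ?thesis by (rule sandwich[OF a(1) a(4)])
      qed
    qed
  qed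
qed

text \<open>
  The stationary mean as a ratio over cycles.  Since the defect lies between 0 and \<open>\<pi>\<close>, pointwise
  convergence to 0 implies convergence of the sums.
\<close>

lemma sum_cycle_tendsto:
  assumes g: "\<And>x. x \<in> S \<Longrightarrow> \<bar>g x\<bar> \<le> 1"
  shows "(\<lambda>m. \<Sum>x\<in>E m. cycle_visits m x * g x) \<longlonglongrightarrow> mean g / \<pi> y"
proof -
  have ev_y: "\<forall>\<^sub>F m in sequentially. y \<in> E m" by (rule eventually_in_E[OF y])
  have "(\<lambda>m. \<Sum>x\<in>E m. defect m x) \<longlonglongrightarrow> 0"
  proof (rule tendsto_sum_dominated[where S = S and g = \<pi>])
    show "\<pi> summable_on S" using pi_sum by (auto simp: summable_on_def)
    show "\<forall>\<^sub>F m in sequentially. \<forall>x\<in>E m. 0 \<le> defect m x \<and> defect m x \<le> \<pi> x"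
      using ev_y by eventually_elim (use defect_nonneg defect_le_pi E_subset in blast)
  qed (use finite_E E_subset defect_tendsto_0 in auto)
  hence "(\<lambda>m. \<Sum>x\<in>E m. defect m x * g x) \<longlonglongrightarrow> 0"
  proof (rule Lim_null_comparison[rotated])
    show "\<forall>\<^sub>F m in sequentially. norm (\<Sum>x\<in>E m. defect m x * g x) \<le> (\<Sum>x\<in>E m. defect m x)"
      using ev_y
    proof eventually_elim
      case (elim m)
      have "norm (\<Sum>x\<in>E m. defect m x * g x) \<le> (\<Sum>x\<in>E m. \<bar>defect m x * g x\<bar>)"
        unfolding real_norm_def by (rule sum_abs)
      also have "\<dots> \<le> (\<Sum>x\<in>E m. defect m x)"
        using defect_nonneg[OF elim] g E_subset by (intro sum_mono) (auto simp: abs_mult intro!: mult_left_le)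
      finally show ?case .
    qed
  qed
  hence "(\<lambda>m. ((\<Sum>x\<in>E m. \<pi> x * g x) - (\<Sum>x\<in>E m. defect m x * g x)) / \<pi> y) \<longlonglongrightarrow> (mean g - 0) / \<pi> y"
    using pi_pos[OF y] by (intro tendsto_intros has_sum_tendsto_E mean_has_sum g) auto
  moreover have "((\<Sum>x\<in>E m. \<pi> x * g x) - (\<Sum>x\<in>E m. defect m x * g x)) / \<pi> y = (\<Sum>x\<in>E m. cycle_visits m x * g x)" for m
  proof -
    have "(\<Sum>x\<in>E m. \<pi> x * g x) - (\<Sum>x\<in>E m. defect m x * g x) = \<pi> y * (\<Sum>x\<in>E m. cycle_visits m x * g x)"
      by (simp add: defect_def left_diff_distrib sum_subtractf sum_distrib_left mult.assoc)
    thus ?thesis using pi_pos[OF y] by simp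
  qed
  ultimately show ?thesis by simp
qed

text \<open>
  Away from \<open>y\<close> both sides agree as soon as \<open>E m\<close> contains \<open>x\<close> and \<open>y\<close>.  At \<open>y\<close> the left-hand side is
  the total of \<open>f\<close> over a cycle minus \<open>f y\<close>, and the total over a cycle tends to \<open>mean f / \<pi> y = 0\<close>.
\<close>

theorem poisson_approximation:
  assumes f: "\<And>x. x \<in> S \<Longrightarrow> \<bar>f x\<bar> \<le> 1" and mean: "mean f = 0" and x: "x \<in> S"
  shows "(\<lambda>m. \<Sum>z\<in>E m. q x z * green_fun 0 (E m - {y}) f z) \<longlonglongrightarrow> - f x"
proof -
  let ?h = "\<lambda>m. green_fun 0 (E m - {y}) f"
  have ev_y: "\<forall>\<^sub>F m in sequentially. y \<in> E m" by (rule eventually_in_E[OF y])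
  have remove: "(\<Sum>z\<in>E m. q x z * ?h m z) = (\<Sum>z\<in>E m - {y}. q x z * ?h m z)" if "y \<in> E m" for m
    using sum.remove[OF finite_E that, of "\<lambda>z. q x z * ?h m z"] A_fin by (simp add: green_fun_zero)
  show ?thesis
  proof (cases "x = y")
    case True
    have "(\<lambda>m. (\<Sum>x\<in>E m. cycle_visits m x * f x) - f y) \<longlonglongrightarrow> 0 / \<pi> y - f y"
      using sum_cycle_tendsto[of f] f unfolding mean by (intro tendsto_intros) simp
    moreover have "\<forall>\<^sub>F m in sequentially. (\<Sum>x\<in>E m. cycle_visits m x * f x) - f y = (\<Sum>z\<in>E m. q x z * ?h m z)"
      using ev_y by eventually_elim (simp add: sum_cycle remove, simp add: True)
    ultimately show ?thesis using True by (simp add: tendsto_cong)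
  next
    case False
    have "\<forall>\<^sub>F m in sequentially. (\<Sum>z\<in>E m. q x z * ?h m z) = - f x"
      using ev_y eventually_in_E[OF x]
    proof eventually_elim
      case (elim m)
      have "shifted 0 (E m - {y}) (?h m) x = f x"
        using elim False by (intro shifted_green_fun A_fin) auto
      thus ?case using remove[OF elim(1)] by (simp add: shifted_def)
    qed
    thus ?thesis by (rule tendsto_eventually)
  qed
qed

end
end

section \<open>The error of a finite truncation\<close>

lemma has_sum_minus:
  fixes f g :: "'s \<Rightarrow> real"
  assumes "(f has_sum a) S" "(g has_sum b) S"
  shows "((\<lambda>x. f x - g x) has_sum (a - b)) S"
  using has_sum_add[OF assms(1), of "\<lambda>x. - g x" "- b"] assms(2) by (simp add: has_sum_uminus)

context irreducible_rates
begin

text \<open>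
  Positivity at \<open>y\<close> comes from the right-hand side of the inequality and spreads backwards along the jumps.
\<close>

lemma supersolution_pos:
  assumes \<gamma>: "0 < \<gamma>" and r: "\<And>x. 0 \<le> r x" and y: "y \<in> S"
    and super: "\<And>F x. finite F \<Longrightarrow> F \<subseteq> S \<Longrightarrow> x \<in> F \<Longrightarrow> \<gamma> * of_bool (x = y) \<le> shifted \<gamma> F r x"
    and x: "x \<in> S"
  shows "0 < r x"
proof -
  have "(x, y) \<in> {(a, b). a \<in> S \<and> b \<in> S \<and> a \<noteq> b \<and> 0 < q a b}\<^sup>*"
    using irreducible x y by (auto simp: irreducible_generator_def)
  thus ?thesis
  proof (induction rule: converse_rtrancl_induct)
    case base
    have "\<gamma> \<le> (\<gamma> - q y y) * r y"
      using super[of "{y}" y] y by (simp add: shifted_def left_diff_distrib)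
    hence "r y \<noteq> 0" using \<gamma> by auto
    thus ?case using r[of y] by simp
  next
    case (step a z)
    hence a: "a \<in> S" "z \<in> S" "a \<noteq> z" "0 < q a z" by auto
    have "0 \<le> \<gamma> * of_bool (a = y)" using \<gamma> by simp
    also have "\<dots> \<le> shifted \<gamma> {a, z} r a" using a by (intro super) auto
    finally have "q a z * r z \<le> (\<gamma> - q a a) * r a" using a by (simp add: shifted_def left_diff_distrib)
    moreover have "0 < q a z * r z" using a step.IH by simp
    ultimately have "r a \<noteq> 0" by auto
    thus ?case using r[of a] by simp
  qed
qed

context
  fixes A :: "'s set" and a :: "'s \<Rightarrow> real"
  assumes A: "finite A" "A \<subseteq> S" and a: "\<And>x. x \<in> A \<Longrightarrow> 0 \<le> a x" "sum a A = 1"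
begin

definition green_row :: "'s \<Rightarrow> real" where
  "green_row z = (\<Sum>x\<in>A. a x * green 0 A x z)"

lemma green_row_nonneg: "0 \<le> green_row z"
  unfolding green_row_def using a by (intro sum_nonneg mult_nonneg_nonneg green_nonneg[OF A]) auto

lemma green_row_zero: "z \<notin> A \<Longrightarrow> green_row z = 0"
  by (simp add: green_row_def green_zero[OF A])

text \<open>
  Together with \<open>green_row_exit\<close> this describes the row \<open>a (- Q\<^sub>A)\<^sup>-\<^sup>1 Q\<close>: it is \<open>- a\<close> on \<open>A\<close>, and it has
  total mass one outside.
\<close>

lemma green_row_rate:
  assumes z: "z \<in> A"
  shows "(\<Sum>x\<in>A. green_row x * q x z) = - a z"
proof -
  have left: "(\<Sum>x\<in>A. green 0 A w x * q x z) = - of_bool (w = z)" if "w \<in> A" for w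
    using green_left[OF A _ that z, of 0] by simp
  have "(\<Sum>x\<in>A. green_row x * q x z) = (\<Sum>w\<in>A. a w * (\<Sum>x\<in>A. green 0 A w x * q x z))"
    unfolding green_row_def sum_distrib_right sum_distrib_left
    by (subst sum.swap) (simp add: mult.assoc)
  also have "\<dots> = (\<Sum>w\<in>A. a w * (- of_bool (w = z)))" by (intro sum.cong refl) (simp only: left)
  also have "\<dots> = - a z" using A z by (simp add: sum_negf)
  finally show ?thesis .
qed

lemma green_row_exit: "(\<Sum>x\<in>A. green_row x * - (\<Sum>z\<in>A. q x z)) = 1"
proof -
  have "(\<Sum>x\<in>A. green_row x * - (\<Sum>z\<in>A. q x z)) = - (\<Sum>z\<in>A. \<Sum>x\<in>A. green_row x * q x z)"
    by (subst sum.swap) (simp add: sum_distrib_left sum_negf)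
  also have "\<dots> = 1" using a(2) by (simp add: green_row_rate sum_negf)
  finally show ?thesis .
qed

lemma green_row_mass_pos: "0 < (\<Sum>x\<in>A. green_row x)"
proof (rule ccontr)
  assume "\<not> ?thesis"
  moreover have "0 \<le> (\<Sum>x\<in>A. green_row x)" by (intro sum_nonneg green_row_nonneg)
  ultimately have "(\<Sum>x\<in>A. green_row x) = 0" by simp
  hence "green_row x = 0" if "x \<in> A" for x
    using sum_nonneg_eq_0_iff[OF A(1), of green_row] green_row_nonneg that by blast
  thus False using green_row_exit by simp
qed

end
end

context exhausted_rates
begin

text \<open>
  Without \<open>C\<close> the function \<open>\<gamma> v\<close> would dominate \<open>green_fun \<gamma> (E m) (\<lambda>_. \<gamma>)\<close>, so \<open>1 \<le> \<gamma> v\<close> for every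
  \<open>\<gamma> > 0\<close>.
\<close>

lemma drift_set_nonempty:
  assumes drift: "drift_condition S q b C v"
  shows "C \<noteq> {}"
proof
  assume C: "C = {}"
  obtain x where x: "x \<in> S" using infinite_states by fastforce
  have v: "0 < v x" using drift x by (simp add: drift_condition_def)
  define \<gamma> where "\<gamma> = 1 / (2 * v x)"
  have \<gamma>: "0 < \<gamma>" using v by (simp add: \<gamma>_def)
  have "\<forall>\<^sub>F m in sequentially. green_fun \<gamma> (E m) (\<lambda>_. \<gamma>) x \<le> \<gamma> * v x"
    using eventually_in_E[OF x]
  proof eventually_elim
    case (elim m)
    show ?case
    proof (rule green_comparison[OF finite_E E_subset _ _ elim])
      fix z assume z: "z \<in> E m"
      have "1 \<le> shifted 0 (E m) v z" using drift_on_finite[OF drift finite_E E_subset z] C by simp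
      moreover have "0 < v z" using drift z E_subset by (auto simp: drift_condition_def)
      hence "0 \<le> \<gamma> * v z" using \<gamma> by simp
      ultimately have "1 \<le> shifted \<gamma> (E m) v z" unfolding shifted_def by linarith
      thus "\<gamma> \<le> shifted \<gamma> (E m) (\<lambda>z. \<gamma> * v z) z" using \<gamma> by (simp add: shifted_scale)
    qed (use \<gamma> in simp)
  qed
  hence "1 \<le> \<gamma> * v x" by (intro tendsto_upperbound[OF nonexplosive[OF \<gamma> x]]) auto
  thus False using v by (simp add: \<gamma>_def)
qed

lemma mean_bounds:
  assumes "\<And>x. x \<in> S \<Longrightarrow> 0 \<le> g x \<and> g x \<le> 1"
  shows "0 \<le> mean g" "mean g \<le> 1"
proof -
  have sum: "((\<lambda>x. \<pi> x * g x) has_sum mean g) S" using assms by (intro mean_has_sum) fastforce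
  show "0 \<le> mean g"
    by (rule has_sum_nonneg[OF sum]) (use assms less_imp_le[OF pi_pos] in auto)
  show "mean g \<le> 1"
    by (rule has_sum_mono[OF sum pi_sum]) (use assms less_imp_le[OF pi_pos] in \<open>auto intro: mult_left_le\<close>)
qed

context
  fixes A :: "'s set" and a v :: "'s \<Rightarrow> real" and c :: real and y :: 's
  assumes A: "finite A" "A \<subseteq> S" and a: "\<And>x. x \<in> A \<Longrightarrow> 0 \<le> a x" "sum a A = 1"
    and y: "y \<in> S" and v: "\<And>x. x \<in> S \<Longrightarrow> (\<lambda>z. q x z * v z) summable_on S"
    and hitting: "\<forall>\<^sub>F m in sequentially. \<forall>x\<in>S. green_fun 0 (E m - {y}) (\<lambda>_. 1) x \<le> v x + c"
begin

text \<open>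
  The row \<open>\<bar>a (- Q\<^sub>A)\<^sup>-\<^sup>1 Q\<bar>\<close> applied to \<open>v + c\<close>; its parts on \<open>A\<close> and outside of \<open>A\<close> have mass one each,
  which gives the term \<open>2 * c\<close>.
\<close>

definition error_mass :: real where
  "error_mass = (\<Sum>x\<in>A. a x * v x) + (\<Sum>x\<in>A. green_row A a x * (\<Sum>\<^sub>\<infinity>z\<in>S - A. q x z * v z)) + 2 * c"

text \<open>
  With \<open>\<mu> = a (- Q\<^sub>A)\<^sup>-\<^sup>1\<close> and \<open>h\<^sub>m\<close> the approximate solution of Poisson's equation for \<open>g\<close>, the left-hand
  side is the limit of \<open>- \<mu> Q h\<^sub>m\<close>, and \<open>\<bar>h\<^sub>m\<bar> \<le> v + c\<close>.
\<close>

lemma green_row_test_bound: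
  assumes g: "\<And>x. x \<in> S \<Longrightarrow> 0 \<le> g x \<and> g x \<le> 1"
  shows "(\<Sum>x\<in>A. green_row A a x * (g x - mean g)) \<le> error_mass"
proof -
  let ?\<mu> = "green_row A a"
  define f where "f x = g x - mean g" for x
  have f: "\<bar>f x\<bar> \<le> 1" if "x \<in> S" for x
    using g[OF that] mean_bounds[of g] g unfolding f_def by (smt (verit))
  have "((\<lambda>x. \<pi> x * g x - \<pi> x * mean g) has_sum (mean g - 1 * mean g)) S"
    using g by (intro has_sum_minus mean_has_sum has_sum_cmult_left pi_sum) fastforce
  hence "mean f = 0" unfolding mean_def f_def
    by (intro infsumI) (simp add: right_diff_distrib mean_def)
  define h where "h m = green_fun 0 (E m - {y}) f" for m
  have lim: "(\<lambda>m. - (\<Sum>x\<in>A. ?\<mu> x * (\<Sum>z\<in>E m. q x z * h m z))) \<longlonglongrightarrow> - (\<Sum>x\<in>A. ?\<mu> x * (- f x))"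
    unfolding h_def using A hitting
    by (intro tendsto_intros poisson_approximation[OF y, of "\<lambda>x. v x + c"] f \<open>mean f = 0\<close>)
      (auto elim: eventually_mono)
  have "\<forall>\<^sub>F m in sequentially. - (\<Sum>x\<in>A. ?\<mu> x * (\<Sum>z\<in>E m. q x z * h m z)) \<le> error_mass"
    using eventually_E_subset[OF A] hitting
  proof eventually_elim
    case (elim m)
    have h: "\<bar>h m z\<bar> \<le> v z + c" if "z \<in> S" for z
    proof -
      have "\<bar>h m z\<bar> \<le> green_fun 0 (E m - {y}) (\<lambda>_. 1) z"
        unfolding h_def using finite_E E_subset f by (intro green_abs_le) auto
      also have "\<dots> \<le> v z + c" using elim that by auto
      finally show ?thesis .
    qed
    \<comment> \<open>contribution of the jumps out of \<open>A\<close>; those within \<open>A\<close> are summed by \<open>green_row_rate\<close>\<close>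
    have out: "- (\<Sum>z\<in>E m - A. q x z * h m z) \<le> (\<Sum>\<^sub>\<infinity>z\<in>S - A. q x z * v z) + c * - (\<Sum>z\<in>A. q x z)"
      if x: "x \<in> A" for x
    proof -
      have xS: "x \<in> S" using x A by auto
      have "((\<lambda>z. q x z * v z) has_sum (\<Sum>\<^sub>\<infinity>z\<in>S - A. q x z * v z)) (S - A)"
        by (intro has_sum_infsum summable_on_subset_banach[OF v[OF xS]]) auto
      hence "((\<lambda>z. q x z * v z + c * q x z) has_sum
          ((\<Sum>\<^sub>\<infinity>z\<in>S - A. q x z * v z) + c * - (\<Sum>z\<in>A. q x z))) (S - A)"
        by (intro has_sum_add has_sum_cmult_right exit_rate[OF A xS])
      moreover have "- (\<Sum>z\<in>E m - A. q x z * h m z) \<le> (\<Sum>z\<in>E m - A. q x z * v z + c * q x z)"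
      proof -
        have "- (q x z * h m z) \<le> q x z * v z + c * q x z" if z: "z \<in> E m - A" for z
        proof -
          have zS: "z \<in> S" using z E_subset by auto
          have "q x z * (- h m z) \<le> q x z * (v z + c)"
            using h[OF zS] x xS z zS by (intro mult_left_mono rate_nonneg) auto
          thus ?thesis by (simp add: algebra_simps)
        qed
        thus ?thesis unfolding sum_negf[symmetric] by (rule sum_mono)
      qed
      moreover have "0 \<le> q x z * v z + c * q x z" if z: "z \<in> S - A" for z
      proof -
        have "0 \<le> v z + c" using h[of z] z by fastforce
        hence "0 \<le> q x z * (v z + c)" using x xS z by (intro mult_nonneg_nonneg rate_nonneg) auto
        thus ?thesis by (simp add: algebra_simps)
      qed
      ultimately show ?thesis
        using has_sum_mono2[OF has_sum_finite[of "E m - A" "\<lambda>z. q x z * v z + c * q x z"]] finite_E E_subset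
        by (smt (verit) Diff_iff Diff_mono finite_Diff order_refl)
    qed
    have split: "(\<Sum>z\<in>E m. q x z * h m z) = (\<Sum>z\<in>A. q x z * h m z) + (\<Sum>z\<in>E m - A. q x z * h m z)" for x
      using sum.subset_diff[OF elim(1) finite_E, of "\<lambda>z. q x z * h m z"] by simp
    have "(\<Sum>x\<in>A. ?\<mu> x * (\<Sum>z\<in>A. q x z * h m z)) = (\<Sum>z\<in>A. (\<Sum>x\<in>A. ?\<mu> x * q x z) * h m z)"
      unfolding sum_distrib_left sum_distrib_right by (subst sum.swap) (simp add: mult.assoc)
    also have "\<dots> = - (\<Sum>z\<in>A. a z * h m z)"
      using green_row_rate[OF A] a by (simp add: sum_negf)
    finally have inside: "- (\<Sum>x\<in>A. ?\<mu> x * (\<Sum>z\<in>A. q x z * h m z)) = (\<Sum>z\<in>A. a z * h m z)" by simp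
    have "(\<Sum>z\<in>A. a z * h m z) \<le> (\<Sum>z\<in>A. a z * (v z + c))"
      using a h A by (intro sum_mono mult_left_mono) (auto simp: abs_le_iff subset_iff)
    also have "\<dots> = (\<Sum>z\<in>A. a z * v z) + c"
      using a(2) by (simp add: distrib_left sum.distrib sum_distrib_right[symmetric])
    finally have in_le: "(\<Sum>z\<in>A. a z * h m z) \<le> (\<Sum>z\<in>A. a z * v z) + c" .
    have "(\<Sum>x\<in>A. ?\<mu> x * - (\<Sum>z\<in>E m - A. q x z * h m z))
        \<le> (\<Sum>x\<in>A. ?\<mu> x * ((\<Sum>\<^sub>\<infinity>z\<in>S - A. q x z * v z) + c * - (\<Sum>z\<in>A. q x z)))"
      using out green_row_nonneg[OF A a] by (intro sum_mono mult_left_mono) auto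
    also have "\<dots> = (\<Sum>x\<in>A. ?\<mu> x * (\<Sum>\<^sub>\<infinity>z\<in>S - A. q x z * v z)) + c * (\<Sum>x\<in>A. ?\<mu> x * - (\<Sum>z\<in>A. q x z))"
      unfolding distrib_left sum.distrib sum_distrib_left by (simp add: mult_ac)
    also have "\<dots> = (\<Sum>x\<in>A. ?\<mu> x * (\<Sum>\<^sub>\<infinity>z\<in>S - A. q x z * v z)) + c"
      by (simp only: green_row_exit[OF A a] mult_1_right)
    finally have out_le: "(\<Sum>x\<in>A. ?\<mu> x * - (\<Sum>z\<in>E m - A. q x z * h m z))
        \<le> (\<Sum>x\<in>A. ?\<mu> x * (\<Sum>\<^sub>\<infinity>z\<in>S - A. q x z * v z)) + c" .
    have "- (\<Sum>x\<in>A. ?\<mu> x * (\<Sum>z\<in>E m. q x z * h m z))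
        = - (\<Sum>x\<in>A. ?\<mu> x * (\<Sum>z\<in>A. q x z * h m z)) + (\<Sum>x\<in>A. ?\<mu> x * - (\<Sum>z\<in>E m - A. q x z * h m z))"
      unfolding split by (simp add: distrib_left sum.distrib sum_negf)
    thus ?case using inside in_le out_le unfolding error_mass_def by linarith
  qed
  hence "- (\<Sum>x\<in>A. ?\<mu> x * (- f x)) \<le> error_mass" by (intro tendsto_upperbound[OF lim]) auto
  hence "(\<Sum>x\<in>A. ?\<mu> x * f x) \<le> error_mass" by (simp add: sum_negf)
  thus ?thesis by (simp add: f_def)
qed

text \<open>
  The test function \<open>g\<close> is the indicator of the set on which the approximation is at least \<open>\<pi>\<close>; the factor 2
  arises since the positive and the negative part of the difference have equal mass.
\<close>

theorem truncation_error:
  shows "(\<Sum>\<^sub>\<infinity>x\<in>S. \<bar>green_row A a x / sum (green_row A a) A - \<pi> x\<bar>)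
    \<le> 2 / sum (green_row A a) A * error_mass"
proof -
  define N where "N = sum (green_row A a) A"
  define p where "p x = green_row A a x / N" for x
  have N: "0 < N" unfolding N_def by (rule green_row_mass_pos[OF A a])
  define g :: "'s \<Rightarrow> real" where "g x = of_bool (\<pi> x \<le> p x)" for x
  have sum_p: "((\<lambda>x. p x * k x) has_sum (\<Sum>x\<in>A. p x * k x)) S" for k
  proof -
    have "((\<lambda>x. p x * k x) has_sum (\<Sum>x\<in>A. p x * k x)) A" using A by (intro has_sum_finite)
    thus ?thesis
      by (subst has_sum_cong_neutral[where T = A])
        (use A in \<open>auto simp: p_def green_row_zero[OF A a]\<close>)
  qed
  have p1: "(\<Sum>x\<in>A. p x) = 1" using N by (simp add: p_def N_def sum_divide_distrib[symmetric])
  have "((\<lambda>x. p x * 1 - \<pi> x) has_sum ((\<Sum>x\<in>A. p x * 1) - 1)) S"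
    by (intro has_sum_minus sum_p pi_sum)
  hence mass: "((\<lambda>x. p x - \<pi> x) has_sum 0) S" using p1 by simp
  have "((\<lambda>x. p x * g x - \<pi> x * g x) has_sum ((\<Sum>x\<in>A. p x * g x) - mean g)) S"
    by (intro has_sum_minus sum_p mean_has_sum) (simp add: g_def)
  hence "((\<lambda>x. 2 * (p x * g x - \<pi> x * g x) - (p x - \<pi> x)) has_sum (2 * ((\<Sum>x\<in>A. p x * g x) - mean g) - 0)) S"
    by (intro has_sum_minus[OF has_sum_cmult_right mass])
  moreover have "2 * (p x * g x - \<pi> x * g x) - (p x - \<pi> x) = \<bar>p x - \<pi> x\<bar>" for x
    by (auto simp: g_def)
  ultimately have "(\<Sum>\<^sub>\<infinity>x\<in>S. \<bar>p x - \<pi> x\<bar>) = 2 * ((\<Sum>x\<in>A. p x * g x) - mean g)"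
    by (intro infsumI) simp
  also have "(\<Sum>x\<in>A. p x * g x) - mean g = (\<Sum>x\<in>A. green_row A a x * (g x - mean g)) / N"
  proof -
    have "(\<Sum>x\<in>A. p x * g x) - mean g = (\<Sum>x\<in>A. p x * g x) - (\<Sum>x\<in>A. p x) * mean g" using p1 by simp
    also have "\<dots> = (\<Sum>x\<in>A. p x * (g x - mean g))"
      by (simp add: right_diff_distrib sum_subtractf sum_distrib_right)
    finally show ?thesis by (simp add: p_def sum_divide_distrib)
  qed
  also have "\<dots> \<le> error_mass / N"
    using N by (intro divide_right_mono green_row_test_bound) (auto simp: g_def)
  finally show ?thesis by (simp add: p_def N_def)
qed

end
end

section \<open>Block-Hessenberg structure and the error bound\<close>

lemma sum_states_upto:
  "(\<Sum>x\<in>states_upto M n. f x) = (\<Sum>k=0..n. \<Sum>j=1..M k. f (k, j))"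
proof -
  have "states_upto M n = Sigma {0..n} (\<lambda>k. {1..M k})"
    by (auto simp: states_upto_def level_def)
  thus ?thesis by (simp add: sum.Sigma)
qed

lemma finite_states_upto: "finite (states_upto M n)"
  by (simp add: states_upto_def level_def)

lemma states_upto_mono: "incseq (states_upto M)"
  by (fastforce simp: incseq_def states_upto_def)

lemma UN_states_upto: "(\<Union>n. states_upto M n) = states M"
  by (auto simp: states_upto_def states_def)

lemma states_upto_subset: "states_upto M n \<subseteq> states M"
  by (auto simp: states_upto_def states_def)

lemma mem_states_upto: "(k, j) \<in> states_upto M n \<longleftrightarrow> k \<le> n \<and> j \<in> {1..M k}"
  by (auto simp: states_upto_def level_def)

lemma infinite_states_if_levels_nonempty:
  assumes "\<And>k. 1 \<le> M k"
  shows "infinite (states M)"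
proof
  assume "finite (states M)"
  hence "finite (fst ` states M)" by simp
  moreover have "fst ` states M = UNIV"
  proof (intro equalityI subsetI UNIV_I)
    fix k have "(k, 1) \<in> states M" using assms[of k] by (auto simp: states_def level_def)
    thus "k \<in> fst ` states M" by force
  qed
  ultimately show False by simp
qed

lemma infsum_states_beyond:
  fixes f :: "nat \<times> nat \<Rightarrow> real"
  assumes "f summable_on (states M - states_upto M n)"
  shows "(\<Sum>\<^sub>\<infinity>z\<in>states M - states_upto M n. f z) = (\<Sum>\<^sub>\<infinity>l\<in>{n+1..}. \<Sum>h=1..M l. f (l, h))"
proof -
  have eq: "states M - states_upto M n = Sigma {n+1..} (\<lambda>l. {1..M l})"
    by (auto simp: states_def states_upto_def level_def)
  have "(\<Sum>\<^sub>\<infinity>l\<in>{n+1..}. \<Sum>\<^sub>\<infinity>h\<in>{1..M l}. f (l, h)) = (\<Sum>\<^sub>\<infinity>(l, h)\<in>Sigma {n+1..} (\<lambda>l. {1..M l}). f (l, h))"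
    using assms unfolding eq by (intro infsum_Sigma'_banach) (simp add: case_prod_beta)
  thus ?thesis by (simp add: eq case_prod_beta)
qed

lemma trunc_inv_green:
  assumes "irreducible_rates (states M) q"
  shows "trunc_inv M q n = irreducible_rates.green q 0 (states_upto M n)"
  unfolding trunc_inv_def irreducible_rates.green_def[OF assms] by simp

text \<open>
  The identity \<open>X (- Q\<^sub>n) = I\<close>, read in the last block row of \<open>X\<close> and in the columns of lower levels, says
  \<open>X\<^sub>n\<^sub>,\<^sub>< (- Q\<^sub>n\<^sub>-\<^sub>1) = X\<^sub>n\<^sub>,\<^sub>n Q\<^sub>n\<^sub>,\<^sub><\<close>, where \<open><\<close> stands for the levels below \<open>n\<close>.  The block \<open>Q\<^sub>n\<^sub>,\<^sub><\<close> is
  concentrated on level \<open>n - 1\<close>, and multiplication by the inverse of \<open>- Q\<^sub>n\<^sub>-\<^sub>1\<close> gives the claim.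
\<close>

lemma U_star_eq_trunc_inv:
  assumes ir: "irreducible_rates (states M) q" and hess: "upper_block_hessenberg M q"
    and i: "i \<in> {1..M n}" and k: "k \<le> n" and j: "j \<in> {1..M k}"
  shows "U_star M q n k i j = trunc_inv M q n (n, i) (k, j)"
proof (cases "k = n")
  case True
  thus ?thesis using j by (simp add: U_star_def U_mat_def)
next
  case False
  interpret irreducible_rates "states M" q by (rule ir)
  let ?S = "states_upto M (n - 1)" and ?G = "trunc_inv M q n" and ?G' = "trunc_inv M q (n - 1)"
  have k: "k < n" using k False by simp
  have kj: "(k, j) \<in> ?S" using k j by (simp add: mem_states_upto)
  have split: "(\<Sum>z\<in>states_upto M n. f z) = (\<Sum>z\<in>?S. f z) + (\<Sum>h=1..M n. f (n, h))" for f :: "_ \<Rightarrow> real"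
    using k by (cases n) (simp_all add: sum_states_upto)
  have left: "(\<Sum>z\<in>?S. ?G (n, i) z * q z w) = - (\<Sum>h=1..M n. ?G (n, i) (n, h) * q (n, h) w)"
    if w: "w \<in> ?S" for w
  proof -
    have "(n, i) \<in> states_upto M n" using i by (simp add: mem_states_upto)
    moreover have "w \<in> states_upto M n" using w k by (cases w) (auto simp: mem_states_upto)
    moreover have "(n, i) \<noteq> w" using w k by (cases w) (auto simp: mem_states_upto)
    ultimately have "(\<Sum>z\<in>states_upto M n. ?G (n, i) z * q z w) = 0"
      using green_left[OF finite_states_upto[of M n] states_upto_subset order_refl, of "(n, i)" w]
      by (simp add: trunc_inv_green[OF ir])
    thus ?thesis by (simp add: split)
  qed
  have right: "(\<Sum>w\<in>?S. q z w * ?G' w (k, j)) = - of_bool (z = (k, j))" if "z \<in> ?S" for z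
    using green_right[OF finite_states_upto states_upto_subset order_refl that kj]
    by (simp add: trunc_inv_green[OF ir] shifted_def)
  have only: "(\<Sum>w\<in>?S. q (n, h) w * ?G' w (k, j)) = U_mat M q n k h j" if h: "h \<in> {1..M n}" for h
  proof -
    have zero: "q (n, h) (l, g) = 0" if "l < n - 1" "g \<in> {1..M l}" for l g
      using hess h that unfolding upper_block_hessenberg_def level_def by auto
    obtain n' where n: "n = Suc n'" using k by (cases n) auto
    have "(\<Sum>w\<in>?S. q (n, h) w * ?G' w (k, j))
        = (\<Sum>l=0..n - 1. \<Sum>g=1..M l. q (n, h) (l, g) * ?G' (l, g) (k, j))"
      by (rule sum_states_upto)
    also have "\<dots> = (\<Sum>l\<in>{n - 1}. \<Sum>g=1..M l. q (n, h) (l, g) * ?G' (l, g) (k, j))"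
      using zero by (intro sum.mono_neutral_right) auto
    finally show ?thesis using k by (simp add: U_mat_def)
  qed
  have "- ?G (n, i) (k, j) = (\<Sum>z\<in>?S. ?G (n, i) z * (- of_bool (z = (k, j))))"
    using kj by (simp add: sum_negf finite_states_upto)
  also have "\<dots> = (\<Sum>z\<in>?S. ?G (n, i) z * (\<Sum>w\<in>?S. q z w * ?G' w (k, j)))"
    by (intro sum.cong refl) (simp only: right)
  also have "\<dots> = (\<Sum>w\<in>?S. (\<Sum>z\<in>?S. ?G (n, i) z * q z w) * ?G' w (k, j))"
    unfolding sum_distrib_left sum_distrib_right by (subst sum.swap) (simp add: mult.assoc)
  also have "\<dots> = (\<Sum>w\<in>?S. - (\<Sum>h=1..M n. ?G (n, i) (n, h) * q (n, h) w) * ?G' w (k, j))"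
    by (intro sum.cong refl) (simp only: left)
  also have "\<dots> = - (\<Sum>h=1..M n. ?G (n, i) (n, h) * (\<Sum>w\<in>?S. q (n, h) w * ?G' w (k, j)))"
    unfolding sum_distrib_left sum_distrib_right mult_minus_left sum_negf by (subst sum.swap) (simp add: mult.assoc)
  also have "\<dots> = - U_star M q n k i j"
    unfolding U_star_def by (intro arg_cong[where f = uminus] sum.cong refl) (simp only: only)
  finally show ?thesis by simp
qed

text \<open>
  For nonempty \<open>C\<close> the supremum in \<open>phi_bar\<close> is over values in \<open>(0, 1]\<close>: positive by irreducibility, and
  at most 1 since the rows of the resolvent kernel are subprobabilities.
\<close>

lemma phi_bar_bounds:
  assumes "regular_chain S q Pr X" and \<beta>: "0 < \<beta>" and C: "finite C" "C \<noteq> {}" "C \<subseteq> S"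
  shows "0 < phi_bar S Pr X C \<beta>"
    and "(\<And>y. y \<in> S \<Longrightarrow> 0 < Min ((\<lambda>x. resolvent_kernel Pr X \<beta> x y) ` C) \<Longrightarrow>
      Min ((\<lambda>x. resolvent_kernel Pr X \<beta> x y) ` C) \<le> B) \<Longrightarrow> phi_bar S Pr X C \<beta> \<le> B"
proof -
  interpret regular_chain S q Pr X by (rule assms)
  let ?\<phi> = "\<lambda>y. Min ((\<lambda>x. resolvent_kernel Pr X \<beta> x y) ` C)"
  have pos: "0 < ?\<phi> y" if y: "y \<in> S" for y
  proof -
    have "0 < resolvent_kernel Pr X \<beta> x y" if "x \<in> C" for x
      using that C by (intro supersolution_pos[OF \<beta> resolvent_nonneg[OF \<beta>] y] resolvent_supersolution \<beta> y) auto
    thus ?thesis using C by simp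
  qed
  obtain x0 where x0: "x0 \<in> C" "x0 \<in> S" using C by auto
  have "?\<phi> y \<le> 1" if "y \<in> S" for y
  proof -
    have "?\<phi> y \<le> resolvent_kernel Pr X \<beta> x0 y" using C x0 by (intro Min_le) auto
    also have "\<dots> \<le> 1" using sum_resolvent_le_1[OF \<beta> x0(2), of "{y}"] that by simp
    finally show ?thesis .
  qed
  hence bdd: "bdd_above (?\<phi> ` S)" by (auto simp: bdd_above_def)
  show "0 < phi_bar S Pr X C \<beta>"
    unfolding phi_bar_def using cSUP_upper[OF x0(2) bdd] pos[OF x0(2)] by linarith
  show "phi_bar S Pr X C \<beta> \<le> B" if "\<And>y. y \<in> S \<Longrightarrow> 0 < ?\<phi> y \<Longrightarrow> ?\<phi> y \<le> B"
    unfolding phi_bar_def using x0 that pos by (intro cSUP_least) auto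
qed

theorem theorem2p1:
  fixes M :: "nat \<Rightarrow> nat"
    and q :: "nat \<times> nat \<Rightarrow> nat \<times> nat \<Rightarrow> real"
    and Pr :: "nat \<times> nat \<Rightarrow> 'w measure"
    and X :: "real \<Rightarrow> 'w \<Rightarrow> nat \<times> nat"
    and \<pi> v :: "nat \<times> nat \<Rightarrow> real"
    and b \<beta> :: real
    and C :: "(nat \<times> nat) set"
    and \<alpha> :: "nat \<Rightarrow> nat \<Rightarrow> real"
  assumes "\<And>k. 1 \<le> M k"
    and "regular_jump_chain (states M) Pr X"
    and "is_generator (states M) Pr X q"
    and "stable_conservative (states M) q"
    and "ergodic_chain (states M) Pr X q"
    and "upper_block_hessenberg M q"
    and "stationary_distribution (states M) q \<pi>"
    and "drift_condition (states M) q b C v"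
    and "0 < \<beta>"
    and "\<And>n. prob_vector_on_phases M n (\<alpha> n)"
  shows "\<forall>n. (\<Sum>\<^sub>\<infinity>x\<in>states M. \<bar>pi_hat M q n (\<alpha> n) x - \<pi> x\<bar>)
            \<le> error_bound M q v b \<beta> (phi_bar (states M) Pr X C \<beta>) (\<alpha> n) n"
proof
  fix n
  let ?S = "states M" and ?A = "states_upto M n"
  have ir: "irreducible_rates ?S q"
    using infinite_states_if_levels_nonempty assms(1,4,5)
    by (auto simp: irreducible_rates_def ergodic_chain_def)
  have rc: "regular_chain ?S q Pr X"
    using ir assms(2,3) by (auto simp: regular_chain_def regular_chain_axioms_def)
  interpret regular_chain ?S q Pr X by (rule rc)
  interpret exhausted_rates ?S q "states_upto M" \<pi>
    using assms(7) by unfold_locales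
      (auto simp: finite_states_upto states_upto_mono UN_states_upto
        intro!: nonexplosion finite_states_upto states_upto_mono UN_states_upto)
  have C: "finite C" "C \<subseteq> ?S" and b: "0 < b"
    and v: "\<And>x. x \<in> ?S \<Longrightarrow> (\<lambda>z. q x z * v z) summable_on ?S"
    using assms(8) by (auto simp: drift_condition_def)
  have C0: "C \<noteq> {}" by (rule drift_set_nonempty[OF assms(8)])
  define a where "a = alpha_hat M n (\<alpha> n)"
  have \<alpha>: "\<And>i. i \<in> {1..M n} \<Longrightarrow> 0 \<le> \<alpha> n i" "(\<Sum>i=1..M n. \<alpha> n i) = 1"
    using assms(10)[of n] by (auto simp: prob_vector_on_phases_def)
  have a_sum: "(\<Sum>x\<in>?A. a x * f x) = (\<Sum>i=1..M n. \<alpha> n i * f (n, i))" for f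
  proof -
    have "(\<Sum>x\<in>?A. a x * f x) = (\<Sum>k\<in>{n}. \<Sum>j=1..M k. a (k, j) * f (k, j))"
      unfolding sum_states_upto
      by (intro sum.mono_neutral_right) (auto simp: a_def alpha_hat_def level_def)
    also have "\<dots> = (\<Sum>i=1..M n. \<alpha> n i * f (n, i))"
      by (auto simp: a_def alpha_hat_def level_def intro!: sum.cong)
    finally show ?thesis .
  qed
  have a_nonneg: "0 \<le> a x" for x using \<alpha>(1) by (auto simp: a_def alpha_hat_def level_def)
  have a_total: "sum a ?A = 1" using a_sum[of "\<lambda>_. 1"] \<alpha>(2) by simp
  have A: "finite ?A" "?A \<subseteq> ?S" by (rule finite_states_upto, rule states_upto_subset)
  let ?row = "green_row ?A a"
  have row: "?row (k, j) = (\<Sum>i=1..M n. \<alpha> n i * U_star M q n k i j)" if "(k, j) \<in> ?A" for k j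
    using that U_star_eq_trunc_inv[OF ir assms(6)]
    by (simp add: green_row_def[OF A a_nonneg a_total] a_sum trunc_inv_green[OF ir] mem_states_upto)
  have pi_hat: "pi_hat M q n (\<alpha> n) x = ?row x / sum ?row ?A" for x
    unfolding pi_hat_def a_def[symmetric] trunc_inv_green[OF ir]
    by (simp add: green_row_def[OF A a_nonneg a_total])
  have row_sum: "(\<Sum>x\<in>?A. ?row x * f x)
      = (\<Sum>i=1..M n. \<alpha> n i * (\<Sum>k=0..n. \<Sum>j=1..M k. U_star M q n k i j * f (k, j)))" for f
  proof -
    have "(\<Sum>x\<in>?A. ?row x * f x)
        = (\<Sum>k=0..n. \<Sum>j=1..M k. \<Sum>i=1..M n. \<alpha> n i * (U_star M q n k i j * f (k, j)))"
      unfolding sum_states_upto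
      by (intro sum.cong refl) (simp add: row mem_states_upto sum_distrib_right mult.assoc)
    also have "\<dots> = (\<Sum>k=0..n. \<Sum>i=1..M n. \<Sum>j=1..M k. \<alpha> n i * (U_star M q n k i j * f (k, j)))"
      by (intro sum.cong refl sum.swap)
    also have "\<dots> = (\<Sum>i=1..M n. \<Sum>k=0..n. \<Sum>j=1..M k. \<alpha> n i * (U_star M q n k i j * f (k, j)))"
      by (rule sum.swap)
    finally show ?thesis by (simp add: sum_distrib_left)
  qed
  define N where "N = (\<Sum>i=1..M n. \<alpha> n i * u_star M q n i)"
  have N: "sum ?row ?A = N" using row_sum[of "\<lambda>_. 1"] by (simp add: N_def u_star_def)
  have N_pos: "0 < N" using green_row_mass_pos[OF A a_nonneg a_total] by (simp add: N)
  define B where "B = (\<Sum>i=1..M n. \<alpha> n i * (v (n, i) + (\<Sum>k=0..n. \<Sum>j=1..M k. U_star M q n k i j *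
            (\<Sum>\<^sub>\<infinity>l\<in>{n+1..}. \<Sum>h=1..M l. q (k, j) (l, h) * v (l, h)))))"
  have B: "(\<Sum>x\<in>?A. a x * v x) + (\<Sum>x\<in>?A. ?row x * (\<Sum>\<^sub>\<infinity>z\<in>?S - ?A. q x z * v z)) = B"
  proof -
    have "(\<Sum>\<^sub>\<infinity>z\<in>?S - ?A. q x z * v z) = (\<Sum>\<^sub>\<infinity>l\<in>{n+1..}. \<Sum>h=1..M l. q x (l, h) * v (l, h))"
      if "x \<in> ?A" for x
      using that A v by (intro infsum_states_beyond summable_on_subset_banach[OF v]) auto
    hence "(\<Sum>x\<in>?A. ?row x * (\<Sum>\<^sub>\<infinity>z\<in>?S - ?A. q x z * v z))
        = (\<Sum>x\<in>?A. ?row x * (\<Sum>\<^sub>\<infinity>l\<in>{n+1..}. \<Sum>h=1..M l. q x (l, h) * v (l, h)))"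
      by (intro sum.cong refl) simp
    thus ?thesis unfolding B_def row_sum a_sum by (simp add: distrib_left sum.distrib)
  qed
  let ?err = "\<Sum>\<^sub>\<infinity>x\<in>?S. \<bar>pi_hat M q n (\<alpha> n) x - \<pi> x\<bar>"
  \<comment> \<open>The bound with a fixed reference state; the supremum over the reference states is taken at the end.\<close>
  let ?\<phi> = "\<lambda>y. Min ((\<lambda>x. resolvent_kernel Pr X \<beta> x y) ` C)"
  have bound: "?err \<le> 2 / N * (B + 2 * b / (\<beta> * ?\<phi> y))" if y: "y \<in> ?S" and pos: "0 < ?\<phi> y" for y
  proof -
    have hit: "\<forall>\<^sub>F m in sequentially. \<forall>x\<in>?S.
        green_fun 0 (states_upto M m - {y}) (\<lambda>_. 1) x \<le> v x + b * (1 / (\<beta> * ?\<phi> y))"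
      using eventually_E_subset[OF C] eventually_in_E[OF y]
    proof eventually_elim
      case (elim m)
      have "green_fun 0 (states_upto M m - {y}) (indicator C) x \<le> 1 / (\<beta> * ?\<phi> y)" for x
      proof (rule occupation_bound[OF finite_E E_subset elim(2,1) assms(9)])
        show "?\<phi> y \<le> resolvent_kernel Pr X \<beta> x y" if "x \<in> C" for x
          using C that by (intro Min_le) auto
        show "\<beta> * of_bool (x = z) \<le> shifted \<beta> (states_upto M m) (\<lambda>x. resolvent_kernel Pr X \<beta> x z) x"
          if "x \<in> states_upto M m" "z \<in> states_upto M m" for x z
          using that E_subset by (intro resolvent_supersolution assms(9) finite_E) auto
      qed (use E_subset[of m] in \<open>auto intro!: resolvent_nonneg sum_resolvent_le_1 assms(9) finite_E pos\<close>)
      thus ?case using finite_E[of m] E_subset[of m] by (intro ballI hitting_time_bound[OF assms(8)]) auto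
    qed
    from truncation_error[OF A a_nonneg a_total y v hit]
    have "?err \<le> 2 / N * error_mass ?A a v (b * (1 / (\<beta> * ?\<phi> y)))" by (simp add: pi_hat N)
    also have "error_mass ?A a v (b * (1 / (\<beta> * ?\<phi> y))) = B + 2 * b / (\<beta> * ?\<phi> y)"
      using error_mass_def[OF A a_nonneg a_total y v hit] B by simp
    finally show ?thesis .
  qed
  show "?err \<le> error_bound M q v b \<beta> (phi_bar ?S Pr X C \<beta>) (\<alpha> n) n"
  proof (cases "?err \<le> 2 / N * B")
    case True
    have "0 \<le> 2 / N * (2 * b / (\<beta> * phi_bar ?S Pr X C \<beta>))"
      using N_pos b assms(9) phi_bar_bounds(1)[OF rc assms(9) C(1) C0 C(2)] by simp
    thus ?thesis using True unfolding error_bound_def B_def[symmetric] N_def[symmetric]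
      by (simp only: distrib_left)
  next
    case False
    \<comment> \<open>solve the bound for the kernel value of the reference state, then pass to the supremum\<close>
    define D where "D = ?err * N / 2 - B"
    have D: "0 < D" using False N_pos by (simp add: D_def field_simps)
    have "?\<phi> y \<le> 2 * b / (\<beta> * D)" if "y \<in> ?S" "0 < ?\<phi> y" for y
    proof -
      define Z where "Z = B + 2 * b / (\<beta> * ?\<phi> y)"
      have "?err \<le> 2 / N * Z" unfolding Z_def by (rule bound[OF that])
      hence "?err * N / 2 \<le> Z" using N_pos by (simp add: field_simps)
      hence "D \<le> 2 * b / (\<beta> * ?\<phi> y)" unfolding D_def Z_def by linarith
      thus ?thesis using D that(2) assms(9) by (simp add: field_simps)
    qed
    hence "phi_bar ?S Pr X C \<beta> \<le> 2 * b / (\<beta> * D)"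
      by (rule phi_bar_bounds(2)[OF rc assms(9) C(1) C0 C(2)])
    moreover have pos: "0 < phi_bar ?S Pr X C \<beta>"
      by (rule phi_bar_bounds(1)[OF rc assms(9) C(1) C0 C(2)])
    ultimately have "D \<le> 2 * b / (\<beta> * phi_bar ?S Pr X C \<beta>)"
      using D assms(9) by (simp add: field_simps)
    hence "2 / N * (?err * N / 2) \<le> 2 / N * (B + 2 * b / (\<beta> * phi_bar ?S Pr X C \<beta>))"
      using N_pos by (intro mult_left_mono) (auto simp: D_def)
    thus ?thesis unfolding error_bound_def B_def[symmetric] N_def[symmetric] using N_pos by simp
  qed
qed

end
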